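(* Let $p,q\colon[0,\infty)\to\mathbb{R}$ be smooth functions with $p(x)>0$ for all $x$, and suppose that $p(x)=1$ and $q(x)=0$ for all sufficiently large $x$. Let $D=-\frac{d}{dx}\,p(x)\,\frac{d}{dx}+q(x)$, regarded as a self-adjoint operator on $L^2(0,\infty)$, namely the closure of the essentially self-adjoint operator with domain the smooth compactly supported functions on $[0,\infty)$ that vanish at $0$. Let $g$ and $h$ be smooth, compactly supported functions on $[0,\infty)$. If $0<\alpha<\beta$, and if $P_{[\alpha,\beta]}$ is the spectral projection of $D$ associated to the interval $[\alpha,\beta]$, then $$\langle g,P_{[\alpha,\beta]}h\rangle=\frac{1}{4\pi}\int_\alpha^\beta\langle g,F_\lambda\rangle\,\langle F_\lambda,h\rangle\,\frac{1}{|c(\lambda)|^2}\,\frac{d\lambda}{\sqrt{\lambda}},$$ where the integral is absolutely convergent, $F_\lambda\colon[0,\infty)\to\mathbb{R}$ is the solution of $DF_\lambda=\lambda F_\lambda$ with $F_\lambda(0)=0$ and $F_\lambda'(0)=1$, and $c(\lambda)\in\mathbb{C}$ is characterized by $$\lim_{x\to+\infty}\Bigl(F_\lambda(x)-c(\lambda)e^{i\sqrt{\lambda}\,x}-\overline{c(\lambda)}\,e^{-i\sqrt{\lambda}\,x}\Bigr)=0.$$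
   Context: All inner products are standard $L^2$-inner products on $(0,\infty)$, conjugate-linear in the first variable: $\langle u,v\rangle=\int_0^\infty\overline{u(x)}\,v(x)\,dx$ (for $\langle g,F_\lambda\rangle$ and $\langle F_\lambda,h\rangle$ this makes sense because $g,h$ have compact support). *)

theory Defs
  imports "HOL-Analysis.Analysis"
begin

section \<open>Functions on the half-line\<close>

text \<open>A function on [0,\<infinity>) is represented by a function on the reals, of which only
  the values on [0,\<infinity>) matter. Derivatives at 0 are one-sided.\<close>

definition hl_deriv :: "(real \<Rightarrow> 'a::real_normed_vector) \<Rightarrow> real \<Rightarrow> 'a" where
  "hl_deriv f x = vector_derivative f (at x within {0..})"

definition hl_smooth :: "(real \<Rightarrow> 'a::real_normed_vector) \<Rightarrow> bool" where
  "hl_smooth f \<longleftrightarrow> (\<forall>n. (hl_deriv ^^ n) f differentiable_on {0..})"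

definition hl_test_function :: "(real \<Rightarrow> 'a::real_normed_vector) \<Rightarrow> bool" where
  "hl_test_function f \<longleftrightarrow> hl_smooth f \<and> (\<exists>R. \<forall>x>R. f x = 0)"

text \<open>The formal expression -(p f')' + q f.\<close>

definition sturm_liouville ::
  "(real \<Rightarrow> real) \<Rightarrow> (real \<Rightarrow> real) \<Rightarrow> (real \<Rightarrow> 'a::real_normed_vector) \<Rightarrow> real \<Rightarrow> 'a" where
  "sturm_liouville p q f x = - hl_deriv (\<lambda>y. p y *\<^sub>R hl_deriv f y) x + q x *\<^sub>R f x"

text \<open>Differentiability is required explicitly, because \<^const>\<open>vector_derivative\<close> is total.\<close>

definition regular_solution ::
  "(real \<Rightarrow> real) \<Rightarrow> (real \<Rightarrow> real) \<Rightarrow> real \<Rightarrow> (real \<Rightarrow> real) \<Rightarrow> bool" where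
  "regular_solution p q l f \<longleftrightarrow>
     f differentiable_on {0..} \<and>
     (\<lambda>x. p x *\<^sub>R hl_deriv f x) differentiable_on {0..} \<and>
     (\<forall>x\<ge>0. sturm_liouville p q f x = l * f x) \<and>
     f 0 = 0 \<and> hl_deriv f 0 = 1"

definition asymptotic_coeff :: "real \<Rightarrow> (real \<Rightarrow> real) \<Rightarrow> complex \<Rightarrow> bool" where
  "asymptotic_coeff l f c \<longleftrightarrow>
     ((\<lambda>x. complex_of_real (f x)
          - c * exp (\<i> * complex_of_real (sqrt l * x))
          - cnj c * exp (- (\<i> * complex_of_real (sqrt l * x)))) \<longlongrightarrow> 0) at_top"


section \<open>The Hilbert space of square-integrable functions on the half-line\<close>

text \<open>Elements of the Hilbert space are represented by functions, and equality in it is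
  equality almost everywhere.\<close>

abbreviation hl_measure :: "real measure" where
  "hl_measure \<equiv> lebesgue_on {0<..}"

definition L2 :: "(real \<Rightarrow> complex) set" where
  "L2 = {u \<in> borel_measurable hl_measure. integrable hl_measure (\<lambda>x. (norm (u x))\<^sup>2)}"

definition l2_inner :: "(real \<Rightarrow> complex) \<Rightarrow> (real \<Rightarrow> complex) \<Rightarrow> complex" where
  "l2_inner u v = (LINT x|hl_measure. cnj (u x) * v x)"

definition l2_norm :: "(real \<Rightarrow> complex) \<Rightarrow> real" where
  "l2_norm u = sqrt (LINT x|hl_measure. (norm (u x))\<^sup>2)"

definition l2_eq :: "(real \<Rightarrow> complex) \<Rightarrow> (real \<Rightarrow> complex) \<Rightarrow> bool" where
  "l2_eq u v \<longleftrightarrow> (AE x in hl_measure. u x = v x)"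


section \<open>Unbounded operators and their spectral projections\<close>

text \<open>An unbounded operator is given by its graph.\<close>

type_synonym l2_operator = "((real \<Rightarrow> complex) \<times> (real \<Rightarrow> complex)) set"

definition l2_closure :: "l2_operator \<Rightarrow> l2_operator" where
  "l2_closure T = {(u, v). u \<in> L2 \<and> v \<in> L2 \<and>
     (\<exists>U V. (\<forall>n::nat. (U n, V n) \<in> T) \<and>
        (\<lambda>n. l2_norm (\<lambda>x. U n x - u x)) \<longlonglongrightarrow> 0 \<and>
        (\<lambda>n. l2_norm (\<lambda>x. V n x - v x)) \<longlonglongrightarrow> 0)}"

definition dirichlet_core :: "(real \<Rightarrow> real) \<Rightarrow> (real \<Rightarrow> real) \<Rightarrow> l2_operator" where
  "dirichlet_core p q = {(u, sturm_liouville p q u) | u. hl_test_function u \<and> u 0 = 0}"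

definition dirichlet_operator :: "(real \<Rightarrow> real) \<Rightarrow> (real \<Rightarrow> real) \<Rightarrow> l2_operator" where
  "dirichlet_operator p q = l2_closure (dirichlet_core p q)"

definition l2_projection :: "((real \<Rightarrow> complex) \<Rightarrow> (real \<Rightarrow> complex)) \<Rightarrow> bool" where
  "l2_projection P \<longleftrightarrow>
     (\<forall>u\<in>L2. P u \<in> L2) \<and>
     (\<forall>u\<in>L2. \<forall>v\<in>L2. l2_eq u v \<longrightarrow> l2_eq (P u) (P v)) \<and>
     (\<forall>u\<in>L2. \<forall>v\<in>L2. \<forall>a b. l2_eq (P (\<lambda>x. a * u x + b * v x)) (\<lambda>x. a * P u x + b * P v x)) \<and>
     (\<forall>u\<in>L2. l2_eq (P (P u)) (P u)) \<and>
     (\<forall>u\<in>L2. \<forall>v\<in>L2. l2_inner u (P v) = l2_inner (P u) v)"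

definition projection_valued_measure ::
  "(real set \<Rightarrow> (real \<Rightarrow> complex) \<Rightarrow> (real \<Rightarrow> complex)) \<Rightarrow> bool" where
  "projection_valued_measure E \<longleftrightarrow>
     (\<forall>S\<in>sets borel. l2_projection (E S)) \<and>
     (\<forall>u\<in>L2. l2_eq (E UNIV u) u) \<and>
     (\<forall>S\<in>sets borel. \<forall>S'\<in>sets borel. \<forall>u\<in>L2. l2_eq (E (S \<inter> S') u) (E S (E S' u))) \<and>
     (\<forall>A. (\<forall>n::nat. A n \<in> sets borel) \<longrightarrow> disjoint_family A \<longrightarrow>
        (\<forall>u\<in>L2. (\<lambda>n. l2_norm (\<lambda>x. (\<Sum>i<n. E (A i) u x) - E (\<Union>i. A i) u x)) \<longlonglongrightarrow> 0))"

definition scalar_spectral_measure ::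
  "(real set \<Rightarrow> (real \<Rightarrow> complex) \<Rightarrow> (real \<Rightarrow> complex)) \<Rightarrow> (real \<Rightarrow> complex) \<Rightarrow> real measure" where
  "scalar_spectral_measure E u =
     measure_of UNIV (sets borel) (\<lambda>S. ennreal (Re (l2_inner u (E S u))))"

text \<open>T is the integral of t with respect to dE(t). For a linear operator T the quadratic
  form on the domain determines T by polarization, and T is then self-adjoint. The spectral
  theorem says that every self-adjoint T has exactly one such E (up to almost everywhere
  equality).\<close>

definition spectral_resolution ::
  "l2_operator \<Rightarrow> (real set \<Rightarrow> (real \<Rightarrow> complex) \<Rightarrow> (real \<Rightarrow> complex)) \<Rightarrow> bool" where
  "spectral_resolution T E \<longleftrightarrow>
     projection_valued_measure E \<and>
     (\<forall>u\<in>L2. u \<in> Domain T \<longleftrightarrow> integrable (scalar_spectral_measure E u) (\<lambda>t. t\<^sup>2)) \<and>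
     (\<forall>(u, v)\<in>T. l2_inner u v = complex_of_real (LINT t|scalar_spectral_measure E u. t))"

definition spectral_projection ::
  "l2_operator \<Rightarrow> real set \<Rightarrow> ((real \<Rightarrow> complex) \<Rightarrow> (real \<Rightarrow> complex)) \<Rightarrow> bool" where
  "spectral_projection T S P \<longleftrightarrow> (\<exists>E. spectral_resolution T E \<and> P = E S)"

end

(* Write z = l + i e. If u solves (D - z) u = f weakly, then localizing to short spectral intervals gives
   |u|^2 = int |t - z|^(-2) d mu_f(t) for the scalar spectral measure mu_f, so e |u|^2 is the Poisson
   integral of mu_f at z. By Stieltjes inversion the density of mu_g on [alpha, beta] is therefore 1/pi times
   the limit of e |u|^2 as e tends to 0, and for this it is enough to solve the equation with right-hand
   side g + r where |r| = O(e). Such a u is obtained from real values of the spectral parameter only: solve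
   (D - l) u = g on [0,R] backwards from a boundary value a at R, and continue by
   a exp((i k - d)(x - R)) with k = sqrt l and d = e / (2 k). Green's identity with F_l shows that u(0) = 0 for
   a = (int F_l g) / (F_l'(R) - (i k - d) F_l(R)), and e |u|^2 tends to
   k |a|^2 = |int F_l g|^2 / (4 k |c(l)|^2). Energy estimates make everything uniform in l, and polarization
   passes from the case g = h to the general one. *)

theory Submission
  imports Defs
begin

section \<open>The semi-inner product space of square-integrable functions\<close>

text \<open>What is known about the spectral projections is thin: additivity, the domain of the
  operator and its diagonal quadratic form. That the operator is nearly the scalar m on a short
  spectral interval around m has to be extracted from this by polarization. Complex spectral
  parameters would bring in solutions other than F_l and their limits at the real axis. At real l
  Green's identity involves F_l itself, and the cost is the residual r. It is small because (i k -
  d)^2 = -(l + i e) + d^2 for d = e / (2 k): beyond R the residual is -d^2 u on a tail of squared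
  norm |a|^2 / (2 d), which adds O(e^3) to |r|^2, and on [0,R] it is -i e u with u bounded. So |r| =
  O(e) although |u|^2 may grow like 1/e. The tail also carries the limit: e |a|^2 / (2 d) = k |a|^2,
  while [0,R] contributes O(e). The denominator of a cannot vanish: F_l is real, so its squared
  modulus is (G + d F)^2 + l F^2 at R, with G = F_l', and F and G are not both 0 there.\<close>

definition lincomb :: "complex \<Rightarrow> (real \<Rightarrow> complex) \<Rightarrow> complex \<Rightarrow> (real \<Rightarrow> complex) \<Rightarrow> real \<Rightarrow> complex" where
  "lincomb a u b v = (\<lambda>x. a * u x + b * v x)"

lemma L2_integrable_mult:
  assumes "u \<in> L2" "v \<in> L2"
  shows "integrable hl_measure (\<lambda>x. cnj (u x) * v x)"
proof (rule Bochner_Integration.integrable_bound)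
  show "integrable hl_measure (\<lambda>x. (norm (u x))\<^sup>2 + (norm (v x))\<^sup>2)"
    using assms by (auto simp: L2_def)
  have "u \<in> borel_measurable hl_measure" "v \<in> borel_measurable hl_measure"
    using assms by (auto simp: L2_def)
  moreover have "cnj \<in> borel_measurable borel"
    by (intro borel_measurable_continuous_onI continuous_intros)
  ultimately show "(\<lambda>x. cnj (u x) * v x) \<in> borel_measurable hl_measure"
    by measurable
  have "norm (cnj (u x) * v x) \<le> (norm (u x))\<^sup>2 + (norm (v x))\<^sup>2" for x
  proof -
    have "0 \<le> (norm (u x) - norm (v x))\<^sup>2" by simp
    then have "2 * (norm (u x) * norm (v x)) \<le> (norm (u x))\<^sup>2 + (norm (v x))\<^sup>2"
      by (simp add: power2_eq_square algebra_simps)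
    moreover have "0 \<le> norm (u x) * norm (v x)" by simp
    ultimately show ?thesis unfolding norm_mult complex_mod_cnj by linarith
  qed
  then show "AE x in hl_measure. norm (cnj (u x) * v x) \<le> norm ((norm (u x))\<^sup>2 + (norm (v x))\<^sup>2)"
    by (simp add: abs_of_nonneg)
qed

lemma L2_lincomb [simp, intro]:
  assumes "u \<in> L2" "v \<in> L2"
  shows "lincomb a u b v \<in> L2"
proof -
  have m: "u \<in> borel_measurable hl_measure" "v \<in> borel_measurable hl_measure"
    using assms by (auto simp: L2_def)
  have meas: "lincomb a u b v \<in> borel_measurable hl_measure"
    unfolding lincomb_def using m by measurable
  have "integrable hl_measure (\<lambda>x. (norm (lincomb a u b v x))\<^sup>2)"
  proof (rule Bochner_Integration.integrable_bound)
    show "integrable hl_measure (\<lambda>x. 2 * (norm a)\<^sup>2 * (norm (u x))\<^sup>2 + 2 * (norm b)\<^sup>2 * (norm (v x))\<^sup>2)"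
      using assms by (auto simp: L2_def)
    show "(\<lambda>x. (norm (lincomb a u b v x))\<^sup>2) \<in> borel_measurable hl_measure"
      using meas by measurable
    have "(norm (lincomb a u b v x))\<^sup>2 \<le> 2 * (norm a)\<^sup>2 * (norm (u x))\<^sup>2 + 2 * (norm b)\<^sup>2 * (norm (v x))\<^sup>2" for x
    proof -
      have "norm (lincomb a u b v x) \<le> norm a * norm (u x) + norm b * norm (v x)"
        unfolding lincomb_def by (metis norm_mult norm_triangle_ineq)
      then have "(norm (lincomb a u b v x))\<^sup>2 \<le> (norm a * norm (u x) + norm b * norm (v x))\<^sup>2"
        by (rule power_mono) simp
      also have "\<dots> \<le> 2 * (norm a * norm (u x))\<^sup>2 + 2 * (norm b * norm (v x))\<^sup>2"
        using zero_le_power2[of "norm a * norm (u x) - norm b * norm (v x)"]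
        by (simp add: power2_eq_square algebra_simps)
      finally show ?thesis by (simp add: power_mult_distrib)
    qed
    then show "AE x in hl_measure. norm ((norm (lincomb a u b v x))\<^sup>2)
       \<le> norm (2 * (norm a)\<^sup>2 * (norm (u x))\<^sup>2 + 2 * (norm b)\<^sup>2 * (norm (v x))\<^sup>2)"
      by (simp add: abs_of_nonneg)
  qed
  with meas show ?thesis by (simp add: L2_def)
qed

lemma l2_inner_lincomb_right:
  assumes "w \<in> L2" "u \<in> L2" "v \<in> L2"
  shows "l2_inner w (lincomb a u b v) = a * l2_inner w u + b * l2_inner w v"
proof -
  have "(LINT x|hl_measure. cnj (w x) * (a * u x + b * v x))
      = (LINT x|hl_measure. a * (cnj (w x) * u x) + b * (cnj (w x) * v x))"
    by (simp add: algebra_simps)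
  also have "\<dots> = a * (LINT x|hl_measure. cnj (w x) * u x) + b * (LINT x|hl_measure. cnj (w x) * v x)"
    using assms by (subst Bochner_Integration.integral_add) (auto intro!: L2_integrable_mult)
  finally show ?thesis by (simp add: l2_inner_def lincomb_def)
qed

lemma cnj_l2_inner: "cnj (l2_inner u v) = l2_inner v u"
  unfolding l2_inner_def Bochner_Integration.integral_cnj [symmetric] by (simp add: mult.commute)

lemma l2_inner_lincomb_left:
  assumes "w \<in> L2" "u \<in> L2" "v \<in> L2"
  shows "l2_inner (lincomb a u b v) w = cnj a * l2_inner u w + cnj b * l2_inner v w"
proof -
  have "cnj (l2_inner w (lincomb a u b v)) = cnj (a * l2_inner w u + b * l2_inner w v)"
    using l2_inner_lincomb_right[OF assms] by simp
  then show ?thesis by (simp add: cnj_l2_inner)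
qed

lemmas l2_inner_lincomb = l2_inner_lincomb_left l2_inner_lincomb_right

lemma l2_norm_nonneg [simp]: "0 \<le> l2_norm u"
  by (simp add: l2_norm_def)

lemma l2_norm_power2: "(l2_norm u)\<^sup>2 = (LINT x|hl_measure. (norm (u x))\<^sup>2)"
  by (simp add: l2_norm_def)

lemma l2_inner_same: "l2_inner u u = complex_of_real ((l2_norm u)\<^sup>2)"
proof -
  have "cnj (u x) * u x = complex_of_real ((norm (u x))\<^sup>2)" for x
    by (metis complex_norm_square mult.commute)
  then show ?thesis
    unfolding l2_inner_def l2_norm_power2 by (simp only: integral_complex_of_real)
qed

lemma l2_norm_lincomb_power2:
  assumes "u \<in> L2" "v \<in> L2"
  shows "(l2_norm (lincomb a u b v))\<^sup>2
    = (norm a)\<^sup>2 * (l2_norm u)\<^sup>2 + 2 * Re (cnj a * b * l2_inner u v) + (norm b)\<^sup>2 * (l2_norm v)\<^sup>2"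
proof -
  have "complex_of_real ((l2_norm (lincomb a u b v))\<^sup>2)
     = cnj a * a * l2_inner u u + (cnj a * b * l2_inner u v + cnj (cnj a * b * l2_inner u v))
       + cnj b * b * l2_inner v v"
    unfolding l2_inner_same [symmetric] using assms
    by (simp add: l2_inner_lincomb cnj_l2_inner algebra_simps)
  also have "\<dots> = complex_of_real ((norm a)\<^sup>2 * (l2_norm u)\<^sup>2 + 2 * Re (cnj a * b * l2_inner u v)
      + (norm b)\<^sup>2 * (l2_norm v)\<^sup>2)"
    unfolding complex_add_cnj l2_inner_same
    by (simp add: complex_norm_square[symmetric] mult.commute[of "cnj _"])
  finally show ?thesis by (simp only: of_real_eq_iff)
qed

lemma l2_Cauchy_Schwarz:
  assumes "u \<in> L2" "v \<in> L2"
  shows "norm (l2_inner u v) \<le> l2_norm u * l2_norm v"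
proof -
  define X where "X = l2_inner u v"
  \<comment> \<open>The coefficient -s \<open>cnj X\<close> has the phase that turns the cross term
    into -2 s |X|^2, so a real parameter s is enough.\<close>
  have key: "2 * s * (norm X)\<^sup>2 \<le> (l2_norm u)\<^sup>2 + s\<^sup>2 * (norm X)\<^sup>2 * (l2_norm v)\<^sup>2" for s :: real
  proof -
    have "0 \<le> (l2_norm (lincomb 1 u (- of_real s * cnj X) v))\<^sup>2" by simp
    also have "\<dots> = (l2_norm u)\<^sup>2 - 2 * s * (norm X)\<^sup>2 + s\<^sup>2 * (norm X)\<^sup>2 * (l2_norm v)\<^sup>2"
      unfolding l2_norm_lincomb_power2[OF assms] X_def[symmetric]
      by (simp add: norm_mult power_mult_distrib mult.assoc mult.commute[of "cnj X"]
          complex_norm_square[symmetric])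
    finally show ?thesis by simp
  qed
  show ?thesis
  proof (cases "l2_norm v = 0")
    \<comment> \<open>\<open>l2_norm\<close> is only a seminorm on functions, so v may be a nonzero
      null function. Here \<open>key\<close> is linear in s and would fail for large s if X were not
      0.\<close>
    case True
    have "(norm X)\<^sup>2 = 0"
    proof (rule ccontr)
      assume "(norm X)\<^sup>2 \<noteq> 0"
      with key[of "((l2_norm u)\<^sup>2 + 1) / (norm X)\<^sup>2"] True
      have "2 * ((l2_norm u)\<^sup>2 + 1) \<le> (l2_norm u)\<^sup>2" by simp
      then show False using zero_le_power2[of "l2_norm u"] by argo
    qed
    then show ?thesis by (simp add: X_def True)
  next
    case False
    define n where "n = (l2_norm v)\<^sup>2"
    have n: "n > 0" using False by (simp add: n_def)
    have "2 * (1/n) * (norm X)\<^sup>2 \<le> (l2_norm u)\<^sup>2 + (1/n)\<^sup>2 * (norm X)\<^sup>2 * n"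
      using key[of "1/n"] by (simp add: n_def)
    then have "(norm X)\<^sup>2 \<le> (l2_norm u)\<^sup>2 * n"
      using n by (simp add: field_simps power2_eq_square)
    then have "(norm X)\<^sup>2 \<le> (l2_norm u * l2_norm v)\<^sup>2"
      by (simp add: n_def power_mult_distrib)
    then show ?thesis unfolding X_def by (rule power2_le_imp_le) simp
  qed
qed

lemma l2_inner_null_right:
  assumes "u \<in> L2" "v \<in> L2" "l2_norm v = 0"
  shows "l2_inner u v = 0"
  using l2_Cauchy_Schwarz[OF assms(1,2)] assms(3) by simp

lemma l2_norm_lincomb_le:
  assumes "u \<in> L2" "v \<in> L2"
  shows "l2_norm (lincomb a u b v) \<le> norm a * l2_norm u + norm b * l2_norm v"
proof (rule power2_le_imp_le)
  have "Re (cnj a * b * l2_inner u v) \<le> norm a * norm b * (l2_norm u * l2_norm v)"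
    using complex_Re_le_cmod[of "cnj a * b * l2_inner u v"]
      mult_left_mono[OF l2_Cauchy_Schwarz[OF assms], of "norm a * norm b"]
    by (simp add: norm_mult)
  then show "(l2_norm (lincomb a u b v))\<^sup>2 \<le> (norm a * l2_norm u + norm b * l2_norm v)\<^sup>2"
    unfolding l2_norm_lincomb_power2[OF assms]
    by (simp add: power2_eq_square algebra_simps)
qed simp

text \<open>Young's inequality applied to the cross term 2 |u| |v|. The leading constant can be
  brought close to 1; \<open>poisson_lincomb_le\<close> passes this on, and
  \<open>Stone_approximate\<close> takes \<eta> = sqrt e.\<close>

lemma l2_norm_lincomb_power2_le:
  assumes "u \<in> L2" "v \<in> L2" "\<eta> > 0"
  shows "(l2_norm (lincomb 1 u 1 v))\<^sup>2 \<le> (1 + \<eta>) * (l2_norm u)\<^sup>2 + (1 + 1 / \<eta>) * (l2_norm v)\<^sup>2"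
proof -
  have "(l2_norm (lincomb 1 u 1 v))\<^sup>2 \<le> (l2_norm u + l2_norm v)\<^sup>2"
    using l2_norm_lincomb_le[OF assms(1,2), of 1 1] by (intro power_mono) auto
  also have "0 \<le> (\<eta> * l2_norm u - l2_norm v)\<^sup>2 / \<eta>"
    using assms(3) by simp
  then have "(l2_norm u + l2_norm v)\<^sup>2 \<le> (1 + \<eta>) * (l2_norm u)\<^sup>2 + (1 + 1 / \<eta>) * (l2_norm v)\<^sup>2"
    using assms(3) by (simp add: power2_eq_square field_simps)
  finally show ?thesis .
qed

lemma l2_inner_cong:
  assumes "l2_eq v w" "u \<in> L2" "v \<in> L2" "w \<in> L2"
  shows "l2_inner u v = l2_inner u w"
  unfolding l2_inner_def
  by (rule integral_cong_AE)
    (use assms L2_integrable_mult in \<open>auto simp: l2_eq_def dest!: borel_measurable_integrable\<close>)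

lemma l2_inner_tendsto:
  assumes "u \<in> L2" "\<And>n. U n \<in> L2" "w \<in> L2" "(\<lambda>n. l2_norm (\<lambda>x. U n x - u x)) \<longlonglongrightarrow> 0"
  shows "(\<lambda>n. l2_inner w (U n)) \<longlonglongrightarrow> l2_inner w u"
proof -
  have eq: "(\<lambda>x. U n x - u x) = lincomb 1 (U n) (-1) u" for n
    by (simp add: lincomb_def)
  have "norm (l2_inner w (U n) - l2_inner w u) \<le> l2_norm w * l2_norm (\<lambda>x. U n x - u x)" for n
    using l2_Cauchy_Schwarz[of w "lincomb 1 (U n) (-1) u"] assms
    by (simp add: l2_inner_lincomb eq)
  moreover have "(\<lambda>n. l2_norm w * l2_norm (\<lambda>x. U n x - u x)) \<longlonglongrightarrow> 0"
    using tendsto_mult_left[OF assms(4), of "l2_norm w"] by simp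
  ultimately have "(\<lambda>n. l2_inner w (U n) - l2_inner w u) \<longlonglongrightarrow> 0"
    by (rule_tac Lim_null_comparison[OF eventuallyI])
  then show ?thesis by (simp add: LIM_zero_iff)
qed


section \<open>Projection-valued measures and spectral resolutions\<close>

lemma L2_zero [simp]: "(\<lambda>x. 0) \<in> L2"
  by (simp add: L2_def)

lemma l2_inner_zero_right [simp]: "l2_inner u (\<lambda>x. 0) = 0"
  by (simp add: l2_inner_def)

text \<open>Vectors are functions, while the axioms for E hold only almost everywhere. Identities
  between vectors are therefore stated below through inner products with every y in
  \<open>L2\<close>; testing with y = a and y = b recovers the norms.\<close>

lemma l2_norm_eqI:
  assumes "a \<in> L2" "b \<in> L2" "\<And>y. y \<in> L2 \<Longrightarrow> l2_inner y a = l2_inner y b"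
  shows "l2_norm a = l2_norm b"
proof -
  have "l2_inner a a = cnj (l2_inner b a)"
    unfolding cnj_l2_inner by (rule assms(3)[OF assms(1)])
  also have "l2_inner b a = l2_inner b b" by (rule assms(3)[OF assms(2)])
  also have "cnj (l2_inner b b) = l2_inner b b" by (rule cnj_l2_inner)
  finally have "(l2_norm a)\<^sup>2 = (l2_norm b)\<^sup>2" by (simp only: l2_inner_same of_real_eq_iff)
  then show ?thesis by simp
qed

text \<open>A setwise comparison of measures is carried over to integrals by building f up from
  indicators. The measures will be the spectral measures of two vectors and of a combination of
  them.\<close>

lemma nn_integral_le_add_measure:
  assumes sets: "sets M = sets M1" "sets M = sets M2"
    and le: "\<And>A. A \<in> sets M \<Longrightarrow> emeasure M A \<le> a * emeasure M1 A + b * emeasure M2 A"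
    and f: "f \<in> borel_measurable M"
  shows "(\<integral>\<^sup>+x. f x \<partial>M) \<le> a * (\<integral>\<^sup>+x. f x \<partial>M1) + b * (\<integral>\<^sup>+x. f x \<partial>M2)"
  using f
proof (induction rule: borel_measurable_induct)
  case (cong f g)
  have sp: "space M1 = space M" "space M2 = space M" using sets by (auto dest: sets_eq_imp_space_eq)
  have "(\<integral>\<^sup>+x. f x \<partial>N) = (\<integral>\<^sup>+x. g x \<partial>N)" if "space N = space M" for N
    by (rule nn_integral_cong) (use cong that in auto)
  with cong sp show ?case by simp
next
  case (set A)
  then show ?case using le[of A] sets by simp
next
  case (mult u c)
  have "u \<in> borel_measurable M1" "u \<in> borel_measurable M2"
    using mult sets by (auto cong: measurable_cong_sets)
  then have "a * (\<integral>\<^sup>+x. c * u x \<partial>M1) + b * (\<integral>\<^sup>+x. c * u x \<partial>M2)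
     = c * (a * (\<integral>\<^sup>+x. u x \<partial>M1) + b * (\<integral>\<^sup>+x. u x \<partial>M2))"
    by (simp add: nn_integral_cmult algebra_simps)
  then show ?case using mult by (simp add: nn_integral_cmult mult_left_mono)
next
  case (add u v)
  have m: "u \<in> borel_measurable M1" "u \<in> borel_measurable M2" "v \<in> borel_measurable M1" "v \<in> borel_measurable M2"
    using add sets by (auto cong: measurable_cong_sets)
  have "(\<integral>\<^sup>+x. u x \<partial>M) + (\<integral>\<^sup>+x. v x \<partial>M) \<le>
    (a * (\<integral>\<^sup>+x. u x \<partial>M1) + b * (\<integral>\<^sup>+x. u x \<partial>M2)) + (a * (\<integral>\<^sup>+x. v x \<partial>M1) + b * (\<integral>\<^sup>+x. v x \<partial>M2))"
    using add by (intro add_mono) auto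
  then show ?case using m add by (simp add: nn_integral_add algebra_simps)
next
  case (seq U)
  have m: "\<And>i. U i \<in> borel_measurable M1" "\<And>i. U i \<in> borel_measurable M2"
    using seq sets by (auto cong: measurable_cong_sets)
  have "(\<integral>\<^sup>+x. (SUP i. U i) x \<partial>M) = (SUP i. \<integral>\<^sup>+x. U i x \<partial>M)"
    using seq by (simp add: nn_integral_monotone_convergence_SUP image_comp)
  also have "\<dots> \<le> a * (\<integral>\<^sup>+x. (SUP i. U i) x \<partial>M1) + b * (\<integral>\<^sup>+x. (SUP i. U i) x \<partial>M2)"
  proof (rule SUP_least)
    fix i
    have "U i x \<le> (SUP i. U i) x" for x
      by (metis SUP_upper UNIV_I le_funD)
    then have "a * (\<integral>\<^sup>+x. U i x \<partial>M1) + b * (\<integral>\<^sup>+x. U i x \<partial>M2) \<le>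
      a * (\<integral>\<^sup>+x. (SUP i. U i) x \<partial>M1) + b * (\<integral>\<^sup>+x. (SUP i. U i) x \<partial>M2)"
      by (intro add_mono mult_left_mono nn_integral_mono) auto
    then show "(\<integral>\<^sup>+x. U i x \<partial>M) \<le> a * (\<integral>\<^sup>+x. (SUP i. U i) x \<partial>M1) + b * (\<integral>\<^sup>+x. (SUP i. U i) x \<partial>M2)"
      using seq.IH[of i] by (rule_tac order_trans)
  qed
  finally show ?case .
qed

text \<open>The indices are integers because the cells will be translates of one interval along the
  whole line; \<open>int_decode\<close> turns them into a sequence for countable additivity.\<close>

lemma emeasure_UNIV_le_of_partition:
  fixes S :: "int \<Rightarrow> 'a set"
  assumes "sets M1 = sets M2" "\<And>j. S j \<in> sets M1" "disjoint_family S" "(\<Union>j. S j) = UNIV"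
    and le: "\<And>j. emeasure M1 (S j) \<le> c * emeasure M2 (S j)"
  shows "emeasure M1 UNIV \<le> c * emeasure M2 UNIV"
proof -
  define A where "A = (\<lambda>n. S (int_decode n))"
  have inj: "inj int_decode" by (rule inj_int_decode)
  have dis: "disjoint_family A"
    using assms(3) inj unfolding A_def disjoint_family_on_def by (meson UNIV_I injD)
  have un: "(\<Union>n. A n) = UNIV"
    using assms(4) UN_simps(10)[of S int_decode UNIV] unfolding A_def by (simp add: surj_int_decode)
  have r: "range A \<subseteq> sets M1" "range A \<subseteq> sets M2" using assms(1,2) by (auto simp: A_def)
  have "emeasure M1 UNIV = (\<Sum>n. emeasure M1 (A n))"
    using suminf_emeasure[OF r(1) dis] un by simp
  also have "\<dots> \<le> (\<Sum>n. c * emeasure M2 (A n))"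
    using le by (intro suminf_le) (auto simp: A_def)
  also have "\<dots> = c * (\<Sum>n. emeasure M2 (A n))" by simp
  also have "(\<Sum>n. emeasure M2 (A n)) = emeasure M2 UNIV"
    using suminf_emeasure[OF r(2) dis] un by simp
  finally show ?thesis .
qed

text \<open>The factor bounds the squared ratio of two values of |t - z| on an interval of
  half-width d, where e = |Im z|; it tends to 1 with d. Finiteness of y reduces the limit to one in
  the reals.\<close>

lemma ennreal_le_of_mult_le:
  fixes x :: ennreal
  assumes e: "e > 0" and le: "\<And>d. 0 < d \<Longrightarrow> d < e \<Longrightarrow> x \<le> ennreal (((e+d)/(e-d))\<^sup>2) * y"
    and y: "y < top"
  shows "x \<le> y"
proof -
  obtain r where r: "y = ennreal r" "r \<ge> 0" using y by (cases y) auto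
  have "x \<le> ennreal (((e+e/2)/(e-e/2))\<^sup>2) * y" using le[of "e/2"] e by simp
  also have "\<dots> < top" using y by (simp add: ennreal_mult_less_top)
  finally obtain s where s: "x = ennreal s" "s \<ge> 0" by (cases x) auto
  have ev: "\<forall>\<^sub>F d in at_right 0. s \<le> ((e+d)/(e-d))\<^sup>2 * r"
    unfolding eventually_at_right_field
  proof (intro exI[of _ e] conjI allI impI e)
    fix d :: real assume d: "0 < d" "d < e"
    have "ennreal s \<le> ennreal (((e+d)/(e-d))\<^sup>2 * r)"
      using le[OF d] r s by (simp add: ennreal_mult)
    then show "s \<le> ((e+d)/(e-d))\<^sup>2 * r" using r by (simp add: ennreal_le_iff)
  qed
  have "((\<lambda>d. ((e+d)/(e-d))\<^sup>2 * r) \<longlongrightarrow> ((e+0)/(e-0))\<^sup>2 * r) (at_right 0)"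
    using e by (intro tendsto_intros) auto
  then have "s \<le> ((e+0)/(e-0))\<^sup>2 * r"
    by (rule tendsto_lowerbound[OF _ ev]) simp
  then show ?thesis using e r s by (simp add: ennreal_leI)
qed

section \<open>Scalar spectral measures of a projection-valued measure\<close>

locale pvm =
  fixes E :: "real set \<Rightarrow> (real \<Rightarrow> complex) \<Rightarrow> (real \<Rightarrow> complex)"
  assumes pvm: "projection_valued_measure E"
begin

lemma projection: "S \<in> sets borel \<Longrightarrow> l2_projection (E S)"
  using pvm by (simp add: projection_valued_measure_def)

lemma E_L2 [simp, intro]: "S \<in> sets borel \<Longrightarrow> u \<in> L2 \<Longrightarrow> E S u \<in> L2"
  using projection by (simp add: l2_projection_def)

lemma E_inner: "S \<in> sets borel \<Longrightarrow> u \<in> L2 \<Longrightarrow> v \<in> L2 \<Longrightarrow> l2_inner (E S u) v = l2_inner u (E S v)"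
  using projection by (simp add: l2_projection_def)

lemma E_E:
  assumes "S \<in> sets borel" "S' \<in> sets borel" "u \<in> L2" "v \<in> L2"
  shows "l2_inner u (E S (E S' v)) = l2_inner u (E (S \<inter> S') v)"
proof -
  have "l2_eq (E (S \<inter> S') v) (E S (E S' v))"
    using pvm assms by (simp add: projection_valued_measure_def)
  then show ?thesis using assms by (intro l2_inner_cong[symmetric]) auto
qed

lemma E_UNIV:
  assumes "u \<in> L2" "v \<in> L2"
  shows "l2_inner u (E UNIV v) = l2_inner u v"
proof -
  have "l2_eq (E UNIV v) v" using pvm assms by (simp add: projection_valued_measure_def)
  then show ?thesis using assms by (intro l2_inner_cong) auto
qed

lemma E_lincomb:
  assumes "S \<in> sets borel" "u \<in> L2" "v \<in> L2" "w \<in> L2"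
  shows "l2_inner w (E S (lincomb a u b v)) = a * l2_inner w (E S u) + b * l2_inner w (E S v)"
proof -
  have "l2_eq (E S (lincomb a u b v)) (lincomb a (E S u) b (E S v))"
    using projection[OF assms(1)] assms by (simp add: l2_projection_def lincomb_def)
  then have "l2_inner w (E S (lincomb a u b v)) = l2_inner w (lincomb a (E S u) b (E S v))"
    using assms by (intro l2_inner_cong) auto
  then show ?thesis using assms by (simp add: l2_inner_lincomb)
qed

lemma inner_E_same:
  assumes "S \<in> sets borel" "u \<in> L2"
  shows "l2_inner u (E S u) = complex_of_real ((l2_norm (E S u))\<^sup>2)"
proof -
  have "l2_inner (E S u) (E S u) = l2_inner u (E S u)"
    using assms by (simp add: E_inner E_E)
  then show ?thesis by (simp add: l2_inner_same)
qed

lemma sums_inner_E: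
  assumes A: "\<And>n::nat. A n \<in> sets borel" "disjoint_family A" and u: "u \<in> L2"
  shows "(\<lambda>n. l2_inner u (E (A n) u)) sums l2_inner u (E (\<Union>n. A n) u)"
proof -
  define U where "U n = (\<lambda>x. \<Sum>i<n. E (A i) u x)" for n
  have Suc: "U (Suc n) = lincomb 1 (U n) 1 (E (A n) u)" for n
    by (simp add: U_def lincomb_def)
  have U: "U n \<in> L2" for n
    by (induction n) (use A u Suc in \<open>auto simp: U_def\<close>)
  have inner: "l2_inner u (U n) = (\<Sum>i<n. l2_inner u (E (A i) u))" for n
    by (induction n) (use A u Suc U in \<open>auto simp: l2_inner_lincomb\<close>, simp add: U_def)
  have "(\<lambda>n. l2_norm (\<lambda>x. U n x - E (\<Union>i. A i) u x)) \<longlonglongrightarrow> 0"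
    using pvm A u by (simp add: projection_valued_measure_def U_def)
  then have "(\<lambda>n. l2_inner u (U n)) \<longlonglongrightarrow> l2_inner u (E (\<Union>n. A n) u)"
    using A u U by (intro l2_inner_tendsto) auto
  then show ?thesis by (simp add: sums_def inner)
qed

abbreviation "\<mu> \<equiv> scalar_spectral_measure E"

lemma sets_mu [simp, measurable_cong]: "sets (\<mu> u) = sets borel"
  unfolding scalar_spectral_measure_def using sets.sets_measure_of_eq[of borel] by simp

lemma space_mu [simp]: "space (\<mu> u) = UNIV"
  unfolding scalar_spectral_measure_def by (simp add: space_measure_of_conv)

lemma emeasure_mu:
  assumes S: "S \<in> sets borel" and u: "u \<in> L2"
  shows "emeasure (\<mu> u) S = ennreal ((l2_norm (E S u))\<^sup>2)"
proof -
  define f where "f = (\<lambda>S. ennreal (Re (l2_inner u (E S u))))"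
  \<comment> \<open>The empty set is the union of infinitely many copies of itself, and a constant
    series converges only if its term is 0.\<close>
  have "(\<lambda>n::nat. l2_inner u (E {} u)) sums l2_inner u (E (\<Union>n::nat. {}) u)"
    using u by (intro sums_inner_E) (auto simp: disjoint_family_on_def)
  then have "l2_inner u (E {} u) = 0" using sums_summable summable_const_iff by metis
  then have pos: "positive (sets (\<mu> u)) f" by (simp add: positive_def f_def)
  have ca: "countably_additive (sets (\<mu> u)) f"
  proof (rule countably_additiveI)
    fix A :: "nat \<Rightarrow> real set" assume A: "range A \<subseteq> sets (\<mu> u)" "disjoint_family A"
    have "(\<lambda>n. Re (l2_inner u (E (A n) u))) sums Re (l2_inner u (E (\<Union>n. A n) u))"
      using A u by (intro sums_Re sums_inner_E) auto
    then show "(\<Sum>i. f (A i)) = f (\<Union> (range A))"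
      unfolding f_def using A u by (intro suminf_ennreal_eq) (auto simp: inner_E_same)
  qed
  have "emeasure (\<mu> u) S = f S"
    unfolding scalar_spectral_measure_def f_def[symmetric]
    using pos ca S sets.sigma_algebra_axioms[of "borel :: real measure"]
    by (intro emeasure_measure_of_sigma) auto
  then show ?thesis using S u by (simp add: f_def inner_E_same)
qed

lemma measure_mu: "S \<in> sets borel \<Longrightarrow> u \<in> L2 \<Longrightarrow> measure (\<mu> u) S = (l2_norm (E S u))\<^sup>2"
  by (simp add: measure_def emeasure_mu)

lemma finite_measure_mu: "u \<in> L2 \<Longrightarrow> finite_measure (\<mu> u)"
  by standard (simp add: emeasure_mu)

lemma l2_norm_E_UNIV: "u \<in> L2 \<Longrightarrow> l2_norm (E UNIV u) = l2_norm u"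
  by (rule l2_norm_eqI) (auto simp: E_UNIV)

lemma measure_mu_UNIV: "u \<in> L2 \<Longrightarrow> measure (\<mu> u) UNIV = (l2_norm u)\<^sup>2"
  by (simp add: measure_mu l2_norm_E_UNIV)

lemma l2_norm_E_le: "S \<in> sets borel \<Longrightarrow> u \<in> L2 \<Longrightarrow> l2_norm (E S u) \<le> l2_norm u"
proof (rule power2_le_imp_le)
  assume *: "S \<in> sets borel" "u \<in> L2"
  interpret finite_measure "\<mu> u" using * by (rule_tac finite_measure_mu)
  show "(l2_norm (E S u))\<^sup>2 \<le> (l2_norm u)\<^sup>2"
    using * finite_measure_mono[of S UNIV] by (simp add: measure_mu l2_norm_E_UNIV)
qed simp

lemma l2_norm_E_E:
  assumes "S \<in> sets borel" "S' \<in> sets borel" "u \<in> L2"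
  shows "l2_norm (E S (E S' u)) = l2_norm (E (S \<inter> S') u)"
  by (rule l2_norm_eqI) (use assms in \<open>auto simp: E_E\<close>)

lemma l2_norm_E_empty: "u \<in> L2 \<Longrightarrow> l2_norm (E {} u) = 0"
  using emeasure_mu[of "{}" u] by simp

text \<open>By orthogonality |u - E S u|^2 = |u|^2 - |E S u|^2. This is the mass of the complement
  of S, hence 0.\<close>

lemma E_concentrated:
  assumes "S \<in> sets borel" "u \<in> L2" "y \<in> L2" "l2_norm (E (-S) u) = 0"
  shows "l2_inner y (E S u) = l2_inner y u"
proof -
  interpret finite_measure "\<mu> u" using assms by (rule_tac finite_measure_mu)
  have "measure (\<mu> u) (-S) = measure (\<mu> u) UNIV - measure (\<mu> u) S"
    using finite_measure_compl[of S] assms by (simp add: Compl_eq_Diff_UNIV)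
  then have eq: "(l2_norm u)\<^sup>2 = (l2_norm (E S u))\<^sup>2"
    using assms by (simp add: measure_mu l2_norm_E_UNIV)
  have "(l2_norm (lincomb 1 u (-1) (E S u)))\<^sup>2 = 0"
    using assms eq by (simp add: l2_norm_lincomb_power2 inner_E_same)
  then have "l2_inner y (lincomb 1 u (-1) (E S u)) = 0"
    using assms by (intro l2_inner_null_right) auto
  then show ?thesis using assms by (simp add: l2_inner_lincomb)
qed

lemma AE_mu_in:
  assumes "S \<in> sets borel" "u \<in> L2" "l2_norm (E (-S) u) = 0"
  shows "AE t in \<mu> u. t \<in> S"
  by (rule AE_I[of _ _ "-S"]) (use assms in \<open>auto simp: emeasure_mu\<close>)

lemma integrable_mu_concentrated:
  fixes f :: "real \<Rightarrow> real"
  assumes "S \<in> sets borel" "u \<in> L2" "l2_norm (E (-S) u) = 0"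
    and "f \<in> borel_measurable borel" "\<And>t. t \<in> S \<Longrightarrow> \<bar>f t\<bar> \<le> B"
  shows "integrable (\<mu> u) f"
proof -
  interpret finite_measure "\<mu> u" using assms by (rule_tac finite_measure_mu)
  show ?thesis
    using AE_mu_in[OF assms(1-3)] assms by (intro integrable_const_bound[of _ B]) auto
qed

end

section \<open>The operator on bounded spectral sets, and weak solutions of the resolvent
  equation\<close>

locale spectral = pvm E for E +
  fixes T :: l2_operator
  assumes resolution: "spectral_resolution T E"
    and T_L2: "(u, v) \<in> T \<Longrightarrow> u \<in> L2 \<and> v \<in> L2"
    and T_lincomb: "(u, v) \<in> T \<Longrightarrow> (u', v') \<in> T \<Longrightarrow> (lincomb a u b u', lincomb a v b v') \<in> T"
begin

lemma form: "(u, v) \<in> T \<Longrightarrow> l2_inner u v = complex_of_real (LINT t|\<mu> u. t)"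
  using resolution by (auto simp: spectral_resolution_def)

text \<open>The resolution gives the quadratic form only, and its values are real. Expanding it at u
  + c u' for c = 1 and c = i makes the cross terms conjugate to each other.\<close>

lemma T_symmetric:
  assumes "(u, v) \<in> T" "(u', v') \<in> T"
  shows "l2_inner u v' = l2_inner v u'"
proof -
  note L = T_L2[OF assms(1)] T_L2[OF assms(2)]
  have real: "Im (l2_inner a b) = 0" if "(a, b) \<in> T" for a b
    using form[OF that] by simp
  have "Im (c * l2_inner u v' + cnj c * l2_inner u' v) = 0" if "cnj c * c = 1" for c
  proof -
    have "l2_inner (lincomb 1 u c u') (lincomb 1 v c v')
      = l2_inner u v + (c * l2_inner u v' + cnj c * l2_inner u' v) + cnj c * c * l2_inner u' v'"
      using L by (simp add: l2_inner_lincomb algebra_simps)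
    with that real[OF T_lincomb[OF assms, of 1 c]] real[OF assms(1)] real[OF assms(2)] show ?thesis by simp
  qed
  from this[of 1] this[of \<i>] have "l2_inner u v' = cnj (l2_inner u' v)"
    by (simp add: complex_eq_iff)
  then show ?thesis by (simp add: cnj_l2_inner)
qed

text \<open>This is the supply of domain vectors for all later arguments: a general vector is first
  cut down to a bounded spectral set, where t^2 is bounded.\<close>

lemma E_in_Domain:
  assumes "S \<in> sets borel" "S \<subseteq> {a..b}" "u \<in> L2"
  shows "\<exists>v. (E S u, v) \<in> T"
proof -
  have "integrable (\<mu> (E S u)) (\<lambda>t. t\<^sup>2)"
  proof (rule integrable_mu_concentrated[of S])
    show "l2_norm (E (- S) (E S u)) = 0"
      using assms by (simp add: l2_norm_E_E l2_norm_E_empty)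
    show "\<bar>t\<^sup>2\<bar> \<le> (\<bar>a\<bar> + \<bar>b\<bar>)\<^sup>2" if "t \<in> S" for t
    proof -
      have "a \<le> t" "t \<le> b" using that assms by auto
      then have "\<bar>t\<bar> \<le> \<bar>a\<bar> + \<bar>b\<bar>" by arith
      then have "\<bar>t\<bar>\<^sup>2 \<le> (\<bar>a\<bar> + \<bar>b\<bar>)\<^sup>2" by (intro power_mono) auto
      then show ?thesis by simp
    qed
  qed (use assms in auto)
  then show ?thesis using resolution assms by (auto simp: spectral_resolution_def)
qed

text \<open>For w = x + c x' the spectral measure of w is that of x on S and that of x' on S', so
  the quadratic form at w has no cross term. In the sesquilinear expansion symmetry makes the cross
  term 2 Re (c <x, v'>), which must therefore vanish; c = 1 and c = i finish.\<close>

lemma T_E_orthogonal: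
  assumes S: "S \<in> sets borel" "S \<subseteq> {a..b}" and S': "S' \<in> sets borel" "S' \<subseteq> {a'..b'}"
    and disj: "S \<inter> S' = {}"
    and T: "(x, v) \<in> T" "(x', v') \<in> T"
    and x: "l2_norm (E (-S) x) = 0" "l2_norm (E (-S') x') = 0"
  shows "l2_inner x v' = 0"
proof -
  note L = T_L2[OF T(1)] T_L2[OF T(2)]
  have "Re (c * l2_inner x v') = 0" if c: "norm c = 1" for c
  proof -
    define w where "w = lincomb 1 x c x'"
    have w: "w \<in> L2" using L by (simp add: w_def)
    have nS: "l2_norm (E A x) = 0" if "A \<in> sets borel" "A \<inter> S = {}" for A
    proof -
      interpret finite_measure "\<mu> x" using L by (intro finite_measure_mu) auto
      have "measure (\<mu> x) A \<le> measure (\<mu> x) (-S)" using that S by (intro finite_measure_mono) auto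
      then show ?thesis using that S L x by (simp add: measure_mu)
    qed
    have nS': "l2_norm (E A x') = 0" if "A \<in> sets borel" "A \<inter> S' = {}" for A
    proof -
      interpret finite_measure "\<mu> x'" using L by (intro finite_measure_mu) auto
      have "measure (\<mu> x') A \<le> measure (\<mu> x') (-S')" using that S' by (intro finite_measure_mono) auto
      then show ?thesis using that S' L x by (simp add: measure_mu)
    qed
    have m1: "l2_norm (E (A \<inter> S) w) = l2_norm (E A x)" if A: "A \<in> sets borel" for A
    proof (rule l2_norm_eqI)
      fix y assume y: "y \<in> L2"
      have "l2_inner y (E (A \<inter> S) x') = 0"
        using nS'[of "A \<inter> S"] disj A S L y by (intro l2_inner_null_right) auto
      moreover have "l2_inner y (E (A \<inter> S) x) = l2_inner y (E A x)"
      proof -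
        have "l2_inner y (E (A \<inter> S) x) = l2_inner (E A y) (E S x)"
          using A S L y by (simp add: E_inner E_E)
        also have "\<dots> = l2_inner (E A y) x" using A S L y x by (intro E_concentrated) auto
        also have "\<dots> = l2_inner y (E A x)" using A S L y by (simp add: E_inner)
        finally show ?thesis .
      qed
      ultimately show "l2_inner y (E (A \<inter> S) w) = l2_inner y (E A x)"
        unfolding w_def using A S L y by (simp add: E_lincomb)
    qed (use A S L w in auto)
    have m2: "l2_norm (E (A \<inter> S') w) = l2_norm (E A x')" if A: "A \<in> sets borel" for A
    proof -
      \<comment> \<open>\<open>lincomb c y 0 y\<close> stands for the scalar multiple c y; as |c| =
        1, the factor disappears from the norm.\<close>
      have "l2_norm (E (A \<inter> S') w) = l2_norm (lincomb c (E A x') 0 (E A x'))"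
      proof (rule l2_norm_eqI)
        fix y assume y: "y \<in> L2"
        have "l2_inner y (E (A \<inter> S') x) = 0"
          using nS[of "A \<inter> S'"] disj A S' L y by (intro l2_inner_null_right) auto
        moreover have "l2_inner y (E (A \<inter> S') x') = l2_inner y (E A x')"
        proof -
          have "l2_inner y (E (A \<inter> S') x') = l2_inner (E A y) (E S' x')"
            using A S' L y by (simp add: E_inner E_E)
          also have "\<dots> = l2_inner (E A y) x'" using A S' L y x by (intro E_concentrated) auto
          also have "\<dots> = l2_inner y (E A x')" using A S' L y by (simp add: E_inner)
          finally show ?thesis .
        qed
        ultimately show "l2_inner y (E (A \<inter> S') w) = l2_inner y (lincomb c (E A x') 0 (E A x'))"
          unfolding w_def using A S' L y by (simp add: E_lincomb l2_inner_lincomb)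
      qed (use A S' L w in auto)
      also have "\<dots> = l2_norm (E A x')"
      proof -
        have "(l2_norm (lincomb c (E A x') 0 (E A x')))\<^sup>2 = (l2_norm (E A x'))\<^sup>2"
          using A L c by (simp add: l2_norm_lincomb_power2)
        then show ?thesis by simp
      qed
      finally show ?thesis .
    qed
    \<comment> \<open>Writing \<open>\<mu> y\<close> as \<open>\<mu> w\<close> with density
      \<open>indicator R\<close> puts the forms at x and at x' under one measure, where they can be
      added.\<close>
    have density: "integral\<^sup>L (\<mu> y) (\<lambda>t. t) = (LINT t|\<mu> w. indicator R t * t)"
      if "R \<in> sets borel" "y \<in> L2" "\<And>A. A \<in> sets borel \<Longrightarrow> l2_norm (E (A \<inter> R) w) = l2_norm (E A y)" for R y
    proof -
      have "\<mu> y = density (\<mu> w) (\<lambda>t. ennreal (indicator R t))"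
      proof (rule measure_eqI)
        fix A assume A: "A \<in> sets (\<mu> y)"
        have "emeasure (density (\<mu> w) (\<lambda>t. ennreal (indicator R t))) A = emeasure (\<mu> w) (A \<inter> R)"
          using A that by (subst emeasure_density)
            (auto simp: indicator_inter_arith[symmetric] ennreal_indicator mult.commute intro!: nn_integral_cong)
        then show "emeasure (\<mu> y) A = emeasure (density (\<mu> w) (\<lambda>t. ennreal (indicator R t))) A"
          using A that w by (simp add: emeasure_mu)
      qed simp
      then show ?thesis using that by (simp add: integral_density)
    qed
    have null: "l2_norm (E (- (S \<union> S')) w) = 0"
    proof -
      have "l2_norm (E (- (S \<union> S')) w) = l2_norm (\<lambda>x. 0)"
      proof (rule l2_norm_eqI)
        fix y assume y: "y \<in> L2"
        have "l2_inner y (E (- (S \<union> S')) x) = 0" "l2_inner y (E (- (S \<union> S')) x') = 0"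
          using nS nS' S S' L y by (auto intro!: l2_inner_null_right)
        then show "l2_inner y (E (- (S \<union> S')) w) = l2_inner y (\<lambda>x. 0)"
          unfolding w_def using S S' L y by (simp add: E_lincomb)
      qed (use S S' w in auto)
      then show ?thesis by (simp add: l2_norm_def)
    qed
    have int: "integrable (\<mu> w) (\<lambda>t. indicator R t * t)" if "R \<in> sets borel" for R
    proof (rule integrable_mu_concentrated[of "S \<union> S'"])
      show "\<bar>indicator R t * t\<bar> \<le> \<bar>a\<bar> + \<bar>b\<bar> + \<bar>a'\<bar> + \<bar>b'\<bar>" if "t \<in> S \<union> S'" for t
      proof -
        have "a \<le> t \<and> t \<le> b \<or> a' \<le> t \<and> t \<le> b'" using that S S' by auto
        then have "\<bar>t\<bar> \<le> \<bar>a\<bar> + \<bar>b\<bar> + \<bar>a'\<bar> + \<bar>b'\<bar>" by arith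
        then show ?thesis by (auto simp: indicator_def)
      qed
    qed (use S S' w null that in auto)
    have "(LINT t|\<mu> w. t) = (LINT t|\<mu> w. indicator S t * t + indicator S' t * t)"
      using AE_mu_in[of "S \<union> S'" w] null w S S' disj
      by (intro integral_cong_AE) (auto simp: indicator_def)
    also have "\<dots> = (LINT t|\<mu> x. t) + (LINT t|\<mu> x'. t)"
      using int S S' density[OF S(1) _ m1] density[OF S'(1) _ m2] L by (simp add: Bochner_Integration.integral_add)
    finally have Q: "l2_inner w (lincomb 1 v c v') = l2_inner x v + l2_inner x' v'"
      using form[OF T(1)] form[OF T(2)] form[OF T_lincomb[OF T, of 1 c]] by (simp add: w_def)
    have "l2_inner x' v = cnj (l2_inner x v')"
      using T_symmetric[OF T] by (simp add: cnj_l2_inner)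
    moreover have "cnj c * c = 1" using c complex_norm_square[of c] by (simp add: mult.commute)
    ultimately have "l2_inner w (lincomb 1 v c v') = l2_inner x v + (c * l2_inner x v' + cnj (c * l2_inner x v')) + l2_inner x' v'"
      unfolding w_def using L by (simp add: l2_inner_lincomb algebra_simps)
    with Q have "c * l2_inner x v' + cnj (c * l2_inner x v') = 0" by (simp add: algebra_simps)
    from arg_cong[OF this, of Re] show ?thesis by simp
  qed
  from this[of 1] this[of \<i>] show ?thesis by (simp add: complex_eq_iff)
qed

text \<open>The part of v outside S is tested in the bounded pieces E (A n) v, for which membership
  in the domain is available; \<open>T_E_orthogonal\<close> makes each piece orthogonal to v, hence
  null.\<close>

lemma T_E_concentrated:
  assumes S: "S \<in> sets borel" "S \<subseteq> {a..b}" and T: "(x, v) \<in> T" "l2_norm (E (-S) x) = 0"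
  shows "l2_norm (E (-S) v) = 0"
proof -
  note L = T_L2[OF T(1)]
  define A where "A n = - S \<inter> {- real n..real n}" for n
  have A: "A n \<in> sets borel" "A n \<subseteq> {- real n..real n}" "A n \<inter> S = {}" for n
    using S by (auto simp: A_def)
  have "emeasure (\<mu> v) (A n) = 0" for n
  proof -
    obtain v' where v': "(E (A n) v, v') \<in> T" using E_in_Domain[OF A(1,2)] L by blast
    have "l2_inner (E (A n) v) v = 0"
      using L A[of n] by (intro T_E_orthogonal[OF A(1)[of n] A(2)[of n] S A(3)[of n] v' T(1) _ T(2)])
        (auto simp: l2_norm_E_E l2_norm_E_empty)
    then show ?thesis using A L by (simp add: E_inner inner_E_same emeasure_mu)
  qed
  then have "(\<Union>n. A n) \<in> null_sets (\<mu> v)"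
    using A by (intro null_sets_UN) (auto simp: null_sets_def)
  moreover have "(\<Union>n. A n) = - S"
  proof -
    have "\<exists>n::nat. - real n \<le> t \<and> t \<le> real n" for t
      using real_arch_simple[of "\<bar>t\<bar>"] by (auto simp: abs_le_iff) (metis minus_le_iff)
    then show ?thesis by (auto simp: A_def)
  qed
  ultimately show ?thesis using S L by (simp add: null_sets_def emeasure_mu)
qed

text \<open>The operator sends E S u to E S (f + z u). As u itself is not known to lie in the
  domain, the operator is moved by symmetry onto E S y, which does, and the weak equation is applied
  there.\<close>

lemma weak_eq_E:
  assumes S: "S \<in> sets borel" "S \<subseteq> {a..b}" and L: "u \<in> L2" "f \<in> L2" "y \<in> L2"
    and weak: "\<And>w w'. (w, w') \<in> T \<Longrightarrow> l2_inner u w' = l2_inner (lincomb 1 f z u) w"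
    and v: "(E S u, v) \<in> T"
  shows "l2_inner y v = l2_inner y (E S (lincomb 1 f z u))"
proof -
  obtain y' where y': "(E S y, y') \<in> T" using E_in_Domain[OF S L(3)] by blast
  note L' = T_L2[OF v] T_L2[OF y']
  have null: "l2_norm (E (- S) (E S x)) = 0" if "x \<in> L2" for x
    using that S by (simp add: l2_norm_E_E l2_norm_E_empty)
  have "l2_inner y v = l2_inner y (E S v)"
    using T_E_concentrated[OF S v null] L L' S by (intro E_concentrated[symmetric]) auto
  also have "\<dots> = l2_inner (E S y) v" using L L' S by (simp add: E_inner)
  also have "\<dots> = l2_inner y' (E S u)" using T_symmetric[OF y' v] .
  also have "\<dots> = cnj (l2_inner u (E S y'))" using L L' S by (simp add: E_inner[symmetric] cnj_l2_inner)
  also have "l2_inner u (E S y') = l2_inner u y'"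
    using T_E_concentrated[OF S y' null] L L' S by (intro E_concentrated) auto
  also have "\<dots> = l2_inner (lincomb 1 f z u) (E S y)" by (rule weak[OF y'])
  also have "cnj \<dots> = l2_inner y (E S (lincomb 1 f z u))"
    using L S by (simp add: cnj_l2_inner E_inner)
  finally show ?thesis .
qed

text \<open>The spectral measure of x lives where |t - m| <= \<delta>.\<close>

lemma form_bound:
  assumes S: "S \<in> sets borel" "S \<subseteq> {m-\<delta>..m+\<delta>}" and T: "(x, v) \<in> T" "l2_norm (E (-S) x) = 0"
  shows "\<bar>Re (l2_inner x v) - m * (l2_norm x)\<^sup>2\<bar> \<le> \<delta> * (l2_norm x)\<^sup>2"
proof -
  note L = T_L2[OF T(1)]
  interpret finite_measure "\<mu> x" using L by (intro finite_measure_mu) auto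
  have int: "integrable (\<mu> x) (\<lambda>t. t)"
  proof (rule integrable_mu_concentrated[of S])
    show "\<bar>t\<bar> \<le> \<bar>m-\<delta>\<bar> + \<bar>m+\<delta>\<bar>" if "t \<in> S" for t
    proof -
      have "m-\<delta> \<le> t" "t \<le> m+\<delta>" using that S by auto
      then show ?thesis by arith
    qed
  qed (use L S T in auto)
  have "Re (l2_inner x v) - m * (l2_norm x)\<^sup>2 = (LINT t|\<mu> x. t - m)"
    using form[OF T(1)] int L by (simp add: measure_mu_UNIV)
  also have "\<bar>\<dots>\<bar> \<le> (LINT t|\<mu> x. \<bar>t - m\<bar>)" by (rule integral_abs_bound)
  also have "\<dots> \<le> (LINT t|\<mu> x. \<delta>)"
  proof (rule integral_mono_AE)
    have "AE t in \<mu> x. t \<in> S" using AE_mu_in L S T by blast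
    then show "AE t in \<mu> x. \<bar>t - m\<bar> \<le> \<delta>"
      by eventually_elim (use S in \<open>force simp: abs_le_iff\<close>)
  qed (use int in auto)
  finally show ?thesis using L by (simp add: measure_mu_UNIV mult.commute)
qed

text \<open>From form to norm, as for a bounded symmetric operator: with y = (T - m) w, subtracting
  the form bounds at w + s y and w - s y isolates 4 s |y|^2. Since y may lie outside the domain, E S
  y takes its place; its inner products with v and w are those of y, because v and w are
  concentrated on S.\<close>

lemma T_norm_bound:
  assumes S: "S \<in> sets borel" "S \<subseteq> {m-\<delta>..m+\<delta>}" and T: "(w, v) \<in> T" "l2_norm (E (-S) w) = 0" and \<delta>: "\<delta> > 0"
  shows "l2_norm (lincomb 1 v (- of_real m) w) \<le> \<delta> * l2_norm w"
proof -
  note L = T_L2[OF T(1)]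
  define y where "y = lincomb 1 v (- of_real m) w"
  have y: "y \<in> L2" using L by (simp add: y_def)
  obtain y' where y': "(E S y, y') \<in> T" using E_in_Domain[OF S y] by blast
  note L' = T_L2[OF y']
  have null: "l2_norm (E (- S) (E S y)) = 0"
    using y S by (simp add: l2_norm_E_E l2_norm_E_empty)
  have Eyv: "l2_inner (E S y) v = l2_inner y v" "l2_inner (E S y) w = l2_inner y w"
    using S y L T T_E_concentrated[OF S T] by (simp_all add: E_inner E_concentrated)
  have "l2_inner y v - of_real m * l2_inner y w = l2_inner y y"
    unfolding y_def using L by (simp add: l2_inner_lincomb)
  then have yy: "Re (l2_inner y v) - m * Re (l2_inner y w) = (l2_norm y)\<^sup>2"
    by (simp add: l2_inner_same complex_eq_iff)
  have q: "\<bar>Re (l2_inner w v) + 2 * s * Re (l2_inner y v) + s\<^sup>2 * Re (l2_inner (E S y) y')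
      - m * ((l2_norm w)\<^sup>2 + 2 * s * Re (l2_inner y w) + s\<^sup>2 * (l2_norm (E S y))\<^sup>2)\<bar>
     \<le> \<delta> * ((l2_norm w)\<^sup>2 + 2 * s * Re (l2_inner y w) + s\<^sup>2 * (l2_norm (E S y))\<^sup>2)" for s
  proof -
    have conc: "l2_norm (E (- S) (lincomb 1 w (of_real s) (E S y))) = 0"
    proof -
      have "l2_norm (E (- S) (lincomb 1 w (of_real s) (E S y))) = l2_norm (\<lambda>x. 0)"
      proof (rule l2_norm_eqI)
        fix x assume x: "x \<in> L2"
        have "l2_inner x (E (- S) w) = 0" "l2_inner x (E (- S) (E S y)) = 0"
          using x L y S T null by (auto intro!: l2_inner_null_right)
        then show "l2_inner x (E (- S) (lincomb 1 w (of_real s) (E S y))) = l2_inner x (\<lambda>x. 0)"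
          using x L y S by (simp add: E_lincomb)
      qed (use S L y in auto)
      then show ?thesis by (simp add: l2_norm_def)
    qed
    have n: "(l2_norm (lincomb 1 w (of_real s) (E S y)))\<^sup>2
      = (l2_norm w)\<^sup>2 + 2 * s * Re (l2_inner y w) + s\<^sup>2 * (l2_norm (E S y))\<^sup>2"
    proof -
      have "Re (l2_inner w (E S y)) = Re (cnj (l2_inner y w))"
        using Eyv(2) by (simp only: cnj_l2_inner[of "E S y" w, symmetric])
      then show ?thesis using L S y by (simp add: l2_norm_lincomb_power2)
    qed
    have i: "Re (l2_inner (lincomb 1 w (of_real s) (E S y)) (lincomb 1 v (of_real s) y'))
      = Re (l2_inner w v) + 2 * s * Re (l2_inner y v) + s\<^sup>2 * Re (l2_inner (E S y) y')"
    proof -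
      have "l2_inner w y' = cnj (l2_inner y v)"
        using T_symmetric[OF y' T(1)] Eyv by (metis cnj_l2_inner)
      then show ?thesis using L L' S y Eyv by (simp add: l2_inner_lincomb power2_eq_square algebra_simps)
    qed
    show ?thesis
      using form_bound[OF S T_lincomb[OF T(1) y', of 1 "of_real s"] conc] unfolding n i .
  qed
  have key: "2 * s * (l2_norm y)\<^sup>2 \<le> \<delta> * ((l2_norm w)\<^sup>2 + s\<^sup>2 * (l2_norm y)\<^sup>2)" if "s > 0" for s
  proof -
    have "4 * s * (Re (l2_inner y v) - m * Re (l2_inner y w)) \<le>
        \<delta> * (2 * (l2_norm w)\<^sup>2 + 2 * (s\<^sup>2 * (l2_norm (E S y))\<^sup>2))"
      using add_mono[OF abs_le_D1[OF q[of s]] abs_le_D2[OF q[of "-s"]]] by (simp add: algebra_simps)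
    also have "\<dots> \<le> \<delta> * (2 * (l2_norm w)\<^sup>2 + 2 * (s\<^sup>2 * (l2_norm y)\<^sup>2))"
      using \<delta> power_mono[OF l2_norm_E_le[OF S(1) y], of 2] by (simp add: mult_left_mono)
    finally show ?thesis unfolding yy by (simp add: algebra_simps)
  qed
  \<comment> \<open>At s = 1 / \<delta> the y-term on the right is exactly half of the left
    side.\<close>
  have "2 * (l2_norm y)\<^sup>2 / \<delta> \<le> \<delta> * (l2_norm w)\<^sup>2 + (l2_norm y)\<^sup>2 / \<delta>"
    using key[of "1 / \<delta>"] \<delta> by (simp add: power2_eq_square field_simps)
  then have "(l2_norm y)\<^sup>2 / \<delta> \<le> \<delta> * (l2_norm w)\<^sup>2" by simp
  then have "(l2_norm y)\<^sup>2 \<le> (\<delta> * l2_norm w)\<^sup>2"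
    using \<delta> by (simp add: power2_eq_square field_simps)
  then have "l2_norm y \<le> \<delta> * l2_norm w"
    by (rule power2_le_imp_le) (use \<delta> in auto)
  then show ?thesis by (simp add: y_def)
qed

text \<open>For w = E S u, the vector E S f is (T - z) w = (T - m) w + (m - z) w, and the first
  summand has norm at most \<delta> |w|. The triangle inequality is used in both directions.\<close>

lemma weak_eq_local:
  assumes S: "S \<in> sets borel" "S \<subseteq> {m-\<delta>..m+\<delta>}" and \<delta>: "\<delta> > 0" and L: "u \<in> L2" "f \<in> L2"
    and weak: "\<And>w w'. (w, w') \<in> T \<Longrightarrow> l2_inner u w' = l2_inner (lincomb 1 f z u) w"
  shows "\<bar>l2_norm (E S f) - norm (of_real m - z) * l2_norm (E S u)\<bar> \<le> \<delta> * l2_norm (E S u)"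
proof -
  define w where "w = E S u"
  have w: "w \<in> L2" using L S by (simp add: w_def)
  obtain v where v: "(w, v) \<in> T" using E_in_Domain[OF S L(1)] by (auto simp: w_def)
  have vL: "v \<in> L2" using T_L2[OF v] by simp
  define c where "c = lincomb 1 v (- of_real m) w"
  have c: "c \<in> L2" using w vL by (simp add: c_def)
  have cn: "l2_norm c \<le> \<delta> * l2_norm w"
    unfolding c_def
    by (rule T_norm_bound[OF S v _ \<delta>]) (use L S in \<open>simp add: w_def l2_norm_E_E l2_norm_E_empty\<close>)
  define e where "e = lincomb 1 v (- z) w"
  have eL: "e \<in> L2" using w vL by (simp add: e_def)
  have ef: "l2_norm (E S f) = l2_norm e"
  proof (rule l2_norm_eqI)
    fix y assume y: "y \<in> L2"
    have "l2_inner y v = l2_inner y (E S f) + z * l2_inner y w"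
      using weak_eq_E[OF S L y weak v[unfolded w_def]] S L y by (simp add: E_lincomb w_def)
    then show "l2_inner y (E S f) = l2_inner y e"
      unfolding e_def using y w vL by (simp add: l2_inner_lincomb)
  qed (use S L eL in auto)
  have "e = lincomb 1 c (of_real m - z) w"
    by (auto simp: e_def c_def lincomb_def algebra_simps)
  then have 1: "l2_norm e \<le> l2_norm c + norm (of_real m - z) * l2_norm w"
    using l2_norm_lincomb_le[OF c w, of 1 "of_real m - z"] by simp
  have "lincomb (of_real m - z) w 0 w = lincomb 1 e (-1) c"
    by (auto simp: e_def c_def lincomb_def algebra_simps)
  moreover have "l2_norm (lincomb (of_real m - z) w 0 w) = norm (of_real m - z) * l2_norm w"
  proof -
    have "(l2_norm (lincomb (of_real m - z) w 0 w))\<^sup>2 = (norm (of_real m - z) * l2_norm w)\<^sup>2"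
      using w by (simp add: l2_norm_lincomb_power2 power_mult_distrib)
    then show ?thesis by (rule power2_eq_imp_eq) auto
  qed
  ultimately have 2: "norm (of_real m - z) * l2_norm w \<le> l2_norm e + l2_norm c"
    using l2_norm_lincomb_le[OF eL c, of 1 "-1"] by simp
  show ?thesis unfolding ef w_def[symmetric] using 1 2 cn by linarith
qed


text \<open>On every cell of half-width d the measure \<open>\<mu> u\<close> and the measure
  \<open>\<mu> f\<close> with density |t - z|^(-2) agree up to a factor that is the same for all
  cells. Summing over the cells and letting d tend to 0 removes the factor.\<close>

lemma weak_eq_nn_integral:
  assumes L: "u \<in> L2" "f \<in> L2"
    and weak: "\<And>w w'. (w, w') \<in> T \<Longrightarrow> l2_inner u w' = l2_inner (lincomb 1 f z u) w"
    and z: "Im z \<noteq> 0"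
  shows "(\<integral>\<^sup>+t. ennreal (1 / (norm (of_real t - z))\<^sup>2) \<partial>\<mu> f) = ennreal ((l2_norm u)\<^sup>2)"
proof -
  define e where "e = \<bar>Im z\<bar>"
  have e: "e > 0" using z by (simp add: e_def)
  define \<kappa> where "\<kappa> t = ennreal (1 / (norm (of_real t - z))\<^sup>2)" for t
  have \<kappa>m: "\<kappa> \<in> borel_measurable borel" unfolding \<kappa>_def by measurable
  define M where "M = density (\<mu> f) \<kappa>"
  have Msets: "sets M = sets borel" by (simp add: M_def)
  have MS: "emeasure M S = (\<integral>\<^sup>+t. \<kappa> t * indicator S t \<partial>\<mu> f)" if "S \<in> sets borel" for S
    using that \<kappa>m unfolding M_def by (subst emeasure_density) auto
  have local: "emeasure M S \<le> ennreal (((e+d)/(e-d))\<^sup>2) * emeasure (\<mu> u) S \<and>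
      emeasure (\<mu> u) S \<le> ennreal (((e+d)/(e-d))\<^sup>2) * emeasure M S"
    if S: "S \<in> sets borel" "S \<subseteq> {m-d..m+d}" and d: "0 < d" "d < e" for S m d
  proof -
    define D where "D = norm (of_real m - z)"
    have De: "e \<le> D" using abs_Im_le_cmod[of "of_real m - z"] by (simp add: D_def e_def)
    have t: "D - d \<le> norm (of_real t - z)" "norm (of_real t - z) \<le> D + d" if "t \<in> S" for t
    proof -
      have "norm (of_real t - of_real m :: complex) \<le> d"
        using that S by (force simp: norm_of_real abs_le_iff simp flip: of_real_diff)
      moreover have "of_real t - z = (of_real t - of_real m) + (of_real m - z)" by simp
      ultimately show "D - d \<le> norm (of_real t - z)" "norm (of_real t - z) \<le> D + d"
        unfolding D_def by (smt (verit, best) norm_diff_ineq norm_triangle_ineq norm_minus_commute add.commute)+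
    qed
    have loc: "\<bar>l2_norm (E S f) - D * l2_norm (E S u)\<bar> \<le> d * l2_norm (E S u)"
      unfolding D_def by (rule weak_eq_local[OF S d(1) L weak])
    have F1: "(l2_norm (E S f))\<^sup>2 \<le> ((D + d) * l2_norm (E S u))\<^sup>2"
      using loc by (intro power_mono) (auto simp: algebra_simps abs_le_iff)
    have F2: "((D - d) * l2_norm (E S u))\<^sup>2 \<le> (l2_norm (E S f))\<^sup>2"
      using loc De d by (intro power_mono mult_nonneg_nonneg) (auto simp: algebra_simps abs_le_iff)
    \<comment> \<open>Since D >= e, the ratio is largest at D = e. This makes the constant the same
      for cells at any distance from z.\<close>
    have R: "(D + d) / (D - d) \<le> (e + d) / (e - d)"
    proof -
      have "(D + d) / (D - d) = 1 + 2 * d / (D - d)" "(e + d) / (e - d) = 1 + 2 * d / (e - d)"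
        using De d by (simp_all add: field_simps)
      moreover have "2 * d / (D - d) \<le> 2 * d / (e - d)"
        using De d by (intro divide_left_mono) auto
      ultimately show ?thesis by simp
    qed
    then have R2: "((D + d) / (D - d))\<^sup>2 \<le> ((e + d) / (e - d))\<^sup>2"
      using De d by (intro power_mono) auto
    have "emeasure M S \<le> (\<integral>\<^sup>+t. ennreal (1 / (D - d)\<^sup>2) * indicator S t \<partial>\<mu> f)"
      unfolding MS[OF S(1)]
    proof (intro nn_integral_mono)
      fix x show "\<kappa> x * indicator S x \<le> ennreal (1 / (D - d)\<^sup>2) * indicator S x"
        using t[of x] De d unfolding \<kappa>_def
        by (cases "x \<in> S") (auto intro!: ennreal_leI divide_left_mono power_mono mult_pos_pos)
    qed
    also have "\<dots> = ennreal (1 / (D - d)\<^sup>2 * (l2_norm (E S f))\<^sup>2)"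
      using S L by (simp add: nn_integral_cmult_indicator emeasure_mu flip: ennreal_mult)
    also have "\<dots> \<le> ennreal (((e+d)/(e-d))\<^sup>2 * (l2_norm (E S u))\<^sup>2)"
    proof (rule ennreal_leI)
      have "1 / (D - d)\<^sup>2 * (l2_norm (E S f))\<^sup>2 \<le> 1 / (D - d)\<^sup>2 * ((D + d) * l2_norm (E S u))\<^sup>2"
        by (intro mult_left_mono F1) auto
      also have "\<dots> = ((D + d) / (D - d))\<^sup>2 * (l2_norm (E S u))\<^sup>2"
        by (simp add: power_mult_distrib power_divide)
      also have "\<dots> \<le> ((e+d)/(e-d))\<^sup>2 * (l2_norm (E S u))\<^sup>2"
        by (intro mult_right_mono R2) auto
      finally show "1 / (D - d)\<^sup>2 * (l2_norm (E S f))\<^sup>2 \<le> ((e+d)/(e-d))\<^sup>2 * (l2_norm (E S u))\<^sup>2" .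
    qed
    also have "\<dots> = ennreal (((e+d)/(e-d))\<^sup>2) * emeasure (\<mu> u) S"
      using S L by (simp add: emeasure_mu ennreal_mult)
    finally have 1: "emeasure M S \<le> ennreal (((e+d)/(e-d))\<^sup>2) * emeasure (\<mu> u) S" .
    have "(l2_norm (E S u))\<^sup>2 \<le> ((e+d)/(e-d))\<^sup>2 * (1 / (D + d)\<^sup>2 * (l2_norm (E S f))\<^sup>2)"
    proof -
      have "(l2_norm (E S u))\<^sup>2 = ((D + d) / (D - d))\<^sup>2 * (1 / (D + d)\<^sup>2 * ((D - d) * l2_norm (E S u))\<^sup>2)"
        using De d by (simp add: power_mult_distrib power_divide)
      also have "\<dots> \<le> ((D + d) / (D - d))\<^sup>2 * (1 / (D + d)\<^sup>2 * (l2_norm (E S f))\<^sup>2)"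
        by (intro mult_left_mono F2) auto
      also have "\<dots> \<le> ((e+d)/(e-d))\<^sup>2 * (1 / (D + d)\<^sup>2 * (l2_norm (E S f))\<^sup>2)"
        by (intro mult_right_mono R2) auto
      finally show ?thesis .
    qed
    then have "emeasure (\<mu> u) S \<le> ennreal (((e+d)/(e-d))\<^sup>2) * ennreal (1 / (D + d)\<^sup>2 * (l2_norm (E S f))\<^sup>2)"
      using S L by (simp add: emeasure_mu ennreal_mult[symmetric] ennreal_leI)
    also have "ennreal (1 / (D + d)\<^sup>2 * (l2_norm (E S f))\<^sup>2) = (\<integral>\<^sup>+t. ennreal (1 / (D + d)\<^sup>2) * indicator S t \<partial>\<mu> f)"
      using S L by (simp add: nn_integral_cmult_indicator emeasure_mu flip: ennreal_mult)
    also have "\<dots> \<le> emeasure M S"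
      unfolding MS[OF S(1)]
    proof (intro nn_integral_mono)
      fix x
      have "norm (of_real x - z) > 0" if "x \<in> S" using t[OF that] De d by linarith
      then show "ennreal (1 / (D + d)\<^sup>2) * indicator S x \<le> \<kappa> x * indicator S x"
        using t[of x] De d unfolding \<kappa>_def
        by (cases "x \<in> S") (auto intro!: ennreal_leI divide_left_mono power_mono mult_pos_pos)
    qed
    finally have 2: "emeasure (\<mu> u) S \<le> ennreal (((e+d)/(e-d))\<^sup>2) * emeasure M S"
      by (simp add: mult_left_mono)
    from 1 2 show ?thesis by blast
  qed
  have global: "emeasure M UNIV \<le> ennreal (((e+d)/(e-d))\<^sup>2) * emeasure (\<mu> u) UNIV \<and>
      emeasure (\<mu> u) UNIV \<le> ennreal (((e+d)/(e-d))\<^sup>2) * emeasure M UNIV"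
    if d: "0 < d" "d < e" for d
  proof -
    \<comment> \<open>The cell with index j is [2 d j, 2 d (j + 1)), with midpoint 2 d j +
      d.\<close>
    define S where "S j = {x. \<lfloor>x / (2 * d)\<rfloor> = j}" for j :: int
    have Sb: "S j \<in> sets borel" for j unfolding S_def by measurable
    have Ss: "S j \<subseteq> {(2 * d * j + d) - d..(2 * d * j + d) + d}" for j
    proof
      fix x assume "x \<in> S j"
      then have "of_int j \<le> x / (2 * d)" "x / (2 * d) < of_int j + 1"
        unfolding S_def by (auto simp: floor_eq_iff)
      then have "of_int j * (2 * d) \<le> x" "x < (of_int j + 1) * (2 * d)"
        using d by (auto simp: field_simps)
      then show "x \<in> {(2 * d * j + d) - d..(2 * d * j + d) + d}" by (auto simp: algebra_simps)
    qed
    have dis: "disjoint_family S" by (auto simp: disjoint_family_on_def S_def)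
    have un: "(\<Union>j. S j) = UNIV" by (auto simp: S_def)
    show ?thesis
      using local[OF Sb Ss d] Msets Sb dis un
      by (intro conjI emeasure_UNIV_le_of_partition[of _ _ S]) auto
  qed
  \<comment> \<open>The limit in d needs finite right-hand sides; for M this follows from the
    comparison at d = e / 2.\<close>
  have fin: "emeasure (\<mu> u) UNIV < top" "emeasure M UNIV < top"
  proof -
    show 1: "emeasure (\<mu> u) UNIV < top" using L by (simp add: emeasure_mu)
    have "emeasure M UNIV \<le> ennreal (((e+e/2)/(e-e/2))\<^sup>2) * emeasure (\<mu> u) UNIV"
      using global[of "e/2"] e by simp
    also have "\<dots> < top" using 1 by (simp add: ennreal_mult_less_top)
    finally show "emeasure M UNIV < top" .
  qed
  have "emeasure M UNIV = emeasure (\<mu> u) UNIV"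
  proof (rule antisym)
    show "emeasure M UNIV \<le> emeasure (\<mu> u) UNIV"
      using global by (intro ennreal_le_of_mult_le[OF e _ fin(1)]) blast
    show "emeasure (\<mu> u) UNIV \<le> emeasure M UNIV"
      using global by (intro ennreal_le_of_mult_le[OF e _ fin(2)]) blast
  qed
  then show ?thesis using MS[of UNIV] L by (simp add: \<kappa>_def emeasure_mu l2_norm_E_UNIV)
qed

end


section \<open>Stieltjes inversion and Stone's formula\<close>

lemma Poisson_kernel_integral:
  fixes a b t e :: real
  assumes "e > 0" "a \<le> b"
  shows "(LBINT l:{a..b}. e / ((t - l)\<^sup>2 + e\<^sup>2)) = arctan ((b - t) / e) - arctan ((a - t) / e)"
proof -
  have pos: "(t - l)\<^sup>2 + e\<^sup>2 > 0" for l using assms by (simp add: add_nonneg_pos)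
  have d: "((\<lambda>l. arctan ((l - t) / e)) has_real_derivative e / ((t - l)\<^sup>2 + e\<^sup>2)) (at l)" for l
  proof -
    have "1 / e / (1 + ((l - t)/e)\<^sup>2) = e / ((t - l)\<^sup>2 + e\<^sup>2)"
      using assms pos[of l] by (simp add: field_simps power2_eq_square)
    moreover have "((\<lambda>l. arctan ((l - t) / e)) has_real_derivative 1 / e / (1 + ((l - t)/e)\<^sup>2)) (at l)"
      using assms by (auto intro!: derivative_eq_intros simp: field_simps)
    ultimately show ?thesis by simp
  qed
  have "(LBINT l=ereal a..ereal b. e / ((t - l)\<^sup>2 + e\<^sup>2)) = arctan ((b - t) / e) - arctan ((a - t) / e)"
  proof (rule interval_integral_FTC_finite)
    show "continuous_on {min a b..max a b} (\<lambda>l. e / ((t - l)\<^sup>2 + e\<^sup>2))"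
      using pos by (intro continuous_intros ballI) (metis less_irrefl)
    show "((\<lambda>l. arctan ((l - t) / e)) has_vector_derivative e / ((t - l)\<^sup>2 + e\<^sup>2))
        (at l within {min a b..max a b})" for l
      using d[of l] unfolding has_real_derivative_iff_has_vector_derivative
      by (rule has_vector_derivative_at_within)
  qed
  then show ?thesis using assms by (simp add: interval_integral_Icc)
qed

text \<open>After integration over l and Fubini the kernel becomes a difference of arctangents,
  tending to pi inside (a, b), to pi / 2 at the ends and to 0 outside. The bound B serves twice: it
  dominates the integrals over l, and it excludes atoms, so the ends carry no mass.\<close>

theorem Stieltjes_inversion:
  fixes M :: "real measure" and \<rho> :: "real \<Rightarrow> real"
  assumes fin: "finite_measure M" and sets [measurable_cong, simp]: "sets M = sets borel"
    and ab: "a < b"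
    and lim: "\<And>l. l \<in> {a..b} \<Longrightarrow> ((\<lambda>e. LINT t|M. e / ((t - l)\<^sup>2 + e\<^sup>2)) \<longlongrightarrow> \<rho> l) (at_right 0)"
    and e0: "e0 > 0"
    and bound: "\<And>l e. l \<in> {a..b} \<Longrightarrow> 0 < e \<Longrightarrow> e < e0 \<Longrightarrow> (LINT t|M. e / ((t - l)\<^sup>2 + e\<^sup>2)) \<le> B"
  shows "set_integrable lborel {a..b} \<rho>" "pi * measure M {a..b} = (LBINT l:{a..b}. \<rho> l)"
proof -
  interpret finite_measure M by (rule fin)
  have [simp]: "space M = UNIV" using sets_eq_imp_space_eq[OF sets] by simp
  define K where "K e t l = e / ((t - l)\<^sup>2 + e\<^sup>2)" for e t l :: real
  define N where "N e l = (LINT t|M. K e t l)" for e l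
  have K0: "0 \<le> K e t l" if "e > 0" for e t l using that by (simp add: K_def)
  have K1: "K e t l \<le> 1 / e" if "e > 0" for e t l
  proof -
    have "e / ((t - l)\<^sup>2 + e\<^sup>2) \<le> e / e\<^sup>2"
      using that by (intro divide_left_mono) (auto simp: add_nonneg_pos)
    then show ?thesis using that by (simp add: K_def power2_eq_square)
  qed
  have Kint: "integrable M (\<lambda>t. K e t l)" if "e > 0" for e l
  proof (rule integrable_const_bound[of _ "1/e"])
    show "AE t in M. norm (K e t l) \<le> 1 / e"
      using K0[OF that] K1[OF that] by (intro AE_I2) simp
    show "(\<lambda>t. K e t l) \<in> borel_measurable M" unfolding K_def by measurable
  qed
  have N0: "0 \<le> N e l" if "e > 0" for e l unfolding N_def using K0[OF that] by simp
  have Nm: "N e \<in> borel_measurable borel" for e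
    unfolding N_def K_def by measurable
  \<comment> \<open>Shifted by two, so that the sequence is below e0 already at n = 0.\<close>
  define \<epsilon> where "\<epsilon> n = e0 * inverse (real (Suc (Suc n)))" for n :: nat
  have \<epsilon>: "0 < \<epsilon> n" "\<epsilon> n < e0" for n
    using e0 by (auto simp: \<epsilon>_def field_simps add_pos_nonneg)
  have \<epsilon>0: "\<epsilon> \<longlonglongrightarrow> 0"
    unfolding \<epsilon>_def
    using tendsto_mult_left[OF LIMSEQ_Suc[OF LIMSEQ_inverse_real_of_nat], of e0] by simp
  have \<epsilon>r: "filterlim \<epsilon> (at_right 0) sequentially"
    using \<epsilon>(1) \<epsilon>0 by (auto simp: filterlim_at less_imp_neq[symmetric] intro!: always_eventually)
  have Nlim: "(\<lambda>n. N (\<epsilon> n) l) \<longlonglongrightarrow> \<rho> l" if "l \<in> {a..b}" for l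
    unfolding N_def K_def by (rule filterlim_compose[OF lim[OF that] \<epsilon>r])
  have NB: "N (\<epsilon> n) l \<le> B" if "l \<in> {a..b}" for n l
    unfolding N_def K_def using bound[OF that \<epsilon>] .
  have ind: "(\<lambda>n. indicator {a..b} l *\<^sub>R N (\<epsilon> n) l) \<longlonglongrightarrow> indicator {a..b} l *\<^sub>R \<rho> l" for l
    using Nlim[of l] by (cases "l \<in> {a..b}") auto
  have m\<rho>: "(\<lambda>l. indicator {a..b} l *\<^sub>R \<rho> l) \<in> borel_measurable lborel"
    using Nm by (intro borel_measurable_LIMSEQ_real[OF ind]) auto
  have dom: "integrable lborel (\<lambda>l. indicator {a..b} l *\<^sub>R B)"
    using ab by (simp add: integrable_mult_left_iff)
  have dombound: "norm (indicator {a..b} l *\<^sub>R N (\<epsilon> n) l) \<le> indicator {a..b} l *\<^sub>R B" for l n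
    using NB[of l n] N0[OF \<epsilon>(1), of n l] by (cases "l \<in> {a..b}") auto
  show "set_integrable lborel {a..b} \<rho>"
    unfolding set_integrable_def
    by (rule integrable_dominated_convergence[where w="\<lambda>l. indicator {a..b} l *\<^sub>R B" and s="\<lambda>n l. indicator {a..b} l *\<^sub>R N (\<epsilon> n) l"])
      (use m\<rho> dom dombound ind Nm in auto)
  have L1: "(\<lambda>n. LBINT l:{a..b}. N (\<epsilon> n) l) \<longlonglongrightarrow> (LBINT l:{a..b}. \<rho> l)"
    unfolding set_lebesgue_integral_def
    by (rule integral_dominated_convergence[where w="\<lambda>l. indicator {a..b} l *\<^sub>R B"])
      (use m\<rho> dom dombound ind Nm in auto)
  define A where "A n t = arctan ((b - t) / \<epsilon> n) - arctan ((a - t) / \<epsilon> n)" for n t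
  have fub: "(LBINT l:{a..b}. N (\<epsilon> n) l) = (LINT t|M. A n t)" for n
  proof -
    \<comment> \<open>Fubini is applied to Lebesgue measure on [a, b], which is finite; the bounded
      kernel is then integrable on the product.\<close>
    define L where "L = restrict_space lborel {a..b}"
    interpret L: finite_measure L
      unfolding L_def using ab by (intro finite_measureI) (simp add: space_restrict_space emeasure_restrict_space)
    interpret P: pair_sigma_finite M L ..
    have prod: "integrable (M \<Otimes>\<^sub>M L) (\<lambda>(t, l). K (\<epsilon> n) t l)"
    proof (rule finite_measure.integrable_const_bound[where B="1 / \<epsilon> n"])
      show "finite_measure (M \<Otimes>\<^sub>M L)"
        by (intro finite_measure_pair_measure) unfold_locales
      have f: "fst \<in> borel_measurable (M \<Otimes>\<^sub>M L)"
        using measurable_fst[of M L] by (simp cong: measurable_cong_sets)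
      have "(\<lambda>x. x) \<in> borel_measurable L"
        unfolding L_def by (intro measurable_restrict_space1) simp
      then have s: "snd \<in> borel_measurable (M \<Otimes>\<^sub>M L)"
        using measurable_compose[OF measurable_snd[of M L]] by blast
      show "(\<lambda>(t, l). K (\<epsilon> n) t l) \<in> borel_measurable (M \<Otimes>\<^sub>M L)"
        unfolding K_def case_prod_beta using f s by (intro borel_measurable_divide) auto
      show "AE x in M \<Otimes>\<^sub>M L. norm (case x of (t, l) \<Rightarrow> K (\<epsilon> n) t l) \<le> 1 / \<epsilon> n"
        using K0[OF \<epsilon>(1)] K1[OF \<epsilon>(1)] by auto
    qed
    have "(LBINT l:{a..b}. N (\<epsilon> n) l) = (LINT l|L. LINT t|M. K (\<epsilon> n) t l)"
      unfolding L_def N_def set_lebesgue_integral_def by (subst integral_restrict_space) auto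
    also have "\<dots> = (LINT t|M. LINT l|L. K (\<epsilon> n) t l)"
      by (rule P.Fubini_integral[OF prod])
    also have "\<dots> = (LINT t|M. A n t)"
    proof -
      have "(LINT l|L. K (\<epsilon> n) t l) = A n t" for t
        using Poisson_kernel_integral[OF \<epsilon>(1), of a b n t] ab
        unfolding L_def A_def K_def set_lebesgue_integral_def by (subst integral_restrict_space) auto
      then show ?thesis by simp
    qed
    finally show ?thesis .
  qed
  \<comment> \<open>\<open>sgn 0 = 0\<close> produces the half weight pi / 2 at t = a and t =
    b.\<close>
  define D where "D t = (pi/2) * sgn (b - t) - (pi/2) * sgn (a - t)" for t
  have at: "(\<lambda>n. arctan (x / \<epsilon> n)) \<longlonglongrightarrow> (pi/2) * sgn x" for x
  proof (cases "x = 0")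
    case False
    have inf: "filterlim (\<lambda>n. inverse (\<epsilon> n)) at_top sequentially"
      using \<epsilon>r by (rule filterlim_compose[OF filterlim_inverse_at_top_right])
    show ?thesis
    proof (cases "x > 0")
      case True
      have "filterlim (\<lambda>n. x * inverse (\<epsilon> n)) at_top sequentially"
        by (rule filterlim_tendsto_pos_mult_at_top[OF tendsto_const True inf])
      then have "(\<lambda>n. arctan (x * inverse (\<epsilon> n))) \<longlonglongrightarrow> pi/2"
        by (rule filterlim_compose[OF tendsto_arctan_at_top])
      then show ?thesis by (simp only: divide_inverse sgn_pos[OF True] mult_1_right)
    next
      case 2: False
      then have x: "x < 0" using False by simp
      have "filterlim (\<lambda>n. x * inverse (\<epsilon> n)) at_bot sequentially"
        by (rule filterlim_tendsto_neg_mult_at_bot[OF tendsto_const x inf])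
      then have "(\<lambda>n. arctan (x * inverse (\<epsilon> n))) \<longlonglongrightarrow> - (pi/2)"
        by (rule filterlim_compose[OF tendsto_arctan_at_bot])
      then show ?thesis by (simp only: divide_inverse sgn_neg[OF x] mult_minus_right mult_1_right)
    qed
  qed simp
  have L2: "(\<lambda>n. LINT t|M. A n t) \<longlonglongrightarrow> (LINT t|M. D t)"
  proof (rule integral_dominated_convergence[where w="\<lambda>_. pi"])
    show "AE t in M. (\<lambda>n. A n t) \<longlonglongrightarrow> D t"
      unfolding A_def D_def by (intro AE_I2 tendsto_diff at)
    show "AE t in M. norm (A n t) \<le> pi" for n
    proof (intro AE_I2)
      fix t show "norm (A n t) \<le> pi"
        using arctan_bounded[of "(b - t) / \<epsilon> n"] arctan_bounded[of "(a - t) / \<epsilon> n"]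
        unfolding A_def real_norm_def by arith
    qed
  qed (auto simp: A_def D_def)
  \<comment> \<open>The kernel is 1 / e at t = l, so the Poisson integral there is at least the mass
    of the atom divided by e; the bound B forces that mass to be at most e B.\<close>
  have atom: "measure M {l} = 0" if l: "l \<in> {a..b}" for l
  proof -
    have le: "measure M {l} \<le> \<epsilon> n * B" for n
    proof -
      have "measure M {l} = (LINT t|M. indicator {l} t)" by simp
      also have "\<dots> \<le> (LINT t|M. \<epsilon> n * K (\<epsilon> n) t l)"
      proof (rule integral_mono)
        show "integrable M (\<lambda>t. \<epsilon> n * K (\<epsilon> n) t l)"
          using Kint[OF \<epsilon>(1)] by (rule integrable_mult_right)
        show "indicator {l} t \<le> \<epsilon> n * K (\<epsilon> n) t l" for t
          using K0[OF \<epsilon>(1), of n t l] \<epsilon>(1)[of n]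
          by (cases "t = l") (auto simp: K_def power2_eq_square)
      qed (simp add: emeasure_eq_measure)
      also have "\<dots> = \<epsilon> n * N (\<epsilon> n) l" by (simp add: N_def)
      also have "\<dots> \<le> \<epsilon> n * B" using NB[OF l] \<epsilon>(1)[of n] by (simp add: mult_left_mono)
      finally show ?thesis .
    qed
    have "(\<lambda>n. \<epsilon> n * B) \<longlonglongrightarrow> 0 * B" by (intro tendsto_intros \<epsilon>0)
    then have "measure M {l} \<le> 0 * B" by (rule LIMSEQ_le_const) (use le in auto)
    then show ?thesis by (simp add: order_antisym)
  qed
  have "AE t in M. t \<noteq> a \<and> t \<noteq> b"
  proof -
    have "{a} \<in> null_sets M" "{b} \<in> null_sets M"
      using atom[of a] atom[of b] ab by (auto simp: null_sets_def emeasure_eq_measure)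
    then have "{a} \<union> {b} \<in> null_sets M" by (rule null_sets.Un)
    then show ?thesis by (intro AE_I'[of "{a} \<union> {b}"]) auto
  qed
  then have "AE t in M. D t = pi * indicator {a..b} t"
    by eventually_elim (use ab in \<open>auto simp: D_def sgn_if indicator_def\<close>)
  then have "(LINT t|M. D t) = (LINT t|M. pi * indicator {a..b} t)"
    by (intro integral_cong_AE) (auto simp: D_def)
  also have "\<dots> = pi * measure M {a..b}" by simp
  finally have "(LINT t|M. D t) = pi * measure M {a..b}" .
  with LIMSEQ_unique[OF L1 L2[folded fub]] show "pi * measure M {a..b} = (LBINT l:{a..b}. \<rho> l)" by simp
qed


section \<open>Poisson integrals of scalar spectral measures and Stone's formula\<close>

context pvm
begin

text \<open>The usual factor 1 / pi is left out; it reappears as the pi in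
  \<open>Stieltjes_inversion\<close>. The integrand is the imaginary part of 1 / (t - z) at z = l +
  i e.\<close>

definition poisson :: "(real \<Rightarrow> complex) \<Rightarrow> real \<Rightarrow> real \<Rightarrow> real" where
  "poisson f l e = (LINT t|\<mu> f. e / ((t - l)\<^sup>2 + e\<^sup>2))"

lemma nn_integral_poisson:
  assumes "f \<in> L2" "e > 0"
  shows "(\<integral>\<^sup>+t. ennreal (e / ((t - l)\<^sup>2 + e\<^sup>2)) \<partial>\<mu> f) = ennreal (poisson f l e)"
proof -
  interpret finite_measure "\<mu> f" by (rule finite_measure_mu[OF assms(1)])
  have "integrable (\<mu> f) (\<lambda>t. e / ((t - l)\<^sup>2 + e\<^sup>2))"
  proof (rule integrable_const_bound[of _ "e / e\<^sup>2"])
    show "AE t in \<mu> f. norm (e / ((t - l)\<^sup>2 + e\<^sup>2)) \<le> e / e\<^sup>2"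
      using assms by (intro AE_I2) (auto intro!: divide_left_mono simp: add_nonneg_pos)
    show "(\<lambda>t. e / ((t - l)\<^sup>2 + e\<^sup>2)) \<in> borel_measurable (\<mu> f)" by measurable
  qed
  then show ?thesis
    unfolding poisson_def using assms by (intro nn_integral_eq_integral) auto
qed

lemma poisson_nonneg: "e > 0 \<Longrightarrow> 0 \<le> poisson f l e"
  by (simp add: poisson_def)

lemma poisson_le:
  assumes "f \<in> L2" "e > 0"
  shows "poisson f l e \<le> (l2_norm f)\<^sup>2 / e"
proof -
  have "ennreal (poisson f l e) \<le> (\<integral>\<^sup>+t. ennreal (1 / e) \<partial>\<mu> f)"
    unfolding nn_integral_poisson[OF assms, symmetric]
  proof (intro nn_integral_mono ennreal_leI)
    fix t
    have "e / ((t - l)\<^sup>2 + e\<^sup>2) \<le> e / e\<^sup>2"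
      using assms by (intro divide_left_mono) (auto simp: add_nonneg_pos)
    then show "e / ((t - l)\<^sup>2 + e\<^sup>2) \<le> 1 / e" using assms by (simp add: power2_eq_square)
  qed
  also have "\<dots> = ennreal ((l2_norm f)\<^sup>2 / e)"
    using assms by (simp add: emeasure_mu l2_norm_E_UNIV flip: ennreal_mult)
  finally show ?thesis using assms by (simp add: ennreal_le_iff)
qed

text \<open>Young's inequality is applied to E A f and E A g for every A, which compares the
  spectral measures, and the result is integrated against the kernel.\<close>

lemma poisson_lincomb_le:
  assumes L: "f \<in> L2" "g \<in> L2" and e: "e > 0" and \<eta>: "\<eta> > 0" and c: "norm c = 1"
  shows "poisson (lincomb 1 f c g) l e \<le> (1 + \<eta>) * poisson f l e + (1 + 1 / \<eta>) * poisson g l e"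
proof -
  have fg: "lincomb 1 f c g \<in> L2" using L by simp
  have "ennreal (poisson (lincomb 1 f c g) l e)
     \<le> ennreal (1 + \<eta>) * ennreal (poisson f l e) + ennreal (1 + 1 / \<eta>) * ennreal (poisson g l e)"
    unfolding nn_integral_poisson[OF fg e, symmetric] nn_integral_poisson[OF L(1) e, symmetric]
      nn_integral_poisson[OF L(2) e, symmetric]
  proof (rule nn_integral_le_add_measure)
    fix A assume A: "A \<in> sets (\<mu> (lincomb 1 f c g))"
    have g': "l2_norm (lincomb c (E A g) 0 (E A g)) = l2_norm (E A g)"
    proof -
      have "(l2_norm (lincomb c (E A g) 0 (E A g)))\<^sup>2 = (l2_norm (E A g))\<^sup>2"
        using A L c by (simp add: l2_norm_lincomb_power2)
      then show ?thesis by simp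
    qed
    have "l2_norm (E A (lincomb 1 f c g)) = l2_norm (lincomb 1 (E A f) 1 (lincomb c (E A g) 0 (E A g)))"
      by (rule l2_norm_eqI) (use A L in \<open>auto simp: E_lincomb l2_inner_lincomb\<close>)
    then have "(l2_norm (E A (lincomb 1 f c g)))\<^sup>2
        \<le> (1 + \<eta>) * (l2_norm (E A f))\<^sup>2 + (1 + 1 / \<eta>) * (l2_norm (E A g))\<^sup>2"
      using l2_norm_lincomb_power2_le[of "E A f" "lincomb c (E A g) 0 (E A g)" \<eta>] A L \<eta> g' by simp
    then have "ennreal ((l2_norm (E A (lincomb 1 f c g)))\<^sup>2)
        \<le> ennreal ((1 + \<eta>) * (l2_norm (E A f))\<^sup>2 + (1 + 1 / \<eta>) * (l2_norm (E A g))\<^sup>2)"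
      by (rule ennreal_leI)
    then show "emeasure (\<mu> (lincomb 1 f c g)) A
        \<le> ennreal (1 + \<eta>) * emeasure (\<mu> f) A + ennreal (1 + 1 / \<eta>) * emeasure (\<mu> g) A"
      using A L \<eta> by (simp add: emeasure_mu ennreal_plus ennreal_mult)
  qed auto
  also have "\<dots> = ennreal ((1 + \<eta>) * poisson f l e + (1 + 1 / \<eta>) * poisson g l e)"
    using \<eta> e by (simp add: poisson_nonneg ennreal_plus ennreal_mult)
  finally show ?thesis
    using \<eta> e by (subst (asm) ennreal_le_iff) (auto simp: poisson_nonneg)
qed

end

context spectral
begin

lemma poisson_weak_eq:
  assumes L: "u \<in> L2" "f \<in> L2"
    and weak: "\<And>w w'. (w, w') \<in> T \<Longrightarrow> l2_inner u w' = l2_inner (lincomb 1 f (Complex l e) u) w"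
    and e: "e > 0"
  shows "poisson f l e = e * (l2_norm u)\<^sup>2"
proof -
  have eq: "(norm (complex_of_real t - Complex l e))\<^sup>2 = (t - l)\<^sup>2 + e\<^sup>2" for t
    by (simp add: cmod_power2)
  have "ennreal (poisson f l e) = (\<integral>\<^sup>+t. ennreal e * ennreal (1 / (norm (of_real t - Complex l e))\<^sup>2) \<partial>\<mu> f)"
    unfolding nn_integral_poisson[OF L(2) e, symmetric] eq
    using e by (simp flip: ennreal_mult)
  also have "\<dots> = ennreal e * ennreal ((l2_norm u)\<^sup>2)"
    using e by (subst nn_integral_cmult) (auto simp: weak_eq_nn_integral[OF L weak])
  finally have "ennreal (poisson f l e) = ennreal (e * (l2_norm u)\<^sup>2)"
    using e by (simp add: ennreal_mult)
  then show ?thesis using e by (simp add: poisson_nonneg)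
qed

text \<open>The error r is harmless because its Poisson integral is at most the square of its norm divided by e.\<close>

theorem Stone_approximate:
  assumes ab: "a < b" and e0: "e0 > 0" and g: "g \<in> L2"
    and L: "\<And>l e. l \<in> {a..b} \<Longrightarrow> 0 < e \<Longrightarrow> e < e0 \<Longrightarrow> u l e \<in> L2 \<and> r l e \<in> L2"
    and weak: "\<And>l e w w'. l \<in> {a..b} \<Longrightarrow> 0 < e \<Longrightarrow> e < e0 \<Longrightarrow> (w, w') \<in> T \<Longrightarrow>
      l2_inner (u l e) w' = l2_inner (lincomb 1 (lincomb 1 g 1 (r l e)) (Complex l e) (u l e)) w"
    and r: "\<And>l e. l \<in> {a..b} \<Longrightarrow> 0 < e \<Longrightarrow> e < e0 \<Longrightarrow> (l2_norm (r l e))\<^sup>2 \<le> K * e\<^sup>2"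
    and lim: "\<And>l. l \<in> {a..b} \<Longrightarrow> ((\<lambda>e. e * (l2_norm (u l e))\<^sup>2) \<longlongrightarrow> \<rho> l) (at_right 0)"
    and bound: "\<And>l e. l \<in> {a..b} \<Longrightarrow> 0 < e \<Longrightarrow> e < e0 \<Longrightarrow> e * (l2_norm (u l e))\<^sup>2 \<le> B"
  shows "set_integrable lborel {a..b} \<rho>" "pi * (l2_norm (E {a..b} g))\<^sup>2 = (LBINT l:{a..b}. \<rho> l)"
proof -
  \<comment> \<open>This is the effect of \<eta> = sqrt e: the error (1 + 1 / sqrt e) K e equals K
    (e + sqrt e), so it tends to 0 together with \<eta>.\<close>
  have K: "K * e\<^sup>2 / e + 1 / sqrt e * (K * e\<^sup>2 / e) = K * (e + sqrt e)" if "e > 0" for e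
  proof -
    have "1 / sqrt e * (K * e\<^sup>2 / e) = K * (e / sqrt e)" using that by (simp add: power2_eq_square)
    also have "e / sqrt e = sqrt e" using that by (simp add: real_div_sqrt)
    finally show ?thesis using that by (simp add: power2_eq_square algebra_simps)
  qed
  have est: "poisson g l e \<le> (1 + sqrt e) * (e * (l2_norm (u l e))\<^sup>2) + K * (e + sqrt e)"
       "e * (l2_norm (u l e))\<^sup>2 \<le> (1 + sqrt e) * poisson g l e + K * (e + sqrt e)"
    if le: "l \<in> {a..b}" "0 < e" "e < e0" for l e
  proof -
    define f where "f = lincomb 1 g 1 (r l e)"
    note ur = L[OF le]
    have f: "f \<in> L2" using g ur by (simp add: f_def)
    have pf: "poisson f l e = e * (l2_norm (u l e))\<^sup>2"
      using f ur weak[OF le] le(2) by (intro poisson_weak_eq) (auto simp: f_def)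
    have "poisson (r l e) l e \<le> (l2_norm (r l e))\<^sup>2 / e" using ur le by (intro poisson_le) auto
    also have "\<dots> \<le> K * e\<^sup>2 / e" using r[OF le] le by (simp add: divide_right_mono)
    finally have pr: "(1 + 1 / sqrt e) * poisson (r l e) l e \<le> (1 + 1 / sqrt e) * (K * e\<^sup>2 / e)"
      using le by (intro mult_left_mono) auto
    have pr': "(1 + 1 / sqrt e) * poisson (r l e) l e \<le> K * (e + sqrt e)"
      using pr K[OF le(2)] by (simp only: distrib_right mult_1)
    \<comment> \<open>Besides f = g + r also g = f - r, so one inequality gives both
      directions.\<close>
    have "lincomb 1 f (-1) (r l e) = g" by (simp add: f_def lincomb_def)
    then show "poisson g l e \<le> (1 + sqrt e) * (e * (l2_norm (u l e))\<^sup>2) + K * (e + sqrt e)"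
      using poisson_lincomb_le[of f "r l e" e "sqrt e" "-1" l] pr' f ur le by (simp add: pf)
    show "e * (l2_norm (u l e))\<^sup>2 \<le> (1 + sqrt e) * poisson g l e + K * (e + sqrt e)"
      using poisson_lincomb_le[of g "r l e" e "sqrt e" 1 l] pr' g ur le
      by (simp add: f_def[symmetric] pf)
  qed
  have sq: "(sqrt \<longlongrightarrow> 0) (at_right 0)"
    using tendsto_real_sqrt[OF tendsto_ident_at, of 0 "{0<..}"] by simp
  have id: "((\<lambda>e. e) \<longlongrightarrow> (0::real)) (at_right 0)" by (rule tendsto_ident_at)
  have plim: "((\<lambda>e. poisson g l e) \<longlongrightarrow> \<rho> l) (at_right 0)" if l: "l \<in> {a..b}" for l
  proof (rule tendsto_sandwich)
    have ev: "\<forall>\<^sub>F e in at_right 0. 0 < e \<and> e < e0"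
      using e0 by (auto simp: eventually_at_right_field)
    show "\<forall>\<^sub>F e in at_right 0. poisson g l e \<le> (1 + sqrt e) * (e * (l2_norm (u l e))\<^sup>2) + K * (e + sqrt e)"
      using ev by eventually_elim (use est(1)[OF l] in blast)
    show "\<forall>\<^sub>F e in at_right 0. (e * (l2_norm (u l e))\<^sup>2 - K * (e + sqrt e)) / (1 + sqrt e) \<le> poisson g l e"
      using ev
    proof eventually_elim
      case (elim e)
      have "1 + sqrt e > 0" using elim by (simp add: add_pos_nonneg)
      then show ?case using est(2)[OF l, of e] elim by (simp add: pos_divide_le_eq mult.commute)
    qed
    have "((\<lambda>e. (1 + sqrt e) * (e * (l2_norm (u l e))\<^sup>2) + K * (e + sqrt e)) \<longlongrightarrow>
       (1 + 0) * \<rho> l + K * (0 + 0)) (at_right 0)"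
      by (intro tendsto_intros lim[OF l] sq id)
    then show "((\<lambda>e. (1 + sqrt e) * (e * (l2_norm (u l e))\<^sup>2) + K * (e + sqrt e)) \<longlongrightarrow> \<rho> l) (at_right 0)"
      by simp
    have "((\<lambda>e. (e * (l2_norm (u l e))\<^sup>2 - K * (e + sqrt e)) / (1 + sqrt e)) \<longlongrightarrow>
       (\<rho> l - K * (0 + 0)) / (1 + 0)) (at_right 0)"
      by (intro tendsto_intros lim[OF l] sq id) simp
    then show "((\<lambda>e. (e * (l2_norm (u l e))\<^sup>2 - K * (e + sqrt e)) / (1 + sqrt e)) \<longlongrightarrow> \<rho> l) (at_right 0)"
      by simp
  qed
  have pbound: "poisson g l e \<le> (1 + sqrt e0) * \<bar>B\<bar> + \<bar>K\<bar> * (e0 + sqrt e0)"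
    if le: "l \<in> {a..b}" "0 < e" "e < e0" for l e
  proof -
    have "(1 + sqrt e) * (e * (l2_norm (u l e))\<^sup>2) \<le> (1 + sqrt e0) * \<bar>B\<bar>"
      using le bound[OF le] by (intro mult_mono add_mono) auto
    moreover have "K * (e + sqrt e) \<le> \<bar>K\<bar> * (e0 + sqrt e0)"
      using le by (intro mult_mono add_mono) auto
    ultimately show ?thesis using est(1)[OF le] by linarith
  qed
  note S = Stieltjes_inversion[OF finite_measure_mu[OF g] sets_mu ab plim[unfolded poisson_def] e0
      pbound[unfolded poisson_def]]
  show "set_integrable lborel {a..b} \<rho>" by (rule S(1))
  show "pi * (l2_norm (E {a..b} g))\<^sup>2 = (LBINT l:{a..b}. \<rho> l)"
    using S(2) g by (simp add: measure_mu)
qed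

end


section \<open>Linear differential equations on an interval\<close>

text \<open>Picard iteration with a terminal value at b. Writing w t = exp (K (b - t)) y t with K =
  2 L amounts to a weighted sup norm in which the iteration contracts by L / K = 1/2 on the whole
  interval at once.\<close>

theorem linear_growth_ode_exists:
  fixes f :: "real \<Rightarrow> 'a::banach \<Rightarrow> 'a"
  assumes ab: "a \<le> b" and L: "L > 0"
    and cont: "\<And>w. continuous_on {a..b} w \<Longrightarrow> continuous_on {a..b} (\<lambda>t. f t (w t))"
    and lip: "\<And>t x y. t \<in> {a..b} \<Longrightarrow> norm (f t x - f t y) \<le> L * norm (x - y)"
  shows "\<exists>w. w b = w0 \<and> (\<forall>t\<in>{a..b}. (w has_vector_derivative f t (w t)) (at t within {a..b}))"
proof -
  define K where "K = 2 * L"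
  have K: "K > 0" using L by (simp add: K_def)
  \<comment> \<open>Clamping extends a continuous function on [a, b] to a bounded continuous
    function on the line, an element of the complete space to which the fixed point theorem
    applies.\<close>
  define cl where "cl t = max a (min b t)" for t
  have cl: "cl t \<in> {a..b}" for t using ab by (auto simp: cl_def)
  have clid: "cl t = t" if "t \<in> {a..b}" for t using that by (auto simp: cl_def)
  have clc: "continuous_on S cl" for S unfolding cl_def by (intro continuous_intros)
  define g where "g y t = f t (exp (K * (b - t)) *\<^sub>R y t)" for y :: "real \<Rightarrow> 'a" and t
  have gc: "continuous_on {a..b} (g y)" if "continuous_on {a..b} y" for y
    unfolding g_def by (intro cont continuous_intros that)
  define \<Psi> where "\<Psi> y t = exp (- K * (b - t)) *\<^sub>R (w0 - integral {t..b} (g y))" for y t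
  have \<Psi>c: "continuous_on {a..b} (\<Psi> y)" if "continuous_on {a..b} y" for y
    unfolding \<Psi>_def
    by (intro continuous_intros indefinite_integral_continuous_1' integrable_continuous_real gc that)
  have bc: "(\<lambda>t. h (cl t)) \<in> bcontfun" if "continuous_on {a..b} h" for h :: "real \<Rightarrow> 'a"
  proof -
    have "continuous_on UNIV (\<lambda>t. h (cl t))"
      using cl by (intro continuous_on_compose2[OF that clc]) auto
    moreover have "bounded (range (\<lambda>t. h (cl t)))"
      by (rule bounded_subset[OF compact_imp_bounded[OF compact_continuous_image[OF that compact_Icc]]])
         (use cl in auto)
    ultimately show ?thesis by (simp add: bcontfun_def)
  qed
  define \<Phi> where "\<Phi> y = Bcontfun (\<lambda>t. \<Psi> (apply_bcontfun y) (cl t))" for y :: "real \<Rightarrow>\<^sub>C 'a"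
  have yc: "continuous_on S (apply_bcontfun y)" for y :: "real \<Rightarrow>\<^sub>C 'a" and S
    using apply_bcontfun[of y] by (auto simp: bcontfun_def intro: continuous_on_subset)
  have \<Phi>: "apply_bcontfun (\<Phi> y) t = \<Psi> (apply_bcontfun y) (cl t)" for y t
    unfolding \<Phi>_def by (subst Bcontfun_inverse) (auto intro!: bc \<Psi>c yc)
  have contr: "dist (\<Phi> x) (\<Phi> y) \<le> 1/2 * dist x y" for x y
  proof (rule dist_bound)
    fix t
    define s where "s = cl t"
    have s: "s \<in> {a..b}" using cl by (simp add: s_def)
    then have sub: "{s..b} \<subseteq> {a..b}" by auto
    define d where "d = dist x y"
    have d0: "d \<ge> 0" by (simp add: d_def)
    have int: "g (apply_bcontfun z) integrable_on {s..b}" for z :: "real \<Rightarrow>\<^sub>C 'a"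
      using gc[OF yc] sub by (intro integrable_continuous_real) (rule continuous_on_subset)
    have E: "((\<lambda>r. L * d * exp (K * (b - r))) has_integral (L * d / K * exp (K * (b - s)) - L * d / K)) {s..b}"
    proof -
      have "((\<lambda>r. L * d * exp (K * (b - r))) has_integral
          (- (L * d / K) * exp (K * (b - b)) - (- (L * d / K) * exp (K * (b - s))))) {s..b}"
      proof (rule fundamental_theorem_of_calculus)
        fix r
        have "((\<lambda>r. - (L * d / K) * exp (K * (b - r))) has_real_derivative L * d * exp (K * (b - r))) (at r within {s..b})"
          using K by (auto intro!: derivative_eq_intros)
        then show "((\<lambda>r. - (L * d / K) * exp (K * (b - r))) has_vector_derivative L * d * exp (K * (b - r))) (at r within {s..b})"
          by (simp add: has_real_derivative_iff_has_vector_derivative)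
      qed (use s in auto)
      then show ?thesis by simp
    qed
    have "norm (integral {s..b} (\<lambda>r. g (apply_bcontfun x) r - g (apply_bcontfun y) r))
        \<le> integral {s..b} (\<lambda>r. L * d * exp (K * (b - r)))"
    proof (rule integral_norm_bound_integral)
      show "(\<lambda>r. g (apply_bcontfun x) r - g (apply_bcontfun y) r) integrable_on {s..b}"
        using int by (rule integrable_diff) (rule int)
      show "(\<lambda>r. L * d * exp (K * (b - r))) integrable_on {s..b}" using E by blast
      fix r assume r: "r \<in> {s..b}"
      have "norm (g (apply_bcontfun x) r - g (apply_bcontfun y) r)
          \<le> L * norm (exp (K * (b - r)) *\<^sub>R apply_bcontfun x r - exp (K * (b - r)) *\<^sub>R apply_bcontfun y r)"
        unfolding g_def using r sub by (intro lip) auto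
      also have "\<dots> = L * exp (K * (b - r)) * dist (apply_bcontfun x r) (apply_bcontfun y r)"
        by (simp add: dist_norm flip: scaleR_diff_right)
      also have "\<dots> \<le> L * exp (K * (b - r)) * d"
        unfolding d_def using L by (intro mult_left_mono dist_bounded) auto
      finally show "norm (g (apply_bcontfun x) r - g (apply_bcontfun y) r) \<le> L * d * exp (K * (b - r))"
        by (simp add: mult_ac)
    qed
    also have "\<dots> \<le> L * d / K * exp (K * (b - s))"
      unfolding integral_unique[OF E] using L K d0 by simp
    finally have I: "norm (integral {s..b} (g (apply_bcontfun x)) - integral {s..b} (g (apply_bcontfun y)))
       \<le> L * d / K * exp (K * (b - s))"
      by (simp add: Henstock_Kurzweil_Integration.integral_diff int)
    have "dist (apply_bcontfun (\<Phi> x) t) (apply_bcontfun (\<Phi> y) t)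
      = norm (exp (- K * (b - s)) *\<^sub>R (integral {s..b} (g (apply_bcontfun y)) - integral {s..b} (g (apply_bcontfun x))))"
      unfolding \<Phi> s_def[symmetric] \<Psi>_def dist_norm by (simp flip: scaleR_diff_right)
    also have "\<dots> = exp (- K * (b - s)) * norm (integral {s..b} (g (apply_bcontfun x)) - integral {s..b} (g (apply_bcontfun y)))"
      by (simp add: norm_minus_commute)
    also have "\<dots> \<le> exp (- K * (b - s)) * (L * d / K * exp (K * (b - s)))"
      by (intro mult_left_mono I) auto
    also have "\<dots> = 1/2 * d"
      using L by (simp add: K_def exp_minus)
    finally show "dist (apply_bcontfun (\<Phi> x) t) (apply_bcontfun (\<Phi> y) t) \<le> 1/2 * dist x y"
      by (simp add: d_def)
  qed
  have "\<exists>!y. \<Phi> y = y"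
    by (rule banach_fix_type[of "1/2"]) (use contr in auto)
  then obtain y where y: "\<Phi> y = y" by blast
  define w where "w t = exp (K * (b - t)) *\<^sub>R apply_bcontfun y t" for t
  have wc: "continuous_on {a..b} w" unfolding w_def by (intro continuous_intros yc)
  have weq: "w t = w0 - integral {t..b} (\<lambda>r. f r (w r))" if t: "t \<in> {a..b}" for t
  proof -
    have "apply_bcontfun y t = \<Psi> (apply_bcontfun y) t"
      using \<Phi>[of y t] y clid[OF t] by simp
    moreover have "g (apply_bcontfun y) = (\<lambda>r. f r (w r))"
      by (simp add: g_def w_def fun_eq_iff)
    ultimately show ?thesis by (simp add: w_def \<Psi>_def exp_minus)
  qed
  have "(w has_vector_derivative f t (w t)) (at t within {a..b})" if t: "t \<in> {a..b}" for t
  proof -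
    have "((\<lambda>x. integral {x..b} (\<lambda>r. f r (w r))) has_vector_derivative - f t (w t)) (at t within {a..b})"
      by (rule integral_has_vector_derivative'[OF cont[OF wc] t])
    then have "((\<lambda>x. w0 - integral {x..b} (\<lambda>r. f r (w r))) has_vector_derivative 0 - (- f t (w t))) (at t within {a..b})"
      by (intro has_vector_derivative_diff has_vector_derivative_const)
    then have "((\<lambda>x. w0 - integral {x..b} (\<lambda>r. f r (w r))) has_vector_derivative f t (w t)) (at t within {a..b})"
      by simp
    then show ?thesis
      by (rule has_vector_derivative_transform[OF t, rotated]) (use weq in auto)
  qed
  moreover have "w b = w0" using weq[of b] ab by simp
  ultimately show ?thesis by blast
qed

text \<open>The differential inequality makes H x exp (L x) nondecreasing.\<close>

lemma Gronwall_backward: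
  fixes H :: "real \<Rightarrow> real"
  assumes "a \<le> b" "continuous_on {a..b} H"
    and "\<And>x. a < x \<Longrightarrow> x < b \<Longrightarrow> (H has_real_derivative H' x) (at x)"
    and "\<And>x. a < x \<Longrightarrow> x < b \<Longrightarrow> - L * H x \<le> H' x"
  shows "H a \<le> H b * exp (L * (b - a))"
proof -
  have "H a * exp (L * a) \<le> H b * exp (L * b)"
  proof (rule DERIV_nonneg_imp_increasing_open[where f="\<lambda>x. H x * exp (L * x)"])
    fix x assume x: "a < x" "x < b"
    have "((\<lambda>x. H x * exp (L * x)) has_real_derivative H' x * exp (L * x) + exp (L * x) * L * H x) (at x)"
      using assms(3)[OF x] by (auto intro!: derivative_eq_intros)
    moreover have "H' x * exp (L * x) + exp (L * x) * L * H x = (H' x + L * H x) * exp (L * x)"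
      by (simp add: algebra_simps)
    moreover have "\<dots> \<ge> 0" using assms(4)[OF x] by simp
    ultimately show "\<exists>y. ((\<lambda>x. H x * exp (L * x)) has_real_derivative y) (at x) \<and> 0 \<le> y" by metis
  qed (use assms in \<open>auto intro!: continuous_intros\<close>)
  then have "H a \<le> H b * exp (L * b) / exp (L * a)" by (simp add: field_simps)
  then show ?thesis by (simp add: exp_diff right_diff_distrib)
qed

lemma Gronwall_forward:
  fixes H :: "real \<Rightarrow> real"
  assumes "a \<le> b" "continuous_on {a..b} H"
    and "\<And>x. a < x \<Longrightarrow> x < b \<Longrightarrow> (H has_real_derivative H' x) (at x)"
    and "\<And>x. a < x \<Longrightarrow> x < b \<Longrightarrow> H' x \<le> L * H x"
  shows "H b \<le> H a * exp (L * (b - a))"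
proof -
  have "- (H b * exp (- L * b)) \<ge> - (H a * exp (- L * a))"
  proof (rule DERIV_nonneg_imp_increasing_open[where f="\<lambda>x. - (H x * exp (- L * x))"])
    fix x assume x: "a < x" "x < b"
    have "((\<lambda>x. - (H x * exp (- L * x))) has_real_derivative - (H' x * exp (- L * x) + exp (- L * x) * (- L) * H x)) (at x)"
      using assms(3)[OF x] by (auto intro!: derivative_eq_intros)
    moreover have "- (H' x * exp (- L * x) + exp (- L * x) * (- L) * H x) = (L * H x - H' x) * exp (- L * x)"
      by (simp add: algebra_simps)
    moreover have "\<dots> \<ge> 0" using assms(4)[OF x] by simp
    ultimately show "\<exists>y. ((\<lambda>x. - (H x * exp (- L * x))) has_real_derivative y) (at x) \<and> 0 \<le> y" by metis
  qed (use assms in \<open>auto intro!: continuous_intros\<close>)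
  then have "H b \<le> H a * exp (- L * a) / exp (- L * b)" by (simp add: field_simps)
  then show ?thesis by (simp add: exp_diff right_diff_distrib exp_minus field_simps)
qed

text \<open>Adding m^2 to |w|^2 absorbs the inhomogeneous term: 2 |w| m <= |w|^2 + m^2, so this
  energy H satisfies |H'| <= (2 L + 1) H and Gronwall applies in both directions.\<close>

lemma linear_growth_ode_bounds:
  fixes w :: "real \<Rightarrow> 'a::real_inner"
  assumes ab: "a \<le> b" and c: "continuous_on {a..b} w" and "L \<ge> 0"
    and d: "\<And>x. a < x \<Longrightarrow> x < b \<Longrightarrow> (w has_vector_derivative w' x) (at x)"
    and le: "\<And>x. a < x \<Longrightarrow> x < b \<Longrightarrow> norm (w' x) \<le> L * norm (w x) + m"
  shows "(norm (w a))\<^sup>2 + m\<^sup>2 \<le> ((norm (w b))\<^sup>2 + m\<^sup>2) * exp ((2 * L + 1) * (b - a))"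
    and "(norm (w b))\<^sup>2 + m\<^sup>2 \<le> ((norm (w a))\<^sup>2 + m\<^sup>2) * exp ((2 * L + 1) * (b - a))"
proof -
  have D: "((\<lambda>x. (norm (w x))\<^sup>2 + m\<^sup>2) has_real_derivative 2 * (w x \<bullet> w' x)) (at x)"
    if "a < x" "x < b" for x
  proof -
    have "((\<lambda>x. w x \<bullet> w x) has_derivative (\<lambda>h. w x \<bullet> (h *\<^sub>R w' x) + (h *\<^sub>R w' x) \<bullet> w x)) (at x)"
      using d[OF that] by (intro has_derivative_inner) (auto simp: has_vector_derivative_def)
    then have "((\<lambda>x. w x \<bullet> w x) has_real_derivative 2 * (w x \<bullet> w' x)) (at x)"
      unfolding has_field_derivative_def by (rule has_derivative_eq_rhs) (auto simp: inner_commute)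
    then show ?thesis
      unfolding dot_square_norm[symmetric] by (auto intro!: derivative_eq_intros)
  qed
  have B: "\<bar>2 * (w x \<bullet> w' x)\<bar> \<le> (2 * L + 1) * ((norm (w x))\<^sup>2 + m\<^sup>2)" if "a < x" "x < b" for x
  proof -
    have "\<bar>2 * (w x \<bullet> w' x)\<bar> \<le> 2 * (norm (w x) * norm (w' x))"
      using Cauchy_Schwarz_ineq2[of "w x" "w' x"] by simp
    also have "\<dots> \<le> 2 * (norm (w x) * (L * norm (w x) + m))"
      by (intro mult_left_mono le that) auto
    also have "\<dots> = 2 * L * (norm (w x))\<^sup>2 + 2 * norm (w x) * m"
      by (simp add: algebra_simps power2_eq_square)
    also have "2 * norm (w x) * m \<le> (norm (w x))\<^sup>2 + m\<^sup>2"
      using sum_squares_bound[of "norm (w x)" m] by simp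
    also have "2 * L * (norm (w x))\<^sup>2 + ((norm (w x))\<^sup>2 + m\<^sup>2) \<le> (2 * L + 1) * ((norm (w x))\<^sup>2 + m\<^sup>2)"
      using \<open>L \<ge> 0\<close> by (simp add: algebra_simps)
    finally show ?thesis by simp
  qed
  have C: "continuous_on {a..b} (\<lambda>x. (norm (w x))\<^sup>2 + m\<^sup>2)"
    by (intro continuous_intros c)
  show "(norm (w a))\<^sup>2 + m\<^sup>2 \<le> ((norm (w b))\<^sup>2 + m\<^sup>2) * exp ((2 * L + 1) * (b - a))"
  proof (rule Gronwall_backward[OF ab C D])
    show "- (2 * L + 1) * ((norm (w x))\<^sup>2 + m\<^sup>2) \<le> 2 * (w x \<bullet> w' x)" if "a < x" "x < b" for x
      unfolding mult_minus_left using abs_le_D2[OF B[OF that]] by linarith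
  qed
  show "(norm (w b))\<^sup>2 + m\<^sup>2 \<le> ((norm (w a))\<^sup>2 + m\<^sup>2) * exp ((2 * L + 1) * (b - a))"
    by (rule Gronwall_forward[OF ab C D]) (use abs_le_D1[OF B] in auto)
qed


section \<open>The Dirichlet operator\<close>

lemma at_within_Ici_neq_bot: "(x::real) \<ge> 0 \<Longrightarrow> at x within {0..} \<noteq> bot"
  using at_le[of "{x<..}" "{0..}" x] trivial_limit_at_right_real[of x]
  by (metis atLeast_iff bot.extremum_uniqueI greaterThan_iff less_imp_le order_trans subsetI)

lemma hl_deriv_eqI:
  assumes "(f has_vector_derivative D) (at x within {0..})" "x \<ge> 0"
  shows "hl_deriv f x = D"
  unfolding hl_deriv_def
  by (rule vector_derivative_within[OF at_within_Ici_neq_bot[OF assms(2)] assms(1)])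

lemma has_hl_deriv:
  assumes "f differentiable_on {0..}" "x \<ge> 0"
  shows "(f has_vector_derivative hl_deriv f x) (at x within {0..})"
  using assms unfolding hl_deriv_def differentiable_on_def
  by (auto simp: vector_derivative_works)

lemma differentiable_on_of_has_vector_derivative:
  assumes "\<And>x. x \<in> S \<Longrightarrow> (f has_vector_derivative D x) (at x within S)"
  shows "f differentiable_on S"
  using assms by (auto simp: differentiable_on_def intro: differentiableI_vector)

lemma has_vector_derivative_at_of_Ici:
  assumes "(f has_vector_derivative D) (at x within {0..})" "(x::real) > 0"
  shows "(f has_vector_derivative D) (at x)"
proof -
  have "at x within {0..} = at x"
    using assms(2) by (intro at_within_interior) (simp add: interior_Ici[of "-1"])
  then show ?thesis using assms(1) by simp
qed

lemma hl_smooth_lincomb: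
  assumes "hl_smooth u" "hl_smooth v"
  shows "hl_smooth (lincomb a u b v)"
proof -
  \<comment> \<open>Agreement can be claimed on [0,\<infinity>) only: at negative x the filter
    \<open>at x within {0..}\<close> is trivial and \<open>hl_deriv\<close> is arbitrary.\<close>
  have "(\<forall>x\<ge>0. (hl_deriv ^^ n) (lincomb a u b v) x
      = lincomb a ((hl_deriv ^^ n) u) b ((hl_deriv ^^ n) v) x) \<and>
    (hl_deriv ^^ n) (lincomb a u b v) differentiable_on {0..}" for n
  proof (induction n)
    case 0
    then show ?case using assms[unfolded hl_smooth_def, rule_format, of 0]
      by (auto simp: lincomb_def intro!: derivative_intros)
  next
    case (Suc n)
    have du: "((hl_deriv ^^ k) u has_vector_derivative (hl_deriv ^^ Suc k) u x) (at x within {0..})"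
      and dv: "((hl_deriv ^^ k) v has_vector_derivative (hl_deriv ^^ Suc k) v x) (at x within {0..})"
      if "x \<ge> 0" for x k
      using has_hl_deriv[OF _ that] assms by (auto simp: hl_smooth_def)
    have d: "(lincomb a ((hl_deriv ^^ k) u) b ((hl_deriv ^^ k) v) has_vector_derivative
        lincomb a ((hl_deriv ^^ Suc k) u) b ((hl_deriv ^^ Suc k) v) x) (at x within {0..})" if "x \<ge> 0" for x k
      using du[OF that, of k] dv[OF that, of k] unfolding lincomb_def
      by (intro has_vector_derivative_add has_vector_derivative_mult_right) auto
    have "((hl_deriv ^^ n) (lincomb a u b v) has_vector_derivative
        lincomb a ((hl_deriv ^^ Suc n) u) b ((hl_deriv ^^ Suc n) v) x) (at x within {0..})" if "x \<ge> 0" for x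
      using that Suc by (intro has_vector_derivative_transform[OF _ _ d]) auto
    then have eq: "(hl_deriv ^^ Suc n) (lincomb a u b v) x
      = lincomb a ((hl_deriv ^^ Suc n) u) b ((hl_deriv ^^ Suc n) v) x" if "x \<ge> 0" for x
      using that by (simp add: hl_deriv_eqI)
    have "((hl_deriv ^^ Suc n) (lincomb a u b v) has_vector_derivative
        lincomb a ((hl_deriv ^^ Suc (Suc n)) u) b ((hl_deriv ^^ Suc (Suc n)) v) x) (at x within {0..})" if "x \<ge> 0" for x
      by (rule has_vector_derivative_transform[OF _ _ d]) (use that eq in auto)
    then show ?case using eq by (auto intro: differentiable_on_of_has_vector_derivative)
  qed
  then show ?thesis by (simp add: hl_smooth_def)
qed

lemma hl_test_function_lincomb:
  assumes "hl_test_function u" "hl_test_function v"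
  shows "hl_test_function (lincomb a u b v)"
proof -
  obtain R R' where "\<forall>x>R. u x = 0" "\<forall>x>R'. v x = 0"
    using assms by (auto simp: hl_test_function_def)
  then have "\<forall>x>max R R'. lincomb a u b v x = 0" by (simp add: lincomb_def)
  then have "\<exists>R. \<forall>x>R. lincomb a u b v x = 0" by blast
  then show ?thesis using assms hl_smooth_lincomb by (auto simp: hl_test_function_def)
qed

lemma hl_measurable_continuous:
  fixes f :: "real \<Rightarrow> complex"
  assumes "continuous_on {0..} f"
  shows "f \<in> borel_measurable hl_measure"
  by (rule continuous_imp_measurable_on_sets_lebesgue) (use assms in \<open>auto intro: continuous_on_subset\<close>)

text \<open>Inner products are Lebesgue integrals over the open half-line, while the fundamental
  theorem of calculus below yields gauge integrals over [0, R]. This is the bridge.\<close>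

lemma hl_integral_compact_support:
  fixes f :: "real \<Rightarrow> 'b::euclidean_space"
  assumes c: "continuous_on {0..R} f" and z: "\<And>x. x > R \<Longrightarrow> f x = 0" and R: "R \<ge> 0"
  shows "has_bochner_integral hl_measure f (integral {0..R} f)"
proof -
  have "f absolutely_integrable_on {0..R}"
    by (rule absolutely_integrable_continuous_real[OF c])
  then have "f absolutely_integrable_on {0<..R}"
    by (rule set_integrable_subset) auto
  then have *: "set_integrable lebesgue {0<..} f"
    unfolding set_integrable_def
    by (rule Bochner_Integration.integrable_cong[THEN iffD1, rotated 2]) (use z in \<open>force simp: indicator_def\<close>)+
  then have i: "integrable hl_measure f" by (simp add: integrable_restrict_space set_integrable_def)
  have "integral\<^sup>L hl_measure f = integral {0<..} f"
    by (rule lebesgue_integral_eq_integral[OF i]) simp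
  also have "\<dots> = integral {0..R} f"
  proof (rule integral_spike_set)
    show "negligible {x \<in> {0<..} - {0..R}. f x \<noteq> 0}"
      by (rule negligible_subset[of "{}"]) (use z in \<open>auto simp: not_le\<close>)
    show "negligible {x \<in> {0..R} - {0<..}. f x \<noteq> 0}"
      by (rule negligible_subset[of "{0}"]) auto
  qed
  finally show ?thesis using i by (simp add: has_bochner_integral_iff)
qed

lemma L2_continuous_compact_support:
  assumes c: "continuous_on {0..} f" and z: "\<And>x. x > R \<Longrightarrow> f x = 0"
  shows "f \<in> L2"
proof -
  have "has_bochner_integral hl_measure (\<lambda>x. (norm (f x))\<^sup>2) (integral {0..max 0 R} (\<lambda>x. (norm (f x))\<^sup>2))"
    by (rule hl_integral_compact_support)
      (use z in \<open>auto intro!: continuous_intros continuous_on_subset[OF c]\<close>)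
  then show ?thesis using hl_measurable_continuous[OF c] by (auto simp: L2_def has_bochner_integral_iff)
qed

lemma hl_smooth_imp:
  assumes "hl_smooth f"
  shows "f differentiable_on {0..}" "hl_deriv f differentiable_on {0..}"
    "hl_deriv (hl_deriv f) differentiable_on {0..}"
  using assms[unfolded hl_smooth_def, rule_format, of 0] assms[unfolded hl_smooth_def, rule_format, of 1]
    assms[unfolded hl_smooth_def, rule_format, of 2] by (simp_all add: numeral_2_eq_2)

lemma sturm_liouville_expand:
  fixes \<phi> :: "real \<Rightarrow> 'b::real_normed_vector"
  assumes p: "hl_smooth p" and \<phi>: "hl_smooth \<phi>" and x: "x \<ge> 0"
  shows "((\<lambda>y. p y *\<^sub>R hl_deriv \<phi> y) has_vector_derivative
      p x *\<^sub>R hl_deriv (hl_deriv \<phi>) x + hl_deriv p x *\<^sub>R hl_deriv \<phi> x) (at x within {0..})"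
    and "sturm_liouville p q \<phi> x
      = - (p x *\<^sub>R hl_deriv (hl_deriv \<phi>) x + hl_deriv p x *\<^sub>R hl_deriv \<phi> x) + q x *\<^sub>R \<phi> x"
proof -
  note dp = has_hl_deriv[OF hl_smooth_imp(1)[OF p] x]
  note d\<phi> = has_hl_deriv[OF hl_smooth_imp(2)[OF \<phi>] x]
  show *: "((\<lambda>y. p y *\<^sub>R hl_deriv \<phi> y) has_vector_derivative
      p x *\<^sub>R hl_deriv (hl_deriv \<phi>) x + hl_deriv p x *\<^sub>R hl_deriv \<phi> x) (at x within {0..})"
    using has_vector_derivative_scaleR[OF dp[folded has_real_derivative_iff_has_vector_derivative] d\<phi>] by simp
  show "sturm_liouville p q \<phi> x
      = - (p x *\<^sub>R hl_deriv (hl_deriv \<phi>) x + hl_deriv p x *\<^sub>R hl_deriv \<phi> x) + q x *\<^sub>R \<phi> x"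
    unfolding sturm_liouville_def hl_deriv_eqI[OF * x] ..
qed

lemma hl_deriv_zero_beyond:
  fixes f :: "real \<Rightarrow> 'b::real_normed_vector"
  assumes z: "\<And>x. x > R \<Longrightarrow> f x = 0" and x: "x > max 0 R"
  shows "hl_deriv f x = 0"
proof -
  have "(f has_vector_derivative 0) (at x)"
    by (rule has_vector_derivative_transform_within_open[of "\<lambda>_. 0" 0 x "{R<..}" f]) (use x z in auto)
  then show ?thesis using x by (intro hl_deriv_eqI[OF has_vector_derivative_at_within]) auto
qed

lemma sturm_liouville_test_function:
  fixes \<phi> :: "real \<Rightarrow> complex"
  assumes p: "hl_smooth p" and q: "hl_smooth q" and \<phi>: "hl_test_function \<phi>"
  shows "continuous_on {0..} (sturm_liouville p q \<phi>)"
    and "(\<And>x. x > R \<Longrightarrow> \<phi> x = 0) \<Longrightarrow> x > max 0 R \<Longrightarrow> sturm_liouville p q \<phi> x = 0"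
    and "sturm_liouville p q \<phi> \<in> L2" "\<phi> \<in> L2"
proof -
  have s: "hl_smooth \<phi>" using \<phi> by (simp add: hl_test_function_def)
  note d = differentiable_imp_continuous_on
  have "continuous_on {0..} (\<lambda>x. - (p x *\<^sub>R hl_deriv (hl_deriv \<phi>) x + hl_deriv p x *\<^sub>R hl_deriv \<phi> x) + q x *\<^sub>R \<phi> x)"
    by (intro continuous_intros d hl_smooth_imp p q s)
  then show c: "continuous_on {0..} (sturm_liouville p q \<phi>)"
    using sturm_liouville_expand(2)[OF p s] by (subst continuous_on_cong[OF refl]) auto
  show z: "sturm_liouville p q \<phi> x = 0" if z: "\<And>x. x > R \<Longrightarrow> \<phi> x = 0" and x: "x > max 0 R" for R x
  proof -
    have 1: "hl_deriv \<phi> x = 0" if "x > max 0 R" for x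
      using z that by (rule hl_deriv_zero_beyond)
    have "hl_deriv (hl_deriv \<phi>) x = 0"
      by (rule hl_deriv_zero_beyond[of "max 0 R"]) (use 1 x in auto)
    with 1[of x] z[of x] x show ?thesis by (subst sturm_liouville_expand(2)[OF p s]) auto
  qed
  obtain R where R: "\<And>x. x > R \<Longrightarrow> \<phi> x = 0" using \<phi> by (auto simp: hl_test_function_def)
  show "sturm_liouville p q \<phi> \<in> L2"
    by (rule L2_continuous_compact_support[OF c z[OF R]])
  show "\<phi> \<in> L2"
    using R by (intro L2_continuous_compact_support[of _ R] d hl_smooth_imp s)
qed

lemma sturm_liouville_lincomb:
  fixes u v :: "real \<Rightarrow> complex"
  assumes p: "hl_smooth p" and u: "hl_smooth u" and v: "hl_smooth v" and x: "x \<ge> 0"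
  shows "sturm_liouville p q (lincomb a u b v) x
    = lincomb a (sturm_liouville p q u) b (sturm_liouville p q v) x"
proof -
  have d: "hl_deriv (lincomb a f b g) y = lincomb a (hl_deriv f) b (hl_deriv g) y"
    if "f differentiable_on {0..}" "g differentiable_on {0..}" "y \<ge> 0" for f g y
    unfolding lincomb_def
    by (rule hl_deriv_eqI[OF _ that(3)])
      (intro has_vector_derivative_add has_vector_derivative_mult_right has_hl_deriv that)
  have d2: "hl_deriv (hl_deriv (lincomb a u b v)) x = lincomb a (hl_deriv (hl_deriv u)) b (hl_deriv (hl_deriv v)) x"
  proof -
    have "(lincomb a (hl_deriv u) b (hl_deriv v) has_vector_derivative
        lincomb a (hl_deriv (hl_deriv u)) b (hl_deriv (hl_deriv v)) x) (at x within {0..})"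
      unfolding lincomb_def
      by (intro has_vector_derivative_add has_vector_derivative_mult_right has_hl_deriv hl_smooth_imp u v x)
    then have "(hl_deriv (lincomb a u b v) has_vector_derivative
        lincomb a (hl_deriv (hl_deriv u)) b (hl_deriv (hl_deriv v)) x) (at x within {0..})"
      by (rule has_vector_derivative_transform[rotated 2]) (use x d hl_smooth_imp u v in auto)
    then show ?thesis using x by (rule hl_deriv_eqI)
  qed
  note e = sturm_liouville_expand(2)[OF p _ x]
  show ?thesis
    unfolding e[OF hl_smooth_lincomb[OF u v]] d[OF hl_smooth_imp(1)[OF u] hl_smooth_imp(1)[OF v] x] d2
    by (simp add: lincomb_def e[OF u] e[OF v] scaleR_conv_of_real algebra_simps)
qed

lemma dirichlet_operator_L2: "(u, v) \<in> dirichlet_operator p q \<Longrightarrow> u \<in> L2 \<and> v \<in> L2"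
  by (simp add: dirichlet_operator_def l2_closure_def)

lemma dirichlet_operatorE:
  assumes "(u, v) \<in> dirichlet_operator p q"
  obtains U where "\<And>n::nat. hl_test_function (U n)" "\<And>n. U n 0 = 0"
    "(\<lambda>n. l2_norm (\<lambda>x. U n x - u x)) \<longlonglongrightarrow> 0" "(\<lambda>n. l2_norm (\<lambda>x. sturm_liouville p q (U n) x - v x)) \<longlonglongrightarrow> 0"
proof -
  obtain U V where UV: "\<forall>n::nat. (U n, V n) \<in> dirichlet_core p q"
    "(\<lambda>n. l2_norm (\<lambda>x. U n x - u x)) \<longlonglongrightarrow> 0" "(\<lambda>n. l2_norm (\<lambda>x. V n x - v x)) \<longlonglongrightarrow> 0"
    using assms by (auto simp: dirichlet_operator_def l2_closure_def)
  have *: "V n = sturm_liouville p q (U n) \<and> hl_test_function (U n) \<and> U n 0 = 0" for n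
    using UV(1)[rule_format, of n] by (auto simp: dirichlet_core_def)
  show ?thesis by (rule that[of U]) (use * UV in auto)
qed

lemma dirichlet_operator_lincomb:
  assumes p: "hl_smooth p" and q: "hl_smooth q"
    and T: "(u, v) \<in> dirichlet_operator p q" "(u', v') \<in> dirichlet_operator p q"
  shows "(lincomb a u b u', lincomb a v b v') \<in> dirichlet_operator p q"
proof -
  obtain U where U: "\<And>n::nat. hl_test_function (U n)" "\<And>n. U n 0 = 0"
    "(\<lambda>n. l2_norm (\<lambda>x. U n x - u x)) \<longlonglongrightarrow> 0" "(\<lambda>n. l2_norm (\<lambda>x. sturm_liouville p q (U n) x - v x)) \<longlonglongrightarrow> 0"
    using dirichlet_operatorE[OF T(1)] by blast
  obtain U' where U': "\<And>n::nat. hl_test_function (U' n)" "\<And>n. U' n 0 = 0"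
    "(\<lambda>n. l2_norm (\<lambda>x. U' n x - u' x)) \<longlonglongrightarrow> 0" "(\<lambda>n. l2_norm (\<lambda>x. sturm_liouville p q (U' n) x - v' x)) \<longlonglongrightarrow> 0"
    using dirichlet_operatorE[OF T(2)] by blast
  define W where "W n = lincomb a (U n) b (U' n)" for n
  have W: "hl_test_function (W n)" "W n 0 = 0" for n
    using U U' by (auto simp: W_def hl_test_function_lincomb) (simp add: lincomb_def)
  \<comment> \<open>Z has to agree with the combination only for x > 0:
    \<open>sturm_liouville\<close> is linear only on the half-line, and \<open>hl_measure\<close>
    sees nothing else.\<close>
  have lim: "(\<lambda>n. l2_norm (\<lambda>x. Z n x - lincomb a w b w' x)) \<longlonglongrightarrow> 0"
    if L: "w \<in> L2" "w' \<in> L2" "\<And>n. X n \<in> L2" "\<And>n. X' n \<in> L2"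
      and l: "(\<lambda>n. l2_norm (\<lambda>x. X n x - w x)) \<longlonglongrightarrow> 0" "(\<lambda>n. l2_norm (\<lambda>x. X' n x - w' x)) \<longlonglongrightarrow> 0"
      and Z: "\<And>n x. x > 0 \<Longrightarrow> Z n x = lincomb a (X n) b (X' n) x" for X X' Z :: "nat \<Rightarrow> real \<Rightarrow> complex" and w w'
  proof (rule Lim_null_comparison[OF eventuallyI])
    fix n
    have "l2_norm (\<lambda>x. Z n x - lincomb a w b w' x) = l2_norm (lincomb a (lincomb 1 (X n) (-1) w) b (lincomb 1 (X' n) (-1) w'))"
      unfolding l2_norm_def
      by (intro arg_cong[of _ _ sqrt] Bochner_Integration.integral_cong) (auto simp: Z lincomb_def algebra_simps)
    also have "\<dots> \<le> norm a * l2_norm (lincomb 1 (X n) (-1) w) + norm b * l2_norm (lincomb 1 (X' n) (-1) w')"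
      using L by (intro l2_norm_lincomb_le) auto
    finally show "norm (l2_norm (\<lambda>x. Z n x - lincomb a w b w' x))
      \<le> norm a * l2_norm (\<lambda>x. X n x - w x) + norm b * l2_norm (\<lambda>x. X' n x - w' x)"
      by (simp add: lincomb_def)
    show "(\<lambda>n. norm a * l2_norm (\<lambda>x. X n x - w x) + norm b * l2_norm (\<lambda>x. X' n x - w' x)) \<longlonglongrightarrow> 0"
      using tendsto_add[OF tendsto_mult_left[OF l(1), of "norm a"] tendsto_mult_left[OF l(2), of "norm b"]] by simp
  qed
  have sm: "hl_smooth (U n)" "hl_smooth (U' n)" for n using U U' by (auto simp: hl_test_function_def)
  note L = dirichlet_operator_L2[OF T(1)] dirichlet_operator_L2[OF T(2)]
  have "(\<lambda>n. l2_norm (\<lambda>x. W n x - lincomb a u b u' x)) \<longlonglongrightarrow> 0"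
    by (rule lim[OF _ _ _ _ U(3) U'(3)])
      (use L sturm_liouville_test_function(4)[OF p q] U U' in \<open>auto simp: W_def\<close>)
  moreover have "(\<lambda>n. l2_norm (\<lambda>x. sturm_liouville p q (W n) x - lincomb a v b v' x)) \<longlonglongrightarrow> 0"
    by (rule lim[OF _ _ _ _ U(4) U'(4)])
      (use L sturm_liouville_test_function(3)[OF p q] U U' in \<open>auto simp: W_def sturm_liouville_lincomb p sm\<close>)
  moreover have "(W n, sturm_liouville p q (W n)) \<in> dirichlet_core p q" for n
    using W by (auto simp: dirichlet_core_def)
  ultimately show ?thesis
    unfolding dirichlet_operator_def l2_closure_def using L
    by (simp; intro exI[of _ W] exI[of _ "\<lambda>n. sturm_liouville p q (W n)"]) simp
qed

text \<open>Both sides are continuous in the graph norm, so an equation tested on the core extends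
  to its closure.\<close>

lemma dirichlet_operator_weak_eq:
  assumes p: "hl_smooth p" and q: "hl_smooth q" and L: "u \<in> L2" "f \<in> L2"
    and core: "\<And>\<phi>. hl_test_function \<phi> \<Longrightarrow> \<phi> 0 = 0 \<Longrightarrow> l2_inner u (sturm_liouville p q \<phi>) = l2_inner f \<phi>"
    and T: "(w, w') \<in> dirichlet_operator p q"
  shows "l2_inner u w' = l2_inner f w"
proof -
  obtain U where U: "\<And>n::nat. hl_test_function (U n)" "\<And>n. U n 0 = 0"
    "(\<lambda>n. l2_norm (\<lambda>x. U n x - w x)) \<longlonglongrightarrow> 0" "(\<lambda>n. l2_norm (\<lambda>x. sturm_liouville p q (U n) x - w' x)) \<longlonglongrightarrow> 0"
    using dirichlet_operatorE[OF T] by blast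
  note LT = dirichlet_operator_L2[OF T]
  have "(\<lambda>n. l2_inner u (sturm_liouville p q (U n))) \<longlonglongrightarrow> l2_inner u w'"
    using LT L U sturm_liouville_test_function(3)[OF p q U(1)] by (intro l2_inner_tendsto) auto
  moreover have "(\<lambda>n. l2_inner f (U n)) \<longlonglongrightarrow> l2_inner f w"
    using LT L U sturm_liouville_test_function(4)[OF p q U(1)] by (intro l2_inner_tendsto) auto
  ultimately show ?thesis using core U(1,2) by (simp add: LIMSEQ_unique)
qed


section \<open>Solutions of the Sturm--Liouville equation\<close>

locale sturm_liouville_data =
  fixes p q :: "real \<Rightarrow> real" and R :: real
  assumes p: "hl_smooth p" and q: "hl_smooth q"
    and p_pos: "\<And>x. x \<ge> 0 \<Longrightarrow> p x > 0"
    and R: "R > 0" and far: "\<And>x. x \<ge> R \<Longrightarrow> p x = 1 \<and> q x = 0"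
begin

lemma continuous_p: "S \<subseteq> {0..} \<Longrightarrow> continuous_on S p"
  using differentiable_imp_continuous_on[OF hl_smooth_imp(1)[OF p]] continuous_on_subset by blast

lemma continuous_q: "S \<subseteq> {0..} \<Longrightarrow> continuous_on S q"
  using differentiable_imp_continuous_on[OF hl_smooth_imp(1)[OF q]] continuous_on_subset by blast

lemma coeff_bound: "\<exists>L\<ge>0. \<forall>x\<in>{0..R}. 1 / p x + \<bar>q x\<bar> \<le> L"
proof -
  have "continuous_on {0..R} (\<lambda>x. 1 / p x + \<bar>q x\<bar>)"
    using p_pos by (intro continuous_intros continuous_p continuous_q) (auto simp: less_imp_neq[symmetric])
  then have "compact ((\<lambda>x. 1 / p x + \<bar>q x\<bar>) ` {0..R})"
    by (rule compact_continuous_image) simp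
  then obtain B where B: "\<forall>y\<in>(\<lambda>x. 1 / p x + \<bar>q x\<bar>) ` {0..R}. norm y \<le> B"
    using compact_imp_bounded bounded_iff by metis
  have "1 / p x + \<bar>q x\<bar> \<le> \<bar>B\<bar>" if "x \<in> {0..R}" for x
  proof -
    have "norm (1 / p x + \<bar>q x\<bar>) \<le> B" using B that by blast
    then show ?thesis by simp
  qed
  then show ?thesis by (intro exI[of _ "\<bar>B\<bar>"]) auto
qed

text \<open>G stands for the quasi-derivative p F'.\<close>

definition solution :: "real \<Rightarrow> (real \<Rightarrow> real) \<Rightarrow> (real \<Rightarrow> real) \<Rightarrow> bool" where
  "solution l F G \<longleftrightarrow> continuous_on {0..} F \<and> continuous_on {0..} G \<and>
    (\<forall>x>0. (F has_real_derivative G x / p x) (at x) \<and> (G has_real_derivative (q x - l) * F x) (at x)) \<and>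
    F 0 = 0 \<and> G 0 = p 0"

lemma regular_solution_imp:
  assumes "regular_solution p q l F"
  shows "solution l F (\<lambda>x. p x *\<^sub>R hl_deriv F x)"
proof -
  let ?G = "\<lambda>x. p x *\<^sub>R hl_deriv F x"
  have F: "F differentiable_on {0..}" and G: "?G differentiable_on {0..}"
    and eq: "\<And>x. x \<ge> 0 \<Longrightarrow> sturm_liouville p q F x = l * F x" and "F 0 = 0" "hl_deriv F 0 = 1"
    using assms by (auto simp: regular_solution_def)
  have "(F has_real_derivative ?G x / p x) (at x) \<and> (?G has_real_derivative (q x - l) * F x) (at x)" if x: "x > 0" for x
  proof
    show "(F has_real_derivative ?G x / p x) (at x)"
      using has_vector_derivative_at_of_Ici[OF has_hl_deriv[OF F] x] x p_pos[of x]
      by (simp add: has_real_derivative_iff_has_vector_derivative)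
    have "hl_deriv ?G x = (q x - l) * F x"
      using eq[of x] x by (simp add: sturm_liouville_def algebra_simps)
    then show "(?G has_real_derivative (q x - l) * F x) (at x)"
      using has_vector_derivative_at_of_Ici[OF has_hl_deriv[OF G] x] x
      by (simp add: has_real_derivative_iff_has_vector_derivative)
  qed
  then show ?thesis
    using F G \<open>F 0 = 0\<close> \<open>hl_deriv F 0 = 1\<close> by (simp add: solution_def differentiable_imp_continuous_on)
qed

text \<open>The pair (F, G) solves a homogeneous linear system, so its norm changes by at most a
  fixed factor along [0, R]. Going backward, this keeps the data at R away from 0, since G 0 = p 0;
  going forward, it bounds F. The dependence on l is through L alone, which gives
  uniformity.\<close>

lemma solution_bounds:
  assumes F: "solution l F G" and L: "\<And>x. x \<in> {0..R} \<Longrightarrow> 1 / p x + \<bar>q x\<bar> + \<bar>l\<bar> \<le> L"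
  defines "C \<equiv> exp ((2 * L + 1) * R)"
  shows "(p 0)\<^sup>2 \<le> ((F R)\<^sup>2 + (G R)\<^sup>2) * C"
    and "x \<in> {0..R} \<Longrightarrow> (F x)\<^sup>2 \<le> (p 0)\<^sup>2 * C"
proof -
  define w where "w x = (F x, G x)" for x
  have L0: "L \<ge> 0" using L[of R] R p_pos[of R] by (force intro: order_trans[rotated])
  have c: "continuous_on {0..b} w" for b
    unfolding w_def using F
    by (auto simp: solution_def intro!: continuous_on_Pair elim: continuous_on_subset)
  have d: "(w has_vector_derivative (G x / p x, (q x - l) * F x)) (at x)" if "x > 0" for x
    unfolding w_def using F that
    by (intro has_vector_derivative_Pair) (auto simp: solution_def has_real_derivative_iff_has_vector_derivative)
  have le: "norm (G x / p x, (q x - l) * F x) \<le> L * norm (w x) + 0" if x: "0 < x" "x < R" for x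
  proof -
    have px: "p x > 0" using p_pos x by simp
    have n: "\<bar>F x\<bar> \<le> norm (w x)" "\<bar>G x\<bar> \<le> norm (w x)"
      using norm_fst_le[of "F x" "G x"] norm_snd_le[of "G x" "F x"] by (simp_all add: w_def)
    have "norm (G x / p x, (q x - l) * F x) \<le> \<bar>G x / p x\<bar> + \<bar>(q x - l) * F x\<bar>"
      using norm_Pair_le[of "G x / p x" "(q x - l) * F x"] by simp
    also have "\<bar>G x / p x\<bar> = 1 / p x * \<bar>G x\<bar>" using px by simp
    also have "\<bar>(q x - l) * F x\<bar> = \<bar>q x - l\<bar> * \<bar>F x\<bar>" by (rule abs_mult)
    also have "1 / p x * \<bar>G x\<bar> + \<bar>q x - l\<bar> * \<bar>F x\<bar> \<le> 1 / p x * norm (w x) + (\<bar>q x\<bar> + \<bar>l\<bar>) * norm (w x)"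
      using n px by (intro add_mono mult_mono) auto
    also have "\<dots> = (1 / p x + \<bar>q x\<bar> + \<bar>l\<bar>) * norm (w x)" by (simp add: algebra_simps)
    also have "\<dots> \<le> L * norm (w x)" using x by (intro mult_right_mono L) auto
    finally show ?thesis by simp
  qed
  have F0: "F 0 = 0" "G 0 = p 0" using F by (auto simp: solution_def)
  have wn: "(norm (w x))\<^sup>2 = (F x)\<^sup>2 + (G x)\<^sup>2" for x by (simp add: w_def norm_Pair)
  have "(norm (w 0))\<^sup>2 + 0\<^sup>2 \<le> ((norm (w R))\<^sup>2 + 0\<^sup>2) * exp ((2 * L + 1) * (R - 0))"
    by (rule linear_growth_ode_bounds(1)[OF _ c L0 d le]) (use R in auto)
  then show "(p 0)\<^sup>2 \<le> ((F R)\<^sup>2 + (G R)\<^sup>2) * C" unfolding wn F0 by (simp add: C_def)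
  show "(F x)\<^sup>2 \<le> (p 0)\<^sup>2 * C" if x: "x \<in> {0..R}"
  proof -
    have "(norm (w x))\<^sup>2 + 0\<^sup>2 \<le> ((norm (w 0))\<^sup>2 + 0\<^sup>2) * exp ((2 * L + 1) * (x - 0))"
      by (rule linear_growth_ode_bounds(2)[OF _ c L0 d le]) (use x in auto)
    also have "\<dots> \<le> ((norm (w 0))\<^sup>2 + 0\<^sup>2) * C"
      unfolding C_def using x L0 by (intro mult_left_mono) auto
    finally have "(F x)\<^sup>2 + (G x)\<^sup>2 \<le> (p 0)\<^sup>2 * C" unfolding wn F0 by simp
    then show ?thesis using zero_le_power2[of "G x"] by linarith
  qed
qed

text \<open>Here v is p u'. The data (a, s a) at R are those of a exp (s (x - R)), as p R = 1, so
  that this exponential can be attached at R with u and v continuous.\<close>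

lemma inhomogeneous_solution:
  fixes g :: "real \<Rightarrow> complex" and a s :: complex
  assumes g: "continuous_on {0..R} g" and m: "\<And>x. x \<in> {0..R} \<Longrightarrow> norm (g x) \<le> m"
    and L: "\<And>x. x \<in> {0..R} \<Longrightarrow> 1 / p x + \<bar>q x\<bar> + \<bar>l\<bar> \<le> L"
  shows "\<exists>u v. continuous_on {0..R} u \<and> continuous_on {0..R} v \<and> u R = a \<and> v R = s * a \<and>
    (\<forall>x. 0 < x \<longrightarrow> x < R \<longrightarrow> (u has_vector_derivative v x / of_real (p x)) (at x)
      \<and> (v has_vector_derivative of_real (q x - l) * u x - g x) (at x)) \<and>
    (\<forall>x\<in>{0..R}. (norm (u x))\<^sup>2 \<le> ((norm a)\<^sup>2 * (1 + (norm s)\<^sup>2) + m\<^sup>2) * exp ((2 * L + 1) * R))"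
proof -
  define f where "f t w = (snd w / of_real (p t), of_real (q t - l) * fst w - g t)" for t and w :: "complex \<times> complex"
  have "1 / p R + \<bar>q R\<bar> + \<bar>l\<bar> \<le> L" by (rule L) (use R in auto)
  then have L0: "L > 0" using far[of R] by auto
  have lip0: "norm (y / of_real (p t), of_real (q t - l) * x) \<le> L * norm (x, y)" if t: "t \<in> {0..R}"
    for t and x y :: complex
  proof -
    have pt: "p t > 0" using p_pos t by simp
    have "norm (y / of_real (p t), of_real (q t - l) * x) \<le> norm (y / of_real (p t)) + norm (of_real (q t - l) * x)"
      by (rule norm_Pair_le)
    also have "\<dots> = 1 / p t * norm y + \<bar>q t - l\<bar> * norm x"
      using pt by (simp add: norm_divide norm_mult del: of_real_diff)
    also have "\<dots> \<le> 1 / p t * norm (x, y) + (\<bar>q t\<bar> + \<bar>l\<bar>) * norm (x, y)"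
      using pt by (intro add_mono mult_mono) (auto simp: norm_fst_le norm_snd_le)
    also have "\<dots> = (1 / p t + \<bar>q t\<bar> + \<bar>l\<bar>) * norm (x, y)" by (simp add: algebra_simps)
    also have "\<dots> \<le> L * norm (x, y)" using t by (intro mult_right_mono L) auto
    finally show ?thesis .
  qed
  have "\<exists>w. w R = (a, s * a) \<and> (\<forall>t\<in>{0..R}. (w has_vector_derivative f t (w t)) (at t within {0..R}))"
  proof (rule linear_growth_ode_exists[OF _ L0])
    show "0 \<le> R" using R by simp
    show "continuous_on {0..R} (\<lambda>t. f t (w t))" if "continuous_on {0..R} w" for w
      unfolding f_def using p_pos
      by (intro continuous_intros continuous_p continuous_q that g) (auto simp: less_imp_neq[symmetric])
    show "norm (f t x - f t y) \<le> L * norm (x - y)" if t: "t \<in> {0..R}" for t x y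
    proof -
      have "f t x - f t y = (snd (x - y) / of_real (p t), of_real (q t - l) * fst (x - y))"
        by (simp add: f_def algebra_simps diff_divide_distrib)
      then show ?thesis using lip0[OF t, of "snd (x - y)" "fst (x - y)"] by (simp only: prod.collapse)
    qed
  qed
  then obtain w where w: "w R = (a, s * a)" "\<And>t. t \<in> {0..R} \<Longrightarrow> (w has_vector_derivative f t (w t)) (at t within {0..R})"
    by blast
  have wc: "continuous_on {0..R} w"
    using w(2) by (rule continuous_on_vector_derivative)
  have wd: "(w has_vector_derivative f x (w x)) (at x)" if "0 < x" "x < R" for x
  proof -
    have "at x within {0..R} = at x" using that by (intro at_within_interior) auto
    then show ?thesis using w(2)[of x] that by simp
  qed
  have bound: "(norm (fst (w x)))\<^sup>2 \<le> ((norm a)\<^sup>2 * (1 + (norm s)\<^sup>2) + m\<^sup>2) * exp ((2 * L + 1) * R)"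
    if x: "x \<in> {0..R}" for x
  proof -
    have "(norm (w x))\<^sup>2 + m\<^sup>2 \<le> ((norm (w R))\<^sup>2 + m\<^sup>2) * exp ((2 * L + 1) * (R - x))"
    proof (rule linear_growth_ode_bounds(1))
      show "continuous_on {x..R} w" using wc x by (auto elim: continuous_on_subset)
      show "(w has_vector_derivative f y (w y)) (at y)" if "x < y" "y < R" for y
        using wd[of y] that x by auto
      show "norm (f y (w y)) \<le> L * norm (w y) + m" if "x < y" "y < R" for y
      proof -
        have y: "y \<in> {0..R}" using that x by auto
        have "f y (w y) = (snd (w y) / of_real (p y), of_real (q y - l) * fst (w y)) - (0, g y)"
          by (simp add: f_def)
        also have "norm \<dots> \<le> norm (snd (w y) / of_real (p y), of_real (q y - l) * fst (w y)) + norm (0::complex, g y)"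
          by (rule norm_triangle_ineq4)
        also have "\<dots> \<le> L * norm (w y) + m"
          using lip0[OF y, of "snd (w y)" "fst (w y)"] m[OF y] by (simp add: norm_Pair)
        finally show ?thesis .
      qed
    qed (use x L0 in auto)
    also have "(norm (w R))\<^sup>2 = (norm a)\<^sup>2 * (1 + (norm s)\<^sup>2)"
      by (simp add: w(1) norm_Pair norm_mult power_mult_distrib algebra_simps)
    also have "((norm a)\<^sup>2 * (1 + (norm s)\<^sup>2) + m\<^sup>2) * exp ((2 * L + 1) * (R - x))
      \<le> ((norm a)\<^sup>2 * (1 + (norm s)\<^sup>2) + m\<^sup>2) * exp ((2 * L + 1) * R)"
      using x L0 by (intro mult_left_mono) auto
    finally have 1: "(norm (w x))\<^sup>2 + m\<^sup>2 \<le> ((norm a)\<^sup>2 * (1 + (norm s)\<^sup>2) + m\<^sup>2) * exp ((2 * L + 1) * R)" .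
    have "(norm (fst (w x)))\<^sup>2 \<le> (norm (w x))\<^sup>2"
      using norm_fst_le[of "fst (w x)" "snd (w x)"] by (intro power_mono) auto
    then show ?thesis using 1 zero_le_power2[of m] by linarith
  qed
  show ?thesis
  proof (rule exI[of _ "\<lambda>x. fst (w x)"], rule exI[of _ "\<lambda>x. snd (w x)"], intro conjI allI impI ballI)
    fix x assume x: "0 < x" "x < R"
    note d = wd[OF x, unfolded has_vector_derivative_def]
    show "((\<lambda>x. fst (w x)) has_vector_derivative snd (w x) / of_real (p x)) (at x)"
      using has_derivative_fst[OF d] by (simp add: has_vector_derivative_def f_def)
    show "((\<lambda>x. snd (w x)) has_vector_derivative of_real (q x - l) * fst (w x) - g x) (at x)"
      using has_derivative_snd[OF d] by (simp add: has_vector_derivative_def f_def)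
  qed (use w(1) bound in \<open>auto intro!: continuous_intros wc\<close>)
qed

text \<open>Beyond R the equation is F'' = -l F with G = F'. With k = sqrt l the function (F - i G /
  k) exp (-i k x) is then constant, and c is half of it; since F is real, the other exponential
  carries the conjugate coefficient.\<close>

lemma solution_far:
  assumes F: "solution l F G" and l: "l > 0" and x: "x \<ge> R"
  defines "c \<equiv> (of_real (F R) - \<i> * of_real (G R / sqrt l)) / 2 * exp (- (\<i> * of_real (sqrt l * R)))"
  shows "complex_of_real (F x) = c * exp (\<i> * of_real (sqrt l * x)) + cnj c * exp (- (\<i> * of_real (sqrt l * x)))"
proof -
  define k where "k = sqrt l"
  have k: "k > 0" "k * k = l" using l by (auto simp: k_def)
  define h where "h x = (of_real (F x) - \<i> * of_real (G x / k)) * exp (- (\<i> * of_real (k * x)))" for x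
  have "h x = h R"
  proof (rule has_derivative_zero_unique_strong_interval[of "{R}"])
    have "continuous_on {R..x} F" "continuous_on {R..x} G"
      using F R by (auto simp: solution_def elim!: continuous_on_subset)
    then show "continuous_on {R..x} h" unfolding h_def using k by (intro continuous_intros) auto
    show "(h has_derivative (\<lambda>h. 0)) (at y within {R..x})" if y: "y \<in> {R..x} - {R}" for y
    proof -
      have y0: "y > 0" "p y = 1" "q y = 0" using y R far[of y] by auto
      have dF: "(F has_real_derivative G y) (at y)" and dG: "(G has_real_derivative - l * F y) (at y)"
        using F y0 unfolding solution_def by (metis div_by_1, metis diff_0)
      have F': "((\<lambda>x. complex_of_real (F x)) has_vector_derivative of_real (G y)) (at y)"
        using dF by (intro has_vector_derivative_of_real) (simp add: has_real_derivative_iff_has_vector_derivative)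
      have G': "((\<lambda>x. complex_of_real (G x / k)) has_vector_derivative of_real (- l * F y / k)) (at y)"
        using DERIV_cdivide[OF dG, of k]
        by (intro has_vector_derivative_of_real) (simp add: has_real_derivative_iff_has_vector_derivative)
      have e': "((\<lambda>x. exp (- (\<i> * complex_of_real (k * x)))) has_vector_derivative
          - (\<i> * of_real k) * exp (- (\<i> * of_real (k * y)))) (at y)"
      proof -
        have "((\<lambda>z. exp (- (\<i> * (of_real k * z)))) has_field_derivative
          - (\<i> * of_real k) * exp (- (\<i> * (of_real k * of_real y)))) (at (of_real y) within UNIV)"
          by (auto intro!: derivative_eq_intros)
        from has_vector_derivative_real_field[OF this] show ?thesis by simp
      qed
      have "(h has_vector_derivative
         (of_real (F y) - \<i> * of_real (G y / k)) * (- (\<i> * of_real k) * exp (- (\<i> * of_real (k * y)))) +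
         (of_real (G y) - \<i> * of_real (- l * F y / k)) * exp (- (\<i> * of_real (k * y)))) (at y)"
        unfolding h_def
        by (intro has_vector_derivative_mult has_vector_derivative_diff F' e' has_vector_derivative_mult_right[OF G'])
      moreover have "(of_real (F y) - \<i> * of_real (G y / k)) * (- (\<i> * of_real k) * exp (- (\<i> * of_real (k * y)))) +
         (of_real (G y) - \<i> * of_real (- l * F y / k)) * exp (- (\<i> * of_real (k * y))) = (0::complex)"
        using k(1) unfolding k(2)[symmetric] by (simp add: field_simps)
      ultimately have "(h has_vector_derivative 0) (at y)" by simp
      then show ?thesis
        unfolding has_vector_derivative_def by (auto intro: has_derivative_at_withinI)
    qed
  qed (use x in auto)
  then have c: "c = h x / 2" unfolding c_def h_def k_def by simp
  have e: "exp (- (\<i> * of_real (k * x))) * exp (\<i> * of_real (k * x)) = (1::complex)"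
    by (simp add: exp_minus)
  have cc: "c * exp (\<i> * of_real (k * x)) = (of_real (F x) - \<i> * of_real (G x / k)) / 2"
    unfolding c h_def using e by (simp add: mult.assoc)
  have 1: "cnj (c * exp (\<i> * of_real (k * x))) = cnj c * exp (- (\<i> * of_real (k * x)))"
    by (simp add: exp_cnj)
  have "c * exp (\<i> * of_real (k * x)) + cnj (c * exp (\<i> * of_real (k * x))) = of_real (F x)"
    unfolding cc by (simp add: field_simps)
  then show ?thesis unfolding k_def[symmetric] 1 by (rule sym)
qed

end

text \<open>For the difference d of two coefficients, h x = d exp (i k x) has real part tending to
  0. A shift of x by the quarter period pi / (2 k) multiplies h by i, so the imaginary part tends to
  0 as well, while |h x| = |d| for all x.\<close>

lemma asymptotic_coeff_unique:
  assumes l: "l > 0" and c: "asymptotic_coeff l F c" and z: "asymptotic_coeff l F z"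
  shows "z = c"
proof -
  define k where "k = sqrt l"
  have k: "k > 0" using l by (simp add: k_def)
  define d where "d = z - c"
  define h where "h x = d * exp (\<i> * of_real (k * x))" for x :: real
  have lim: "((\<lambda>x. h x + cnj (h x)) \<longlongrightarrow> 0) at_top"
  proof -
    have "((\<lambda>x. (of_real (F x) - c * exp (\<i> * of_real (k * x)) - cnj c * exp (- (\<i> * of_real (k * x))))
       - (of_real (F x) - z * exp (\<i> * of_real (k * x)) - cnj z * exp (- (\<i> * of_real (k * x))))) \<longlongrightarrow> 0 - 0) at_top"
      using c z unfolding asymptotic_coeff_def k_def by (rule tendsto_diff)
    then show ?thesis by (simp add: h_def d_def exp_cnj algebra_simps)
  qed
  then have "((\<lambda>x. Re (h x + cnj (h x))) \<longlongrightarrow> Re 0) at_top" by (rule tendsto_Re)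
  then have "((\<lambda>x. 2 * Re (h x) / 2) \<longlongrightarrow> 0 / 2) at_top" by (intro tendsto_divide) simp_all
  then have re: "((\<lambda>x. Re (h x)) \<longlongrightarrow> 0) at_top" by simp
  have "filterlim (\<lambda>x. x + pi / (2 * k)) at_top at_top"
    using filterlim_tendsto_add_at_top[OF tendsto_const filterlim_ident, of "pi / (2 * k)"]
    by (simp add: add.commute)
  then have "((\<lambda>x. Re (h (x + pi / (2 * k)))) \<longlongrightarrow> 0) at_top"
    by (rule filterlim_compose[OF re])
  moreover have "h (x + pi / (2 * k)) = \<i> * h x" for x
  proof -
    have "\<i> * of_real (k * (x + pi / (2 * k))) = \<i> * of_real (k * x) + of_real pi / 2 * \<i>"
      using k by (simp add: algebra_simps)
    moreover have "exp (of_real pi / 2 * \<i>) = \<i>"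
      using cis_conv_exp[of "pi / 2"] by (simp add: mult.commute)
    ultimately show ?thesis unfolding h_def by (simp only: exp_add mult_ac)
  qed
  ultimately have "((\<lambda>x. - Im (h x)) \<longlongrightarrow> 0) at_top" by simp
  then have "((\<lambda>x. (Re (h x))\<^sup>2 + (- Im (h x))\<^sup>2) \<longlongrightarrow> 0\<^sup>2 + 0\<^sup>2) at_top"
    by (intro tendsto_intros re)
  moreover have "(Re (h x))\<^sup>2 + (- Im (h x))\<^sup>2 = (norm d)\<^sup>2" for x
    unfolding h_def power2_minus cmod_power2[symmetric] by (simp add: norm_mult)
  ultimately have "((\<lambda>x::real. (norm d)\<^sup>2) \<longlongrightarrow> 0) at_top" by simp
  then have "(norm d)\<^sup>2 = 0" by (simp add: tendsto_const_iff)
  then show ?thesis by (simp add: d_def)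
qed

section \<open>The asymptotic coefficient, Green's identity and the weak form of the
  equation\<close>

context sturm_liouville_data
begin

text \<open>The value of |c|^2 links the theorem to \<open>spectral_density\<close>, whose
  denominator is the same expression in the data at R.\<close>

lemma solution_asymptotic_coeff:
  assumes F: "solution l F G" and l: "l > 0" and nz: "(F R)\<^sup>2 + (G R)\<^sup>2 > 0"
  shows "\<exists>c. c \<noteq> 0 \<and> (norm c)\<^sup>2 = ((G R)\<^sup>2 + l * (F R)\<^sup>2) / (4 * l) \<and> (\<forall>z. asymptotic_coeff l F z \<longleftrightarrow> z = c)"
proof -
  define c where "c = (of_real (F R) - \<i> * of_real (G R / sqrt l)) / 2 * exp (- (\<i> * of_real (sqrt l * R)))"
  have "(norm c)\<^sup>2 = ((F R)\<^sup>2 + (G R / sqrt l)\<^sup>2) / 4"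
    unfolding c_def by (simp add: norm_mult norm_divide power_mult_distrib power_divide cmod_power2)
  also have "\<dots> = ((G R)\<^sup>2 + l * (F R)\<^sup>2) / (4 * l)"
    using l by (simp add: power_divide field_simps)
  finally have n: "(norm c)\<^sup>2 = ((G R)\<^sup>2 + l * (F R)\<^sup>2) / (4 * l)" .
  have "(G R)\<^sup>2 + l * (F R)\<^sup>2 > 0"
    using nz l by (cases "F R = 0") (auto simp: add_nonneg_pos)
  with n l have "c \<noteq> 0" by auto
  moreover have "asymptotic_coeff l F c"
  proof -
    have "\<forall>\<^sub>F x in at_top. complex_of_real (F x) - c * exp (\<i> * of_real (sqrt l * x))
        - cnj c * exp (- (\<i> * of_real (sqrt l * x))) = 0"
      using eventually_ge_at_top[of R]
    proof eventually_elim
      case (elim x)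
      show ?case unfolding solution_far[OF F l elim, folded c_def] by simp
    qed
    then show ?thesis unfolding asymptotic_coeff_def by (rule tendsto_eventually)
  qed
  ultimately show ?thesis using n asymptotic_coeff_unique[OF l] by blast
qed

text \<open>The Wronskian G u - F v has derivative F g, because F and u belong to the same real l.
  At the left end F 0 = 0 leaves only the term with u 0.\<close>

lemma Green_boundary_value:
  fixes u v g :: "real \<Rightarrow> complex"
  assumes F: "solution l F G"
    and uv: "continuous_on {0..R} u" "continuous_on {0..R} v"
    and du: "\<And>x. 0 < x \<Longrightarrow> x < R \<Longrightarrow> (u has_vector_derivative v x / of_real (p x)) (at x)"
    and dv: "\<And>x. 0 < x \<Longrightarrow> x < R \<Longrightarrow> (v has_vector_derivative of_real (q x - l) * u x - g x) (at x)"
  shows "integral {0..R} (\<lambda>x. of_real (F x) * g x) = of_real (G R) * u R - of_real (F R) * v R - of_real (p 0) * u 0"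
proof -
  let ?W = "\<lambda>x. of_real (G x) * u x - of_real (F x) * v x"
  have "((\<lambda>x. of_real (F x) * g x) has_integral ?W R - ?W 0) {0..R}"
  proof (rule fundamental_theorem_of_calculus_interior)
    have "continuous_on {0..R} F" "continuous_on {0..R} G"
      using F by (auto simp: solution_def elim!: continuous_on_subset)
    then show "continuous_on {0..R} ?W" by (intro continuous_intros uv)
    fix x assume "x \<in> {0<..<R}"
    then have x: "0 < x" "x < R" by auto
    have dF: "((\<lambda>x. complex_of_real (F x)) has_vector_derivative of_real (G x / p x)) (at x)"
      and dG: "((\<lambda>x. complex_of_real (G x)) has_vector_derivative of_real ((q x - l) * F x)) (at x)"
      using F x by (intro has_vector_derivative_of_real,
        simp add: solution_def has_real_derivative_iff_has_vector_derivative)+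
    have "(?W has_vector_derivative
       (of_real (G x) * (v x / of_real (p x)) + of_real ((q x - l) * F x) * u x)
      - (of_real (F x) * (of_real (q x - l) * u x - g x) + of_real (G x / p x) * v x)) (at x)"
      by (intro has_vector_derivative_diff has_vector_derivative_mult dF dG du[OF x] dv[OF x])
    moreover have "(of_real (G x) * (v x / of_real (p x)) + of_real ((q x - l) * F x) * u x)
      - (of_real (F x) * (of_real (q x - l) * u x - g x) + of_real (G x / p x) * v x) = of_real (F x) * g x"
      by (simp add: algebra_simps)
    ultimately show "(?W has_vector_derivative of_real (F x) * g x) (at x)" by simp
  qed (use R in simp)
  then show ?thesis
    using F by (simp add: integral_unique solution_def)
qed

text \<open>U solves the equation classically except at R, where U and V are only known to be
  continuous; that is enough for the integration by parts to pass over R without a boundary term. At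
  0 the boundary terms vanish with U and \<phi>, at M with \<phi> and its derivative.\<close>

lemma weak_identity:
  fixes U V Q :: "real \<Rightarrow> complex"
  assumes U: "continuous_on {0..} U" "U \<in> L2" "U 0 = 0" and V: "continuous_on {0..} V" and Q: "Q \<in> L2"
    and dU: "\<And>x. x > 0 \<Longrightarrow> x \<noteq> R \<Longrightarrow> (U has_vector_derivative V x / of_real (p x)) (at x)"
    and dV: "\<And>x. x > 0 \<Longrightarrow> x \<noteq> R \<Longrightarrow> (V has_vector_derivative of_real (q x) * U x - Q x) (at x)"
    and \<phi>: "hl_test_function \<phi>" "\<phi> 0 = 0"
  shows "l2_inner U (sturm_liouville p q \<phi>) = l2_inner Q \<phi>"
proof -
  have s: "hl_smooth \<phi>" using \<phi> by (simp add: hl_test_function_def)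
  obtain M0 where M0: "\<And>x. x > M0 \<Longrightarrow> \<phi> x = 0" using \<phi> by (auto simp: hl_test_function_def)
  define M where "M = \<bar>M0\<bar> + 1"
  have M: "M > 0" "M > max 0 M0" by (auto simp: M_def)
  let ?S = "sturm_liouville p q \<phi>"
  define \<psi> where "\<psi> x = p x *\<^sub>R hl_deriv \<phi> x" for x
  note L = sturm_liouville_test_function(3,4)[OF p q \<phi>(1)]
  have z: "\<phi> x = 0" "\<psi> x = 0" "?S x = 0" if "x > max 0 M0" for x
  proof -
    show "\<phi> x = 0" using that M0[of x] by simp
    have "hl_deriv \<phi> x = 0" by (rule hl_deriv_zero_beyond[of M0]) (use M0 that in auto)
    then show "\<psi> x = 0" by (simp add: \<psi>_def)
    show "?S x = 0" by (rule sturm_liouville_test_function(2)[OF p q \<phi>(1), of M0]) (use M0 that in auto)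
  qed
  let ?h = "\<lambda>x. cnj (U x) * ?S x - cnj (Q x) * \<phi> x"
  let ?B = "\<lambda>x. cnj (V x) * \<phi> x - cnj (U x) * \<psi> x"
  have "(?h has_integral ?B M - ?B 0) {0..M}"
  proof (rule fundamental_theorem_of_calculus_interior_strong[of "{R}"])
    have "continuous_on {0..} \<phi>" "continuous_on {0..} \<psi>"
      unfolding \<psi>_def
      by (intro continuous_intros continuous_p order_refl differentiable_imp_continuous_on hl_smooth_imp s)+
    then have "continuous_on {0..} ?B" by (intro continuous_intros U V)
    then show "continuous_on {0..M} ?B" by (rule continuous_on_subset) auto
    fix x assume "x \<in> {0<..<M} - {R}"
    then have x: "x > 0" "x \<noteq> R" by auto
    then have px: "p x > 0" using p_pos by simp
    have d\<phi>: "(\<phi> has_vector_derivative hl_deriv \<phi> x) (at x)"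
      using x by (intro has_vector_derivative_at_of_Ici has_hl_deriv hl_smooth_imp s) auto
    have d\<psi>: "(\<psi> has_vector_derivative of_real (q x) * \<phi> x - ?S x) (at x)"
      using has_vector_derivative_at_of_Ici[OF sturm_liouville_expand(1)[OF p s], of x]
        sturm_liouville_expand(2)[OF p s, of x q] x
      unfolding \<psi>_def by (simp add: scaleR_conv_of_real)
    have "(?B has_vector_derivative
       (cnj (V x) * hl_deriv \<phi> x + cnj (of_real (q x) * U x - Q x) * \<phi> x)
       - (cnj (U x) * (of_real (q x) * \<phi> x - ?S x) + cnj (V x / of_real (p x)) * \<psi> x)) (at x)"
      by (intro has_vector_derivative_diff has_vector_derivative_mult has_vector_derivative_cnj d\<phi> d\<psi> dU dV x)
    moreover have "(cnj (V x) * hl_deriv \<phi> x + cnj (of_real (q x) * U x - Q x) * \<phi> x)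
       - (cnj (U x) * (of_real (q x) * \<phi> x - ?S x) + cnj (V x / of_real (p x)) * \<psi> x) = ?h x"
      using px by (simp add: \<psi>_def scaleR_conv_of_real algebra_simps)
    ultimately show "(?B has_vector_derivative ?h x) (at x)" by simp
  qed (use M in auto)
  moreover have "?B M - ?B 0 = 0" using z[OF M(2)] \<phi>(2) U(3) by simp
  ultimately have "(?h has_integral 0) {0..M}" by simp
  then have 0: "integral {0..M} ?h = 0" by (rule integral_unique)
  have i1: "integrable hl_measure (\<lambda>x. cnj (U x) * ?S x)" and i2: "integrable hl_measure (\<lambda>x. cnj (Q x) * \<phi> x)"
    by (intro L2_integrable_mult L U Q)+
  have "l2_inner U ?S - l2_inner Q \<phi> = integral\<^sup>L hl_measure ?h"
    unfolding l2_inner_def using i1 i2 by simp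
  also have "\<dots> = integral {0<..} ?h"
    by (rule lebesgue_integral_eq_integral) (use i1 i2 in auto)
  also have "\<dots> = integral {0..M} ?h"
  proof (rule integral_spike_set)
    show "negligible {x \<in> {0<..} - {0..M}. ?h x \<noteq> 0}"
      by (rule negligible_subset[of "{}"]) (use z M in force)+
    show "negligible {x \<in> {0..M} - {0<..}. ?h x \<noteq> 0}"
      by (rule negligible_subset[of "{0}"]) auto
  qed
  finally show ?thesis using 0 by simp
qed

end

lemma L2_normI:
  assumes "f \<in> borel_measurable hl_measure" "has_bochner_integral hl_measure (\<lambda>x. (norm (f x))\<^sup>2) N"
  shows "f \<in> L2" "(l2_norm f)\<^sup>2 = N"
  using assms by (auto simp: L2_def l2_norm_power2 has_bochner_integral_iff)

text \<open>The weights A and B let one computation serve both norms in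
  \<open>approximate_resolvent\<close>, that of the solution and that of its residual.\<close>

lemma has_bochner_integral_exponential_tail:
  fixes u :: "real \<Rightarrow> complex"
  assumes u: "continuous_on {0..R} u" and R: "R \<ge> 0" and \<delta>: "\<delta> > 0" and AB: "A \<ge> 0" "B \<ge> 0"
  shows "has_bochner_integral hl_measure
      (\<lambda>x. if x \<le> R then A * (norm (u x))\<^sup>2 else B * exp (- 2 * \<delta> * (x - R)))
      (A * integral {0..R} (\<lambda>x. (norm (u x))\<^sup>2) + B / (2 * \<delta>))"
proof -
  let ?h = "\<lambda>x. if x \<le> R then A * (norm (u x))\<^sup>2 else B * exp (- 2 * \<delta> * (x - R))"
  let ?I = "A * integral {0..R} (\<lambda>x. (norm (u x))\<^sup>2) + B / (2 * \<delta>)"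
  have "((\<lambda>x. (norm (u x))\<^sup>2) has_integral integral {0..R} (\<lambda>x. (norm (u x))\<^sup>2)) {0..R}"
    by (intro integrable_integral integrable_continuous_real continuous_intros u)
  then have "((\<lambda>x. A * (norm (u x))\<^sup>2) has_integral A * integral {0..R} (\<lambda>x. (norm (u x))\<^sup>2)) {0..R}"
    by (rule has_integral_mult_right)
  then have 1: "(?h has_integral A * integral {0..R} (\<lambda>x. (norm (u x))\<^sup>2)) {0..R}"
    by (rule has_integral_eq[rotated]) auto
  have "((\<lambda>x. B * exp (2 * \<delta> * R) * exp (- (2 * \<delta>) * x)) has_integral
      B * exp (2 * \<delta> * R) * (exp (- (2 * \<delta>) * R) / (2 * \<delta>))) {R..}"
    by (intro has_integral_mult_right has_integral_exp_minus_to_infinity) (use \<delta> in simp)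
  moreover have "B * exp (2 * \<delta> * R) * (exp (- (2 * \<delta>) * R) / (2 * \<delta>)) = B / (2 * \<delta>)"
    by (simp add: exp_minus)
  moreover have "B * exp (2 * \<delta> * R) * exp (- (2 * \<delta>) * x) = B * exp (- 2 * \<delta> * (x - R))" for x
    by (simp add: exp_add[symmetric] algebra_simps flip: mult.assoc)
  ultimately have "((\<lambda>x. B * exp (- 2 * \<delta> * (x - R))) has_integral B / (2 * \<delta>)) {R..}" by (simp only:)
  then have 2: "(?h has_integral B / (2 * \<delta>)) {R..}"
    by (rule has_integral_spike[of "{R}", rotated 2]) auto
  have "{0..R} \<inter> {R..} = {R}" "{0..R} \<union> {R..} = {0..}" using R by auto
  then have "(?h has_integral ?I) {0..}"
    using has_integral_Un[OF 1 2] by simp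
  then have 3: "(?h has_integral ?I) {0<..}"
  proof (rule has_integral_spike_set_eq[THEN iffD1, rotated 2])
    show "negligible {x \<in> {0..} - {0<..}. ?h x \<noteq> 0}"
      by (rule negligible_subset[of "{0}"]) auto
    show "negligible {x \<in> {0<..} - {0..}. ?h x \<noteq> 0}"
      by (rule negligible_subset[of "{0}"]) auto
  qed
  then have "?h absolutely_integrable_on {0<..}"
    using AB by (intro nonnegative_absolutely_integrable_1) (auto intro: has_integral_integrable)
  then have i: "integrable hl_measure ?h"
    by (simp add: set_integrable_def integrable_restrict_space)
  then have "integral\<^sup>L hl_measure ?h = integral {0<..} ?h"
    by (rule lebesgue_integral_eq_integral) simp
  also have "\<dots> = ?I" using 3 by (rule integral_unique)
  finally show ?thesis using i by (simp add: has_bochner_integral_iff)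
qed


section \<open>The approximate resolvent\<close>

context sturm_liouville_data
begin

text \<open>The resolvent equation at l + ie is solved only approximately: the solution follows the equation at
  the real point l on [0,R] and the decaying exponential beyond R, the amplitude a being chosen such that
  the boundary value at 0 vanishes.\<close>

lemma approximate_resolvent:
  assumes F: "solution l F G" and l: "l > 0" and \<delta>: "\<delta> > 0"
    and g: "continuous_on {0..} g" "\<And>x. x \<ge> R \<Longrightarrow> g x = 0" and m: "\<And>x. x \<in> {0..R} \<Longrightarrow> norm (g x) \<le> m"
    and L: "\<And>x. x \<in> {0..R} \<Longrightarrow> 1 / p x + \<bar>q x\<bar> + \<bar>l\<bar> \<le> L"
  defines "e \<equiv> 2 * sqrt l * \<delta>"
    and "s \<equiv> Complex (- \<delta>) (sqrt l)"
  defines "d \<equiv> of_real (G R) - s * of_real (F R)"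
  defines "a \<equiv> integral {0..R} (\<lambda>x. of_real (F x) * g x) / d"
  assumes d: "d \<noteq> 0"
  shows "\<exists>U r J. U \<in> L2 \<and> r \<in> L2 \<and>
    (\<forall>w w'. (w, w') \<in> dirichlet_operator p q \<longrightarrow>
      l2_inner U w' = l2_inner (lincomb 1 (lincomb 1 g 1 r) (Complex l e) U) w) \<and>
    0 \<le> J \<and> J \<le> ((norm a)\<^sup>2 * (1 + (norm s)\<^sup>2) + m\<^sup>2) * exp ((2 * L + 1) * R) * R \<and>
    (l2_norm U)\<^sup>2 = J + (norm a)\<^sup>2 / (2 * \<delta>) \<and>
    (l2_norm r)\<^sup>2 = e\<^sup>2 * J + \<delta> ^ 4 * (norm a)\<^sup>2 / (2 * \<delta>)"
proof -
  let ?M = "((norm a)\<^sup>2 * (1 + (norm s)\<^sup>2) + m\<^sup>2) * exp ((2 * L + 1) * R)"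
  have "continuous_on {0..R} g" using g(1) by (rule continuous_on_subset) auto
  from inhomogeneous_solution[OF this m L, of a s]
  obtain u v where uv: "continuous_on {0..R} u" "continuous_on {0..R} v" "u R = a" "v R = s * a"
    and du: "\<And>x. 0 < x \<Longrightarrow> x < R \<Longrightarrow> (u has_vector_derivative v x / of_real (p x)) (at x)"
    and dv: "\<And>x. 0 < x \<Longrightarrow> x < R \<Longrightarrow> (v has_vector_derivative of_real (q x - l) * u x - g x) (at x)"
    and M: "\<And>x. x \<in> {0..R} \<Longrightarrow> (norm (u x))\<^sup>2 \<le> ?M"
    by blast
  \<comment> \<open>This is the reason for the choice of a: the left side of Green's identity is a
    d, and with u R = a and v R = s a the terms at R add up to a d as well, which leaves p 0 times u
    0 equal to 0.\<close>
  have "integral {0..R} (\<lambda>x. of_real (F x) * g x) = a * d" using d by (simp add: a_def)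
  with Green_boundary_value[OF F uv(1,2) du dv] have "of_real (p 0) * u 0 = 0"
    unfolding uv(3,4) by (simp add: d_def algebra_simps)
  then have u0: "u 0 = 0" using p_pos[of 0] by simp
  define J where "J = integral {0..R} (\<lambda>x. (norm (u x))\<^sup>2)"
  have J0: "0 \<le> J" unfolding J_def by (rule integral_nonneg) (auto intro!: integrable_continuous_real continuous_intros uv)
  have J1: "J \<le> ?M * R"
  proof -
    have "norm J \<le> ?M * (R - 0)"
      unfolding J_def using R M by (intro integral_bound continuous_intros uv) auto
    then show ?thesis by simp
  qed
  define U where "U x = (if x \<le> R then u x else a * exp (s * of_real (x - R)))" for x
  define V where "V x = (if x \<le> R then v x else s * a * exp (s * of_real (x - R)))" for x
  \<comment> \<open>On [0,R] the equation is solved at l instead of l + i e, which costs -i e U.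
    Beyond R, -U'' = -s^2 U falls short of (l + i e) U by \<delta>^2 U.\<close>
  define r where "r x = (if x \<le> R then - \<i> * of_real e else - of_real (\<delta>\<^sup>2)) * U x" for x
  \<comment> \<open>Q is what the differential expression makes of U, piece by piece.\<close>
  define Q where "Q x = (if x \<le> R then of_real l * U x + g x else - s\<^sup>2 * U x)" for x
  have glue: "continuous_on {0..} (\<lambda>x. if x \<le> R then y x else y R * exp (s * of_real (x - R)))"
    if "continuous_on {0..R} y" for y :: "real \<Rightarrow> complex"
  proof -
    have "continuous_on ({0..R} \<union> {R..}) (\<lambda>x. if x \<le> R then y x else y R * exp (s * of_real (x - R)))"
      by (rule continuous_on_If) (use that in \<open>auto intro!: continuous_intros\<close>)
    moreover have "{0..R} \<union> {R..} = {0..}" using R by auto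
    ultimately show ?thesis by simp
  qed
  have Uc: "continuous_on {0..} U" and Vc: "continuous_on {0..} V"
    using glue[OF uv(1)] glue[OF uv(2)] unfolding uv(3,4) U_def V_def by simp_all
  note Um = hl_measurable_continuous[OF Uc]
  have Re_s: "Re s = - \<delta>" by (simp add: s_def)
  have nexp: "(norm (exp (s * of_real (x - R))))\<^sup>2 = exp (- 2 * \<delta> * (x - R))" for x
  proof -
    have "(norm (exp (s * of_real (x - R))))\<^sup>2 = (exp (- \<delta> * (x - R)))\<^sup>2"
      by (simp add: norm_exp_eq_Re Re_s)
    also have "\<dots> = exp (2 * (- \<delta> * (x - R)))" by (rule exp_double[symmetric])
    finally show ?thesis by (simp add: mult.assoc)
  qed
  have Un: "(norm (U x))\<^sup>2 = (if x \<le> R then 1 * (norm (u x))\<^sup>2 else (norm a)\<^sup>2 * exp (- 2 * \<delta> * (x - R)))" for x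
    unfolding nexp[symmetric] by (simp add: U_def norm_mult power_mult_distrib del: norm_exp_eq_Re)
  have "has_bochner_integral hl_measure (\<lambda>x. (norm (U x))\<^sup>2) (1 * J + (norm a)\<^sup>2 / (2 * \<delta>))"
    unfolding J_def Un by (rule has_bochner_integral_exponential_tail[OF uv(1) _ \<delta>]) (use R in auto)
  note U2 = L2_normI[OF Um this]
  have rm: "r \<in> borel_measurable hl_measure"
  proof -
    have [measurable]: "(\<lambda>x. x) \<in> borel_measurable hl_measure"
      by (intro measurable_restrict_space1) (simp add: measurable_completion)
    note Um [measurable]
    show ?thesis unfolding r_def by measurable
  qed
  have "has_bochner_integral hl_measure (\<lambda>x. (norm (r x))\<^sup>2) (e\<^sup>2 * J + \<delta> ^ 4 * (norm a)\<^sup>2 / (2 * \<delta>))"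
  proof -
    have "(norm (r x))\<^sup>2 = (if x \<le> R then e\<^sup>2 * (norm (u x))\<^sup>2 else \<delta> ^ 4 * (norm a)\<^sup>2 * exp (- 2 * \<delta> * (x - R)))" for x
      unfolding r_def norm_mult power_mult_distrib Un
      by (simp add: norm_mult power_mult_distrib norm_power flip: power_mult)
    then show ?thesis
      unfolding J_def
      by (simp only:) (rule has_bochner_integral_exponential_tail[OF uv(1) _ \<delta>], use R in auto)
  qed
  note r2 = L2_normI[OF rm this]
  have gL: "g \<in> L2" by (rule L2_continuous_compact_support[OF g(1), of R]) (use g(2) in auto)
  \<comment> \<open>The square of -\<delta> + i sqrt l has imaginary part -2 sqrt l \<delta>, which
    is where the value of e comes from.\<close>
  have s2: "s\<^sup>2 = - Complex l e + of_real (\<delta>\<^sup>2)"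
    using l by (simp add: s_def e_def complex_eq_iff power2_eq_square)
  have Qeq: "Q = lincomb 1 (lincomb 1 g 1 r) (Complex l e) U"
  proof
    fix x
    show "Q x = lincomb 1 (lincomb 1 g 1 r) (Complex l e) U x"
    proof (cases "x \<le> R")
      case True
      have "Complex l e = of_real l + \<i> * of_real e" by (simp add: complex_eq_iff)
      then show ?thesis using True by (simp add: Q_def r_def lincomb_def algebra_simps)
    next
      case False
      then show ?thesis unfolding Q_def s2 using g(2)[of x] by (simp add: r_def lincomb_def algebra_simps)
    qed
  qed
  have QL: "Q \<in> L2" unfolding Qeq using gL U2 r2 by simp
  have dexp: "((\<lambda>x. b * exp (s * of_real (x - R))) has_vector_derivative s * (b * exp (s * of_real (x - R)))) (at x)"
    for b x
  proof -
    have "((\<lambda>z. b * exp (s * (z - of_real R))) has_field_derivative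
        s * (b * exp (s * (of_real x - of_real R)))) (at (of_real x) within UNIV)"
      by (auto intro!: derivative_eq_intros)
    from has_vector_derivative_real_field[OF this] show ?thesis by simp
  qed
  have dU: "(U has_vector_derivative V x / of_real (p x)) (at x)"
    and dV: "(V has_vector_derivative of_real (q x) * U x - Q x) (at x)" if x: "x > 0" "x \<noteq> R" for x
  proof -
    have "(U has_vector_derivative V x / of_real (p x)) (at x) \<and> (V has_vector_derivative of_real (q x) * U x - Q x) (at x)"
    proof (cases "x < R")
      case True
      have "(U has_vector_derivative v x / of_real (p x)) (at x)"
        by (rule has_vector_derivative_transform_within_open[OF du, of x "{0<..<R}"]) (use x True in \<open>auto simp: U_def\<close>)
      moreover have "(V has_vector_derivative of_real (q x - l) * u x - g x) (at x)"
        by (rule has_vector_derivative_transform_within_open[OF dv, of x "{0<..<R}"]) (use x True in \<open>auto simp: V_def\<close>)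
      ultimately show ?thesis using True by (simp add: U_def V_def Q_def algebra_simps)
    next
      case False
      then have xR: "x > R" using x by simp
      have "(U has_vector_derivative s * (a * exp (s * of_real (x - R)))) (at x)"
        by (rule has_vector_derivative_transform_within_open[OF dexp, of "{R<..}"]) (use xR in \<open>auto simp: U_def\<close>)
      moreover have "(V has_vector_derivative s * (s * a * exp (s * of_real (x - R)))) (at x)"
        by (rule has_vector_derivative_transform_within_open[OF dexp, of "{R<..}"]) (use xR in \<open>auto simp: V_def\<close>)
      ultimately show ?thesis using xR far[of x] by (simp add: U_def V_def Q_def power2_eq_square mult_ac)
    qed
    then show "(U has_vector_derivative V x / of_real (p x)) (at x)"
      "(V has_vector_derivative of_real (q x) * U x - Q x) (at x)" by auto
  qed
  have U0: "U 0 = 0" using u0 R by (simp add: U_def)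
  have weak: "l2_inner U w' = l2_inner (lincomb 1 (lincomb 1 g 1 r) (Complex l e) U) w"
    if "(w, w') \<in> dirichlet_operator p q" for w w'
    unfolding Qeq[symmetric]
    by (rule dirichlet_operator_weak_eq[OF p q U2(1) QL weak_identity[OF Uc U2(1) U0 Vc QL dU dV] that])
  show ?thesis
    by (rule exI[of _ U], rule exI[of _ r], rule exI[of _ J])
      (use U2 r2 weak J0 J1 in auto)
qed

end


section \<open>The spectral density\<close>

context sturm_liouville_data
begin

lemma coeff_bound_uniform:
  obtains L where "L \<ge> 0" "\<And>x l. x \<in> {0..R} \<Longrightarrow> 0 < l \<Longrightarrow> l \<le> \<beta> \<Longrightarrow> 1 / p x + \<bar>q x\<bar> + \<bar>l\<bar> \<le> L"
proof -
  obtain L where "L \<ge> 0" and L: "\<forall>x\<in>{0..R}. 1 / p x + \<bar>q x\<bar> \<le> L" using coeff_bound by blast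
  then show ?thesis by (intro that[of "L + \<bar>\<beta>\<bar>"]) fastforce+
qed

lemma boundary_data_pos:
  assumes "solution l F G" "l > 0"
  shows "(F R)\<^sup>2 + (G R)\<^sup>2 > 0"
proof -
  obtain L where L: "\<And>x l'. x \<in> {0..R} \<Longrightarrow> 0 < l' \<Longrightarrow> l' \<le> l \<Longrightarrow> 1 / p x + \<bar>q x\<bar> + \<bar>l'\<bar> \<le> L"
    using coeff_bound_uniform[of l] by metis
  have "0 < (p 0)\<^sup>2" using p_pos[of 0] by simp
  also have "\<dots> \<le> ((F R)\<^sup>2 + (G R)\<^sup>2) * exp ((2 * L + 1) * R)"
    using assms L by (intro solution_bounds(1)) auto
  finally show ?thesis by (simp add: zero_less_mult_iff)
qed

text \<open>By the value of |c|^2 in \<open>solution_asymptotic_coeff\<close>, \<rho> l is the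
  squared modulus of the integral of F g divided by 4 sqrt l |c|^2. What remains for
  \<open>Stone_approximate\<close> is to make every constant uniform over
  [\<alpha>, \<beta>].\<close>

theorem spectral_density:
  assumes ab: "0 < \<alpha>" "\<alpha> < \<beta>"
    and E: "spectral_resolution (dirichlet_operator p q) E"
    and F: "\<And>l. l \<in> {\<alpha>..\<beta>} \<Longrightarrow> solution l (F l) (G l)"
    and g: "continuous_on {0..} g" "\<And>x. x \<ge> R \<Longrightarrow> g x = 0"
  defines "\<rho> \<equiv> \<lambda>l. sqrt l * ((norm (integral {0..R} (\<lambda>x. of_real (F l x) * g x)))\<^sup>2
      / ((G l R)\<^sup>2 + l * (F l R)\<^sup>2))"
  shows "set_integrable lborel {\<alpha>..\<beta>} \<rho>" "pi * (l2_norm (E {\<alpha>..\<beta>} g))\<^sup>2 = (LBINT l:{\<alpha>..\<beta>}. \<rho> l)"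
proof -
  interpret spectral E "dirichlet_operator p q"
    using E dirichlet_operator_L2 dirichlet_operator_lincomb[OF p q]
    by unfold_locales (auto simp: spectral_resolution_def)
  obtain L where L0: "L \<ge> 0" and L: "\<And>x l. x \<in> {0..R} \<Longrightarrow> 0 < l \<Longrightarrow> l \<le> \<beta> \<Longrightarrow> 1 / p x + \<bar>q x\<bar> + \<bar>l\<bar> \<le> L"
    using coeff_bound_uniform[of \<beta>] by metis
  define C where "C = exp ((2 * L + 1) * R)"
  have C: "C > 0" by (simp add: C_def)
  have gc: "continuous_on {0..R} g" using g(1) by (rule continuous_on_subset) auto
  obtain m where m: "\<And>x. x \<in> {0..R} \<Longrightarrow> norm (g x) \<le> m"
    using compact_imp_bounded[OF compact_continuous_image[OF gc compact_Icc]]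
    unfolding bounded_iff by blast
  have gL: "g \<in> L2" by (rule L2_continuous_compact_support[OF g(1), of R]) (use g(2) in auto)
  define I where "I l = integral {0..R} (\<lambda>x. of_real (F l x) * g x)" for l
  \<comment> \<open>The squared modulus of the denominator G - s F in
    \<open>approximate_resolvent\<close>, where s = -\<delta> + i sqrt l.\<close>
  define D where "D l \<delta> = (G l R + \<delta> * F l R)\<^sup>2 + l * (F l R)\<^sup>2" for l \<delta>
  define I0 where "I0 = p 0 * sqrt C * m * R"
  \<comment> \<open>At R the sum F^2 + G^2 is at least (p 0)^2 / C, and for 0 <= \<delta> <= 1 it is
    at most (2 + 3 / \<alpha>) D.\<close>
  define c0 where "c0 = (p 0)\<^sup>2 / C / (2 + 3 / \<alpha>)"
  have p0: "p 0 > 0" by (rule p_pos) simp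
  have c0: "c0 > 0" using p0 C ab by (simp add: c0_def add_pos_pos)
  have I: "norm (I l) \<le> I0" if l: "l \<in> {\<alpha>..\<beta>}" for l
  proof -
    have "norm (I l) \<le> p 0 * sqrt C * m * (R - 0)"
      unfolding I_def
    proof (rule integral_bound)
      have "continuous_on {0..R} (F l)" using F[OF l] by (auto simp: solution_def elim: continuous_on_subset)
      then show "continuous_on {0..R} (\<lambda>x. complex_of_real (F l x) * g x)" by (intro continuous_intros gc)
      fix x assume x: "x \<in> {0..R}"
      have "(F l x)\<^sup>2 \<le> (p 0)\<^sup>2 * C"
        unfolding C_def by (rule solution_bounds(2)[OF F[OF l] _ x]) (use l ab L in auto)
      then have "\<bar>F l x\<bar> \<le> sqrt ((p 0)\<^sup>2 * C)" using real_sqrt_le_mono[of "(F l x)\<^sup>2"] by simp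
      then have "\<bar>F l x\<bar> \<le> p 0 * sqrt C" using p0 by (simp add: real_sqrt_mult)
      then show "norm (complex_of_real (F l x) * g x) \<le> p 0 * sqrt C * m"
        unfolding norm_mult using m[OF x] p0 C by (intro mult_mono) auto
    qed (use R in simp)
    then show ?thesis by (simp add: I0_def)
  qed
  have D: "c0 \<le> D l \<delta>" if l: "l \<in> {\<alpha>..\<beta>}" and \<delta>: "0 \<le> \<delta>" "\<delta> \<le> 1" for l \<delta>
  proof -
    have "(p 0)\<^sup>2 \<le> ((F l R)\<^sup>2 + (G l R)\<^sup>2) * C"
      unfolding C_def by (rule solution_bounds(1)[OF F[OF l]]) (use l ab L in auto)
    then have 1: "(p 0)\<^sup>2 / C \<le> (F l R)\<^sup>2 + (G l R)\<^sup>2" using C by (simp add: field_simps)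
    \<comment> \<open>The right side minus the left side is (G + 2 \<delta> F)^2.\<close>
    have "(G l R)\<^sup>2 \<le> 2 * (G l R + \<delta> * F l R)\<^sup>2 + 2 * (\<delta> * F l R)\<^sup>2"
      using zero_le_power2[of "G l R + 2 * (\<delta> * F l R)"] by (simp add: power2_eq_square algebra_simps)
    also have "(\<delta> * F l R)\<^sup>2 \<le> (F l R)\<^sup>2"
      using \<delta> by (simp add: power_mult_distrib mult_left_le_one_le power_le_one)
    finally have 2: "(F l R)\<^sup>2 + (G l R)\<^sup>2 \<le> 2 * (G l R + \<delta> * F l R)\<^sup>2 + 3 * (F l R)\<^sup>2" by simp
    have "\<alpha> * (F l R)\<^sup>2 \<le> l * (F l R)\<^sup>2" using l by (intro mult_right_mono) auto
    also have "\<dots> \<le> D l \<delta>" by (simp add: D_def)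
    finally have 3: "(F l R)\<^sup>2 \<le> D l \<delta> / \<alpha>" using ab by (simp add: field_simps)
    have 4: "(G l R + \<delta> * F l R)\<^sup>2 \<le> D l \<delta>" using l ab by (simp add: D_def)
    have "(p 0)\<^sup>2 / C \<le> 2 * D l \<delta> + 3 * (D l \<delta> / \<alpha>)"
      using 1 2 3 4 by linarith
    also have "\<dots> = D l \<delta> * (2 + 3 / \<alpha>)" by (simp add: algebra_simps)
    finally show ?thesis unfolding c0_def using ab by (subst pos_divide_le_eq) (auto intro: add_pos_pos)
  qed
  \<comment> \<open>A will bound |a|^2, M the energy J on [0,R] by way of |s|^2 = \<delta>^2 + l <=
    \<beta> + 1, and K the quotient |r|^2 / e^2; all three are independent of l and e.\<close>
  define A where "A = I0\<^sup>2 / c0"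
  have A0: "A \<ge> 0" using c0 by (simp add: A_def)
  define M where "M = (A * (1 + (\<beta> + 1)) + m\<^sup>2) * C * R"
  have M0: "M \<ge> 0" unfolding M_def using A0 C R ab by (intro mult_nonneg_nonneg add_nonneg_nonneg) auto
  \<comment> \<open>For e < e0 the rate \<delta> = e / (2 sqrt l) is at most 1 for every l >=
    \<alpha>.\<close>
  define e0 where "e0 = 2 * sqrt \<alpha>"
  have e0: "e0 > 0" using ab by (simp add: e0_def)
  define K where "K = M + A / (8 * \<alpha>)"
  \<comment> \<open>This collects the input of \<open>Stone_approximate\<close>, with J replaced by
    its bound M; the last clause says that e |U|^2 is sqrt l |a|^2 up to e M.\<close>
  define P where "P l e U r \<longleftrightarrow> U \<in> L2 \<and> r \<in> L2 \<and>
    (\<forall>w w'. (w, w') \<in> dirichlet_operator p q \<longrightarrow>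
      l2_inner U w' = l2_inner (lincomb 1 (lincomb 1 g 1 r) (Complex l e) U) w) \<and>
    (l2_norm r)\<^sup>2 \<le> K * e\<^sup>2 \<and>
    \<bar>e * (l2_norm U)\<^sup>2 - sqrt l * ((norm (I l))\<^sup>2 / D l (e / (2 * sqrt l)))\<bar> \<le> e * M" for l e U r
  have ex: "\<exists>U r. P l e U r" if l: "l \<in> {\<alpha>..\<beta>}" and e: "0 < e" "e < e0" for l e
  proof -
    define \<delta> where "\<delta> = e / (2 * sqrt l)"
    have l0: "l > 0" using l ab by simp
    have e\<delta>: "2 * sqrt l * \<delta> = e" using l0 by (simp add: \<delta>_def)
    have "e \<le> 2 * sqrt l"
      using e l real_sqrt_le_mono[of \<alpha> l] unfolding e0_def by (simp del: real_sqrt_le_iff)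
    then have \<delta>: "0 < \<delta>" "\<delta> \<le> 1" using e l0 by (auto simp: \<delta>_def field_simps)
    define s where "s = Complex (- \<delta>) (sqrt l)"
    define d where "d = complex_of_real (G l R) - s * of_real (F l R)"
    have nd: "(norm d)\<^sup>2 = D l \<delta>"
      unfolding cmod_power2 d_def s_def D_def using l0 by (simp add: power_mult_distrib)
    have nd0: "(norm d)\<^sup>2 > 0" using D[OF l, of \<delta>] \<delta> c0 unfolding nd by simp
    then have d0: "d \<noteq> 0" by auto
    define a where "a = I l / d"
    have na: "(norm a)\<^sup>2 = (norm (I l))\<^sup>2 / D l \<delta>" by (simp add: a_def norm_divide power_divide nd)
    have aA: "(norm a)\<^sup>2 \<le> A"
      unfolding na A_def using I[OF l] D[OF l, of \<delta>] \<delta> c0 by (intro frac_le power_mono) auto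
    have ns: "(norm s)\<^sup>2 \<le> \<beta> + 1"
    proof -
      have "(norm s)\<^sup>2 = \<delta>\<^sup>2 + l" using l0 by (simp add: s_def cmod_power2)
      also have "\<delta>\<^sup>2 \<le> 1" using \<delta> by (simp add: power_le_one)
      finally show ?thesis using l by simp
    qed
    have "\<exists>U r J. U \<in> L2 \<and> r \<in> L2 \<and>
      (\<forall>w w'. (w, w') \<in> dirichlet_operator p q \<longrightarrow>
        l2_inner U w' = l2_inner (lincomb 1 (lincomb 1 g 1 r) (Complex l e) U) w) \<and>
      0 \<le> J \<and> J \<le> ((norm a)\<^sup>2 * (1 + (norm s)\<^sup>2) + m\<^sup>2) * exp ((2 * L + 1) * R) * R \<and>
      (l2_norm U)\<^sup>2 = J + (norm a)\<^sup>2 / (2 * \<delta>) \<and>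
      (l2_norm r)\<^sup>2 = e\<^sup>2 * J + \<delta> ^ 4 * (norm a)\<^sup>2 / (2 * \<delta>)"
      unfolding a_def I_def d_def s_def e\<delta>[symmetric]
      by (rule approximate_resolvent[OF F[OF l] l0 \<delta>(1) g m])
        (use l l0 L d0 in \<open>auto simp: d_def s_def\<close>)
    then obtain U r J where U: "U \<in> L2" and r: "r \<in> L2" and
      weak: "\<forall>w w'. (w, w') \<in> dirichlet_operator p q \<longrightarrow>
        l2_inner U w' = l2_inner (lincomb 1 (lincomb 1 g 1 r) (Complex l e) U) w" and
      J: "0 \<le> J" "J \<le> ((norm a)\<^sup>2 * (1 + (norm s)\<^sup>2) + m\<^sup>2) * C * R" and
      Un: "(l2_norm U)\<^sup>2 = J + (norm a)\<^sup>2 / (2 * \<delta>)" and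
      rn: "(l2_norm r)\<^sup>2 = e\<^sup>2 * J + \<delta> ^ 4 * (norm a)\<^sup>2 / (2 * \<delta>)"
      unfolding C_def by blast
    have JM: "J \<le> M"
      using J(2) unfolding M_def
      by (rule order_trans) (use aA ns A0 C R ab in \<open>intro mult_right_mono add_mono mult_mono; auto\<close>)
    have "e * (l2_norm U)\<^sup>2 = e * J + sqrt l * (norm a)\<^sup>2"
      unfolding Un e\<delta>[symmetric] using \<delta> by (simp add: field_simps)
    then have 1: "\<bar>e * (l2_norm U)\<^sup>2 - sqrt l * ((norm (I l))\<^sup>2 / D l (e / (2 * sqrt l)))\<bar> \<le> e * M"
      unfolding \<delta>_def[symmetric] na using J(1) JM e by (simp add: mult_left_mono)
    \<comment> \<open>Splitting \<delta>^4 / (2 \<delta>) as \<delta>^2 \<delta> / 2 and using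
      \<delta>^2 <= e^2 / (4 \<alpha>) and \<delta> <= 1 gives the summand A / (8 \<alpha>) of
      K.\<close>
    have "(l2_norm r)\<^sup>2 = e\<^sup>2 * J + \<delta>\<^sup>2 * \<delta> * (norm a)\<^sup>2 / 2"
      unfolding rn using \<delta> by (simp add: field_simps power2_eq_square eval_nat_numeral)
    also have "\<delta>\<^sup>2 * \<delta> * (norm a)\<^sup>2 / 2 \<le> (e\<^sup>2 / (4 * \<alpha>)) * 1 * A / 2"
    proof (intro divide_right_mono mult_mono aA \<delta>(2))
      have "\<delta>\<^sup>2 = e\<^sup>2 / (4 * l)" using l0 by (simp add: \<delta>_def power_divide power_mult_distrib)
      also have "\<dots> \<le> e\<^sup>2 / (4 * \<alpha>)" using l ab by (intro divide_left_mono) auto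
      finally show "\<delta>\<^sup>2 \<le> e\<^sup>2 / (4 * \<alpha>)" .
    qed (use \<delta> ab in auto)
    also have "e\<^sup>2 * J \<le> e\<^sup>2 * M" using JM by (intro mult_left_mono) auto
    finally have "(l2_norm r)\<^sup>2 \<le> K * e\<^sup>2" using ab by (simp add: K_def field_simps)
    with U r weak 1 have "P l e U r" unfolding P_def by blast
    then show ?thesis by blast
  qed
  define u where "u l e = (SOME U. \<exists>r. P l e U r)" for l e
  define r where "r l e = (SOME r. P l e (u l e) r)" for l e
  have ur: "P l e (u l e) (r l e)" if "l \<in> {\<alpha>..\<beta>}" "0 < e" "e < e0" for l e
  proof -
    have "\<exists>r. P l e (u l e) r" unfolding u_def by (rule someI_ex[OF ex[OF that]])
    then show ?thesis unfolding r_def by (rule someI_ex)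
  qed
  have \<rho>: "\<rho> l = sqrt l * ((norm (I l))\<^sup>2 / D l 0)" for l
    by (simp add: \<rho>_def I_def D_def)
  have lim: "((\<lambda>e. e * (l2_norm (u l e))\<^sup>2) \<longlongrightarrow> \<rho> l) (at_right 0)" if l: "l \<in> {\<alpha>..\<beta>}" for l
  proof -
    let ?\<Phi> = "\<lambda>e. sqrt l * ((norm (I l))\<^sup>2 / D l (e / (2 * sqrt l)))"
    have id: "((\<lambda>e. e) \<longlongrightarrow> (0::real)) (at_right 0)" by (rule tendsto_ident_at)
    have "(?\<Phi> \<longlongrightarrow> sqrt l * ((norm (I l))\<^sup>2 / D l (0 / (2 * sqrt l)))) (at_right 0)"
      unfolding D_def using D[OF l, of 0] c0 l ab
      by (intro tendsto_intros id) (auto simp: D_def)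
    then have 1: "(?\<Phi> \<longlongrightarrow> \<rho> l) (at_right 0)" by (simp add: \<rho>)
    have "((\<lambda>e. e * (l2_norm (u l e))\<^sup>2 - ?\<Phi> e) \<longlongrightarrow> 0) (at_right 0)"
    proof (rule Lim_null_comparison)
      have "\<forall>\<^sub>F e in at_right 0. 0 < e \<and> e < e0" using e0 by (auto simp: eventually_at_right_field)
      then show "\<forall>\<^sub>F e in at_right 0. norm (e * (l2_norm (u l e))\<^sup>2 - ?\<Phi> e) \<le> e * M"
        by eventually_elim (use ur[OF l] in \<open>auto simp: P_def\<close>)
      have "((\<lambda>e. e * M) \<longlongrightarrow> 0 * M) (at_right 0)" by (intro tendsto_intros id)
      then show "((\<lambda>e. e * M) \<longlongrightarrow> 0) (at_right 0)" by simp
    qed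
    from tendsto_add[OF this 1] show ?thesis by simp
  qed
  have bound: "e * (l2_norm (u l e))\<^sup>2 \<le> e0 * M + sqrt \<beta> * A" if l: "l \<in> {\<alpha>..\<beta>}" and e: "0 < e" "e < e0" for l e
  proof -
    have "e * (l2_norm (u l e))\<^sup>2 \<le> e * M + sqrt l * ((norm (I l))\<^sup>2 / D l (e / (2 * sqrt l)))"
      using ur[OF l e] by (auto simp: P_def abs_le_iff)
    also have "\<dots> \<le> e0 * M + sqrt \<beta> * A"
    proof (intro add_mono mult_mono)
      have "e \<le> 2 * sqrt l"
        using e l real_sqrt_le_mono[of \<alpha> l] unfolding e0_def by (simp del: real_sqrt_le_iff)
      then have \<delta>: "0 \<le> e / (2 * sqrt l)" "e / (2 * sqrt l) \<le> 1" using e l ab by auto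
      show "(norm (I l))\<^sup>2 / D l (e / (2 * sqrt l)) \<le> A"
        unfolding A_def using I[OF l] D[OF l \<delta>] c0 by (intro frac_le power_mono) auto
      show "0 \<le> (norm (I l))\<^sup>2 / D l (e / (2 * sqrt l))" using D[OF l \<delta>] c0 by auto
    qed (use e e0 l ab M0 in auto)
    finally show ?thesis .
  qed
  note S = Stone_approximate[OF ab(2) e0 gL, of u r K \<rho> "e0 * M + sqrt \<beta> * A"]
  show "set_integrable lborel {\<alpha>..\<beta>} \<rho>"
    by (rule S(1)) (use ur lim bound in \<open>auto simp: P_def\<close>)
  show "pi * (l2_norm (E {\<alpha>..\<beta>} g))\<^sup>2 = (LBINT l:{\<alpha>..\<beta>}. \<rho> l)"
    by (rule S(2)) (use ur lim bound in \<open>auto simp: P_def\<close>)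
qed

end

section \<open>Polarization and the formula for two functions\<close>

lemma cnj_mult_polarization:
  "4 * (cnj a * b) = complex_of_real ((norm (b + a))\<^sup>2 - (norm (b + - 1 * a))\<^sup>2)
    + \<i> * complex_of_real ((norm (b + \<i> * a))\<^sup>2 - (norm (b + - \<i> * a))\<^sup>2)"
  unfolding cmod_power2 by (simp add: complex_eq_iff power2_eq_square algebra_simps)

text \<open>The combinations h + z g with z = 1, -1, i, -i are those of
  \<open>cnj_mult_polarization\<close>, so that the norms on the operator side and the densities on
  the integral side match term by term.\<close>

lemma (in pvm) E_polarization:
  assumes S: "S \<in> sets borel" and L: "g \<in> L2" "h \<in> L2"
  shows "4 * l2_inner g (E S h) =
     complex_of_real ((l2_norm (E S (lincomb 1 h 1 g)))\<^sup>2 - (l2_norm (E S (lincomb 1 h (-1) g)))\<^sup>2)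
    + \<i> * complex_of_real ((l2_norm (E S (lincomb 1 h \<i> g)))\<^sup>2 - (l2_norm (E S (lincomb 1 h (- \<i>) g)))\<^sup>2)"
proof -
  have n: "(l2_norm (E S (lincomb 1 h z g)))\<^sup>2 =
      (l2_norm (E S h))\<^sup>2 + 2 * Re (z * l2_inner (E S h) (E S g)) + (norm z)\<^sup>2 * (l2_norm (E S g))\<^sup>2" for z
  proof -
    have "l2_norm (E S (lincomb 1 h z g)) = l2_norm (lincomb 1 (E S h) z (E S g))"
      by (rule l2_norm_eqI) (use S L in \<open>auto simp: E_lincomb l2_inner_lincomb\<close>)
    then show ?thesis using S L by (simp add: l2_norm_lincomb_power2)
  qed
  have "l2_inner g (E S h) = cnj (l2_inner (E S h) (E S g))"
    using S L by (simp add: cnj_l2_inner E_inner E_E)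
  then show ?thesis unfolding n by (simp add: complex_eq_iff)
qed

theorem theorem3p17:
  fixes p q :: "real \<Rightarrow> real" and g h :: "real \<Rightarrow> complex"
    and \<alpha> \<beta> :: real
    and P :: "(real \<Rightarrow> complex) \<Rightarrow> (real \<Rightarrow> complex)"
    and F :: "real \<Rightarrow> real \<Rightarrow> real"
  assumes "hl_smooth p" and "hl_smooth q"
    and "\<And>x. x \<ge> 0 \<Longrightarrow> p x > 0"
    and "\<forall>\<^sub>F x in at_top. p x = 1 \<and> q x = 0"
    and "hl_test_function g" and "hl_test_function h"
    and "0 < \<alpha>" and "\<alpha> < \<beta>"
    and "spectral_projection (dirichlet_operator p q) {\<alpha>..\<beta>} P"
    and "\<And>l. l \<in> {\<alpha>..\<beta>} \<Longrightarrow> regular_solution p q l (F l)"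
  shows "\<exists>c :: real \<Rightarrow> complex.
    (\<forall>l\<in>{\<alpha>..\<beta>}. c l \<noteq> 0 \<and> (\<forall>z. asymptotic_coeff l (F l) z \<longleftrightarrow> z = c l)) \<and>
    set_integrable lborel {\<alpha>..\<beta>}
      (\<lambda>l. l2_inner g (\<lambda>x. complex_of_real (F l x)) * l2_inner (\<lambda>x. complex_of_real (F l x)) h
            * complex_of_real (1 / (cmod (c l))\<^sup>2 * (1 / sqrt l))) \<and>
    l2_inner g (P h) = complex_of_real (1 / (4 * pi)) *
      (LBINT l:{\<alpha>..\<beta>}.
         l2_inner g (\<lambda>x. complex_of_real (F l x)) * l2_inner (\<lambda>x. complex_of_real (F l x)) h
            * complex_of_real (1 / (cmod (c l))\<^sup>2 * (1 / sqrt l)))"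
proof -
  obtain N where N: "\<And>x. x \<ge> N \<Longrightarrow> p x = 1 \<and> q x = 0"
    using assms(4) by (auto simp: eventually_at_top_linorder)
  obtain Rg where Rg: "\<And>x. x > Rg \<Longrightarrow> g x = 0" using assms(5) by (auto simp: hl_test_function_def)
  obtain Rh where Rh: "\<And>x. x > Rh \<Longrightarrow> h x = 0" using assms(6) by (auto simp: hl_test_function_def)
  \<comment> \<open>g and h are known to vanish only strictly beyond Rg and Rh; the added 1 puts R
    strictly beyond both, so they vanish from R on, and makes R positive.\<close>
  define R where "R = \<bar>N\<bar> + \<bar>Rg\<bar> + \<bar>Rh\<bar> + 1"
  have Rb: "R > 0" "R \<ge> N" "R > Rg" "R > Rh" by (auto simp: R_def)
  interpret sturm_liouville_data p q R
    by unfold_locales (use assms(1-3) Rb N in auto)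
  obtain E where E: "spectral_resolution (dirichlet_operator p q) E" and P: "P = E {\<alpha>..\<beta>}"
    using assms(9) by (auto simp: spectral_projection_def)
  interpret pvm E by unfold_locales (use E in \<open>simp add: spectral_resolution_def\<close>)
  define G where "G l x = p x *\<^sub>R hl_deriv (F l) x" for l x
  have sol: "solution l (F l) (G l)" if "l \<in> {\<alpha>..\<beta>}" for l
    unfolding G_def using regular_solution_imp[OF assms(10)[OF that]] .
  have l0: "l > 0" if "l \<in> {\<alpha>..\<beta>}" for l using that assms(7) by simp
  \<comment> \<open>Selecting the coefficient together with its modulus turns it into a function of
    l and keeps the value of |c l|^2 at hand.\<close>
  define c where "c l = (SOME c. c \<noteq> 0 \<and> (norm c)\<^sup>2 = ((G l R)\<^sup>2 + l * (F l R)\<^sup>2) / (4 * l) \<and>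
      (\<forall>z. asymptotic_coeff l (F l) z \<longleftrightarrow> z = c))" for l
  have c: "c l \<noteq> 0 \<and> (norm (c l))\<^sup>2 = ((G l R)\<^sup>2 + l * (F l R)\<^sup>2) / (4 * l) \<and>
      (\<forall>z. asymptotic_coeff l (F l) z \<longleftrightarrow> z = c l)" if l: "l \<in> {\<alpha>..\<beta>}" for l
    unfolding c_def
    by (rule someI_ex[OF solution_asymptotic_coeff[OF sol[OF l] l0[OF l] boundary_data_pos[OF sol[OF l] l0[OF l]]]])
  define I where "I f l = integral {0..R} (\<lambda>x. complex_of_real (F l x) * f x)" for f l
  have tc: "continuous_on {0..} f" if "hl_test_function f" for f :: "real \<Rightarrow> complex"
    using that hl_smooth_imp(1) by (auto simp: hl_test_function_def intro: differentiable_imp_continuous_on)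
  have Fc: "continuous_on {0..R} (F l)" if "l \<in> {\<alpha>..\<beta>}" for l
    using sol[OF that] by (auto simp: solution_def elim: continuous_on_subset)
  have inner: "l2_inner (\<lambda>x. complex_of_real (F l x)) f = I f l"
    if l: "l \<in> {\<alpha>..\<beta>}" and f: "continuous_on {0..} f" "\<And>x. x > R \<Longrightarrow> f x = 0" for l f
  proof -
    have "has_bochner_integral hl_measure (\<lambda>x. complex_of_real (F l x) * f x) (I f l)"
      unfolding I_def
      by (rule hl_integral_compact_support)
        (use f R in \<open>auto intro!: continuous_intros Fc[OF l] elim: continuous_on_subset\<close>)
    then show ?thesis by (simp add: l2_inner_def has_bochner_integral_integral_eq)
  qed
  note cg = tc[OF assms(5)] and ch = tc[OF assms(6)]
  have zg: "g x = 0" and zh: "h x = 0" if "x \<ge> R" for x using that Rb Rg[of x] Rh[of x] by simp_all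
  have gL: "g \<in> L2" and hL: "h \<in> L2"
    by (rule L2_continuous_compact_support[OF cg, of R], use zg in auto)
      (rule L2_continuous_compact_support[OF ch, of R], use zh in auto)
  \<comment> \<open>The density belonging to h + z g, written with |c l| in place of the data at
    R.\<close>
  define \<rho> where "\<rho> z l = (norm (I h l + z * I g l))\<^sup>2 * (1 / (4 * ((norm (c l))\<^sup>2 * sqrt l)))" for z l
  have \<rho>: "set_integrable lborel {\<alpha>..\<beta>} (\<rho> z) \<and>
      pi * (l2_norm (E {\<alpha>..\<beta>} (lincomb 1 h z g)))\<^sup>2 = (LBINT l:{\<alpha>..\<beta>}. \<rho> z l)" for z
  proof -
    have fc: "continuous_on {0..} (lincomb 1 h z g)"
      unfolding lincomb_def by (intro continuous_intros cg ch)
    have fz: "lincomb 1 h z g x = 0" if "x \<ge> R" for x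
      using zg[OF that] zh[OF that] by (simp add: lincomb_def)
    have eq: "\<rho> z l = sqrt l * ((norm (integral {0..R} (\<lambda>x. of_real (F l x) * lincomb 1 h z g x)))\<^sup>2
       / ((G l R)\<^sup>2 + l * (F l R)\<^sup>2))" if l: "l \<in> {\<alpha>..\<beta>}" for l
    proof -
      have i: "(\<lambda>x. complex_of_real (F l x) * f x) integrable_on {0..R}" if "continuous_on {0..} f" for f
        by (intro integrable_continuous_real continuous_intros Fc[OF l])
          (use that in \<open>auto elim: continuous_on_subset\<close>)
      have "integral {0..R} (\<lambda>x. of_real (F l x) * lincomb 1 h z g x)
         = integral {0..R} (\<lambda>x. of_real (F l x) * h x + z * (of_real (F l x) * g x))"
        by (simp add: lincomb_def algebra_simps)
      also have "\<dots> = I h l + z * I g l"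
        unfolding I_def using i[OF ch] i[OF cg]
        by (subst Henstock_Kurzweil_Integration.integral_add) (auto intro: integrable_on_mult_right)
      finally have 1: "integral {0..R} (\<lambda>x. of_real (F l x) * lincomb 1 h z g x) = I h l + z * I g l" .
      have 2: "(G l R)\<^sup>2 + l * (F l R)\<^sup>2 = 4 * l * (norm (c l))\<^sup>2"
        using c[OF l] l0[OF l] by (simp add: field_simps)
      \<comment> \<open>With s = sqrt l and C = |c l|^2 this trades sqrt l / (4 l) for 1 / (4 sqrt
        l).\<close>
      have "s * (X / (4 * (s * s) * C)) = X * (1 / (4 * (C * s)))" if "s > 0" for s X C :: real
        using that by (simp add: field_simps)
      from this[of "sqrt l"] show ?thesis unfolding 1 2 \<rho>_def using l0[OF l] by simp
    qed
    note S = spectral_density[OF assms(7,8) E sol fc fz]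
    have "set_integrable lborel {\<alpha>..\<beta>} (\<rho> z)"
      using S(1) by (subst set_integrable_cong[OF refl refl eq]) auto
    moreover have "pi * (l2_norm (E {\<alpha>..\<beta>} (lincomb 1 h z g)))\<^sup>2 = (LBINT l:{\<alpha>..\<beta>}. \<rho> z l)"
      by (rule trans[OF S(2)]) (auto intro!: set_lebesgue_integral_cong simp: eq)
    ultimately show ?thesis ..
  qed
  define K where "K l = l2_inner g (\<lambda>x. complex_of_real (F l x)) * l2_inner (\<lambda>x. complex_of_real (F l x)) h
            * complex_of_real (1 / (cmod (c l))\<^sup>2 * (1 / sqrt l))" for l
  have K: "K l = complex_of_real (\<rho> 1 l - \<rho> (-1) l) + \<i> * complex_of_real (\<rho> \<i> l - \<rho> (-\<i>) l)"
    if l: "l \<in> {\<alpha>..\<beta>}" for l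
  proof -
    have "l2_inner g (\<lambda>x. complex_of_real (F l x)) = cnj (I g l)"
      using inner[OF l cg] zg cnj_l2_inner[of "\<lambda>x. complex_of_real (F l x)" g] by simp
    moreover have "l2_inner (\<lambda>x. complex_of_real (F l x)) h = I h l"
      using inner[OF l ch] zh by simp
    ultimately have "K l = 4 * (cnj (I g l) * I h l) * complex_of_real (1 / (4 * ((norm (c l))\<^sup>2 * sqrt l)))"
      by (simp add: K_def)
    also have "\<dots> = complex_of_real (\<rho> 1 l - \<rho> (-1) l) + \<i> * complex_of_real (\<rho> \<i> l - \<rho> (-\<i>) l)"
      unfolding cnj_mult_polarization \<rho>_def by (simp add: algebra_simps)
    finally show ?thesis .
  qed
  have \<rho>i: "set_integrable lborel {\<alpha>..\<beta>} (\<lambda>l. complex_of_real (\<rho> z l - \<rho> z' l))" for z z'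
  proof -
    have "set_integrable lborel {\<alpha>..\<beta>} (\<lambda>l. \<rho> z l - \<rho> z' l)"
      using \<rho> by (intro set_integral_diff) auto
    then have "integrable lborel (\<lambda>l. complex_of_real (indicator {\<alpha>..\<beta>} l *\<^sub>R (\<rho> z l - \<rho> z' l)))"
      unfolding set_integrable_def by (rule integrable_of_real)
    then show ?thesis by (simp add: set_integrable_def scaleR_conv_of_real)
  qed
  have \<rho>I: "(LBINT l:{\<alpha>..\<beta>}. complex_of_real (\<rho> z l - \<rho> z' l)) =
     complex_of_real (pi * (l2_norm (E {\<alpha>..\<beta>} (lincomb 1 h z g)))\<^sup>2 - pi * (l2_norm (E {\<alpha>..\<beta>} (lincomb 1 h z' g)))\<^sup>2)" for z z'
    unfolding set_integral_complex_of_real using \<rho>[of z] \<rho>[of z']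
    by (subst set_integral_diff) auto
  have Ki: "set_integrable lborel {\<alpha>..\<beta>} K"
    using \<rho>i by (subst set_integrable_cong[OF refl refl K]) (auto intro!: set_integral_add)
  have "(LBINT l:{\<alpha>..\<beta>}. K l) =
     (LBINT l:{\<alpha>..\<beta>}. complex_of_real (\<rho> 1 l - \<rho> (-1) l) + \<i> * complex_of_real (\<rho> \<i> l - \<rho> (-\<i>) l))"
    by (rule set_lebesgue_integral_cong) (use K in auto)
  also have "\<dots> = (LBINT l:{\<alpha>..\<beta>}. complex_of_real (\<rho> 1 l - \<rho> (-1) l))
      + \<i> * (LBINT l:{\<alpha>..\<beta>}. complex_of_real (\<rho> \<i> l - \<rho> (-\<i>) l))"
    using \<rho>i by (subst set_integral_add) auto
  \<comment> \<open>Each of the four densities integrates to pi times a squared norm, and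
    polarization contributes 4; hence the constant 1 / (4 pi).\<close>
  also have "\<dots> = of_real pi * (4 * l2_inner g (P h))"
    unfolding \<rho>I P using gL hL by (subst E_polarization) (auto simp: algebra_simps)
  finally have "l2_inner g (P h) = complex_of_real (1 / (4 * pi)) * (LBINT l:{\<alpha>..\<beta>}. K l)"
    by simp
  with Ki c show ?thesis
    unfolding K_def by (intro exI[of _ c]) blast
qed

end
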